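(* Let $g_1,\dots,g_m:T\times\mathbb{R}^n\times\mathbb{R}^q\to\mathbb{R}\cup\{+\infty\}$ be normal integrands, let $\Phi(t,x,z):=(g_1(t,x,z),\dots,g_m(t,x,z))^\top$, let $G:\mathbb{R}^n\rightrightarrows\mathbb{R}^q$ have closed graph, and let $$F(x):=\{z\in\mathbb{R}^q:\ \mathrm{E}_\Phi(x,z)\le0,\ z\in G(x)\}.$$ Let $(\bar x,\bar z)\in\operatorname{gph}F$, and suppose that the functions $g_i$ are locally Lipschitzian around $(\bar x,\bar z)$ and convex with respect to the second variable $z$. Assume also that: (a) The set $G(\bar x)$ is convex, and $\operatorname{gph}G$ is normally regular at $(\bar x,\bar z)$. (b) There exists $z_0\in G(\bar x)\setminus\{\bar z\}$ such that $\mathrm{E}_{g_i}(\bar x,z_0)<0$ for all $i=1,\dots,m$, and $\mathrm{E}_{g_i}(\bar x,\bar z)=0$ for all $i=1,\dots,m$. Then for all $z^*\in\mathbb{R}^q$ and all $x^*\in D^*F(\bar x,\bar z)(z^* )$ there exist $y^*\in N(\mathrm{E}_\Phi(\bar x,\bar z);\mathbb{R}^m_-)$ and $(u^*,v^* )\in\mathbb{R}^n\times\mathbb{R}^q$ with $-u^*\in D^*G(\bar x,\bar z)(v^* )$ such that $$\begin{pmatrix}x^*+u^*\\-z^*+v^*\end{pmatrix}\in\int_T\partial\langle y^*,\Phi_t\rangle(\bar x,\bar z)\,\mu(dt).$$ If in addition $G$ is Lipschitz-like around $(\bar x,\bar z)$, then $F$ is Lipschitz-like around $(\bar x,\bar 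z)$.
   Context: $(T,\mathcal{A},\mu)$ is a complete finite measure space. A normal integrand $g:T\times\mathbb{R}^d\to\mathbb{R}\cup\{+\infty\}$ is an $\mathcal{A}\otimes\mathcal{B}(\mathbb{R}^d)$-measurable function with $g_t:=g(t,\cdot)$ lower semicontinuous for each $t$; here $d=n+q$. $\mathrm{E}_{g_i}(x,z):=\int_T g_i(t,x,z)\,\mu(dt)$ and $\mathrm{E}_\Phi=(\mathrm{E}_{g_1},\dots,\mathrm{E}_{g_m})^\top$; the inequality $\mathrm{E}_\Phi\le0$ is componentwise, and $\Phi_t:=\Phi(t,\cdot,\cdot)$. "Locally Lipschitzian around $(\bar x,\bar z)$" for an integrand $g$ means: there are $\eta>0$, $\ell\in L^1(T,\mathbb{R})$ and $\hat T\in\mathcal{A}$ with $\mu(T\setminus\hat T)=0$ such that for $t\in\hat T$, $g_t$ is finite and $\ell(t)$-Lipschitz on the closed ball $\mathbb{B}_\eta(\bar x,\bar z)$. "Convex with respect to the second variable" means $g_i(t,x,\cdot)$ is convex. Normal cones: for $C\subseteq\mathbb{R}^d$ and $x\in C$, $\hat N(x;C):=\{x^*:\limsup_{u\to x,\,u\in C}\langle x^*,u-x\rangle/\|u-x\|\le0\}$ (empty if $x\notin C$), and $N(x;C)$ is the set of all limits of sequences $x_k^*\in\hat N(x_k;C)$ with $x_k\to x$. $C$ is normally regular at $x\in C$ if $\hat N(x;C)=N(x;C)$. Coderivative: $D^*M(x,y)(y^* ):=\{x^*:(x^*,-y^* )\in N((x,y);\operatorname{gph}M)\}$ for $(x,y)\in\operatorname{gph}M$.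 Subdifferential: $\partial f(u):=\{u^*:(u^*,-1)\in N((u,f(u));\operatorname{epi}f)\}$, and $\langle y^*,\Phi_t\rangle(\cdot):=\langle y^*,\Phi_t(\cdot)\rangle$. Integrals of multifunctions are Aumann integrals (sets of integrals of integrable a.e. selections). A multifunction $F$ is Lipschitz-like around $(x,z)\in\operatorname{gph}F$ if there exist $\ell\ge0$ and neighborhoods $U$ of $x$, $V$ of $z$ with $F(u)\cap V\subseteq F(v)+\ell\|u-v\|\mathbb{B}$ for all $u,v\in U$, where $\mathbb{B}$ is the closed unit ball. *)

theory Defs
  imports "HOL-Analysis.Analysis"
begin

definition lsc :: "('a::topological_space \<Rightarrow> ereal) \<Rightarrow> bool" where
  "lsc f \<longleftrightarrow> (\<forall>u. f u \<le> Liminf (at u) f)"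

definition normal_integrand :: "'t measure \<Rightarrow> ('t \<Rightarrow> 'a::topological_space \<Rightarrow> ereal) \<Rightarrow> bool" where
  "normal_integrand M g \<longleftrightarrow>
     (\<lambda>(t, u). g t u) \<in> borel_measurable (M \<Otimes>\<^sub>M borel) \<and>
     (\<forall>t\<in>space M. (\<forall>u. g t u \<noteq> -\<infinity>) \<and> lsc (g t))"

(* Integral of an extended-real-valued function as (integral of the positive part) minus
   (integral of the negative part); e2ennreal truncates negative values to 0.  In ereal,
   \<infinity> - \<infinity> = \<infinity>, which is the usual convention for integral functionals.  The value is finite
   exactly for integrable functions. *)
definition ereal_integral :: "'t measure \<Rightarrow> ('t \<Rightarrow> ereal) \<Rightarrow> ereal" where
  "ereal_integral M f =
     enn2ereal (\<integral>\<^sup>+ t. e2ennreal (f t) \<partial>M) - enn2ereal (\<integral>\<^sup>+ t. e2ennreal (- f t) \<partial>M)"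

definition expected :: "'t measure \<Rightarrow> ('t \<Rightarrow> 'a \<Rightarrow> ereal) \<Rightarrow> 'a \<Rightarrow> ereal" where
  "expected M g u = ereal_integral M (\<lambda>t. g t u)"

definition expected_vec ::
  "'t measure \<Rightarrow> ('m::finite \<Rightarrow> 't \<Rightarrow> 'a \<Rightarrow> ereal) \<Rightarrow> 'a \<Rightarrow> ereal ^ 'm" where
  "expected_vec M g u = (\<chi> i. expected M (g i) u)"

(* real_of_ereal sends infinite values to 0; the Lipschitz clause is only about points where
   g t is finite. *)
definition locally_Lipschitzian_integrand ::
  "'t measure \<Rightarrow> ('t \<Rightarrow> 'a::metric_space \<Rightarrow> ereal) \<Rightarrow> 'a \<Rightarrow> bool" where
  "locally_Lipschitzian_integrand M g c \<longleftrightarrow>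
     (\<exists>\<eta> (l :: 't \<Rightarrow> real) T'. \<eta> > 0 \<and> integrable M l \<and>
        T' \<in> sets M \<and> emeasure M (space M - T') = 0 \<and>
        (\<forall>t\<in>T'. (\<forall>u\<in>cball c \<eta>. \<bar>g t u\<bar> \<noteq> \<infinity>) \<and>
                 (l t)-lipschitz_on (cball c \<eta>) (\<lambda>u. real_of_ereal (g t u))))"

(* Convexity of a function with values in (-\<infinity>, \<infinity>]; ereal has 0 * \<infinity> = 0, so the endpoint
   cases of the inequality are harmless. *)
definition ereal_convex :: "('a::real_vector \<Rightarrow> ereal) \<Rightarrow> bool" where
  "ereal_convex f \<longleftrightarrow>
     (\<forall>u v. \<forall>r\<in>{0..1}. f ((1 - r) *\<^sub>R u + r *\<^sub>R v) \<le> ereal (1 - r) * f u + ereal r * f v)"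

(* At an isolated point of C the filter is bot and Limsup is -\<infinity>, so every vector is normal. *)
definition regular_normal_cone :: "'a::real_inner \<Rightarrow> 'a set \<Rightarrow> 'a set" where
  "regular_normal_cone x C =
     {xs. x \<in> C \<and> Limsup (at x within C) (\<lambda>u. ereal (inner xs (u - x) / norm (u - x))) \<le> 0}"

definition normal_cone :: "'a::real_inner \<Rightarrow> 'a set \<Rightarrow> 'a set" where
  "normal_cone x C =
     {xs. \<exists>X Xs. X \<longlonglongrightarrow> x \<and> Xs \<longlonglongrightarrow> xs \<and> (\<forall>k::nat. Xs k \<in> regular_normal_cone (X k) C)}"

definition normally_regular :: "'a::real_inner set \<Rightarrow> 'a \<Rightarrow> bool" where
  "normally_regular C x \<longleftrightarrow> x \<in> C \<and> regular_normal_cone x C = normal_cone x C"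

definition gph :: "('a \<Rightarrow> 'b set) \<Rightarrow> ('a \<times> 'b) set" where
  "gph F = {(x, z). z \<in> F x}"

definition coderivative ::
  "('a::real_inner \<Rightarrow> 'b::real_inner set) \<Rightarrow> 'a \<Rightarrow> 'b \<Rightarrow> 'b \<Rightarrow> 'a set" where
  "coderivative F x y ys = {xs. (xs, - ys) \<in> normal_cone (x, y) (gph F)}"

definition epi :: "('a \<Rightarrow> ereal) \<Rightarrow> ('a \<times> real) set" where
  "epi f = {(u, a). f u \<le> ereal a}"

(* The limiting subdifferential, empty at points where f is not finite. *)
definition subdiff :: "('a::real_inner \<Rightarrow> ereal) \<Rightarrow> 'a \<Rightarrow> 'a set" where
  "subdiff f u = {us. \<bar>f u\<bar> \<noteq> \<infinity> \<and> (us, -1) \<in> normal_cone (u, real_of_ereal (f u)) (epi f)}"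

definition scalarization :: "real ^ 'm \<Rightarrow> ('m::finite \<Rightarrow> 'a \<Rightarrow> ereal) \<Rightarrow> 'a \<Rightarrow> ereal" where
  "scalarization y \<phi> u = (\<Sum>i\<in>UNIV. ereal (y $ i) * \<phi> i u)"

definition aumann_integral ::
  "'t measure \<Rightarrow> ('t \<Rightarrow> 'a::{banach, second_countable_topology} set) \<Rightarrow> 'a set" where
  "aumann_integral M S =
     {integral\<^sup>L M \<xi> | \<xi>. integrable M \<xi> \<and> (AE t in M. \<xi> t \<in> S t)}"

definition Lipschitz_like ::
  "('a::real_normed_vector \<Rightarrow> 'b::real_normed_vector set) \<Rightarrow> 'a \<Rightarrow> 'b \<Rightarrow> bool" where
  "Lipschitz_like F x z \<longleftrightarrow> (x, z) \<in> gph F \<and>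
     (\<exists>l U V. l \<ge> 0 \<and> open U \<and> x \<in> U \<and> open V \<and> z \<in> V \<and>
        (\<forall>u\<in>U. \<forall>v\<in>U. F u \<inter> V \<subseteq> {w + (l * norm (u - v)) *\<^sub>R b | w b. w \<in> F v \<and> b \<in> cball 0 1}))"

end

theory Submission
  imports Defs "HOL-Library.Diagonal_Subsequence"
begin

text \<open>A limiting normal to the graph of \<open>F\<close> is a limit of regular normals at nearby points of the graph, and a
regular normal \<open>v\<close> at a point \<open>u\<close> says that near \<open>u\<close>, up to a
multiple of the distance to \<open>u\<close> as small as desired, the linear function \<open>inner v\<close> is maximal on the graph at \<open>u\<close>. Two
regularizations turn this into a multiplier rule that involves the integrands.

Penalizing the squared positive parts of the expectations replaces the inequality constraints by a
weighted sum of the expectations with weights \<open>y \<ge> 0\<close> on the graph of \<open>G\<close> (\<open>penalty_multipliers\<close>). Replacing the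
weighted integrand by its Moreau envelope then moves differentiation inside the integral: the
expected envelope is smooth from above, and its gradient is the integral of proximal subgradients of
the integrand at measurably selected nearby points (\<open>fuzzy_sum_rule\<close>). As the envelope parameter tends to
infinity these integrals converge for a subsequence, and a Fatou lemma for vector-valued functions
(\<open>integral_cluster_selection\<close>) writes their limit as the integral of cluster points of the proximal
subgradients, that is, of limiting subgradients (\<open>limiting_sum_rule\<close>). The Fatou lemma holds on the atoms because
measurable functions are constant there, and on the atomless part by a theorem of Lyapunov type
(\<open>convexified_integral_selection\<close>).

The multipliers must stay bounded along the sequence. If they did not, dividing by their norms would
produce a nonzero \<open>y \<ge> 0\<close> and an integral \<open>p\<close> of subgradients of the weighted integrand such that \<open>- p\<close> is normal to
the graph of \<open>G\<close>. Let \<open>d\<close> be the direction from \<open>zbar\<close> to the Slater point. Normal regularity and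
convexity of \<open>G xbar\<close> give \<open>inner p (0, d) \<ge> 0\<close>, while convexity in the second variable bounds \<open>inner p (0, d)\<close> by a
nontrivial nonnegative combination of the (negative) values of the expectations at the Slater point
(\<open>multiplier_slater_bound\<close>).

The same bound shows that a horizontal normal \<open>(a, 0)\<close> to the graph of \<open>F\<close> has the multiplier \<open>0\<close>, so it
is already normal to the graph of \<open>G\<close>, and \<open>a = 0\<close> if \<open>G\<close> is Lipschitz-like. Mordukhovich's criterion
(\<open>Lipschitz_like_if_normal_cone_trivial\<close>) then gives the stability of \<open>F\<close>.\<close>

section \<open>Normals and approximate normals\<close>

text \<open>Clearing the denominator makes the condition meaningful at \<open>u = x\<close> too, so that isolated points of \<open>C\<close>
need no separate treatment.\<close>

lemma regular_normal_cone_iff: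
  fixes x v :: "'a::real_inner"
  shows "v \<in> regular_normal_cone x C \<longleftrightarrow>
    x \<in> C \<and> (\<forall>e>0. \<exists>d>0. \<forall>u\<in>C. norm (u - x) < d \<longrightarrow> inner v (u - x) \<le> e * norm (u - x))"
    (is "_ \<longleftrightarrow> _ \<and> ?R")
proof -
  let ?q = "\<lambda>u. inner v (u - x) / norm (u - x)"
  have quot: "?q u < e \<Longrightarrow> inner v (u - x) \<le> e * norm (u - x)" for u e
    by (cases "u = x") (auto simp: divide_less_eq)
  have "Limsup (at x within C) (\<lambda>u. ereal (?q u)) \<le> 0 \<longleftrightarrow>
      (\<forall>e>0. eventually (\<lambda>u. ?q u < e) (at x within C))" (is "?L \<longleftrightarrow> ?E")
  proof
    assume L: ?L
    show ?E
    proof (intro allI impI)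
      fix e :: real assume "e > 0"
      then have "Limsup (at x within C) (\<lambda>u. ereal (?q u)) < ereal e"
        using L le_less_trans[of _ 0 "ereal e"] by simp
      from Limsup_lessD[OF this] show "eventually (\<lambda>u. ?q u < e) (at x within C)" by simp
    qed
  next
    assume E: ?E
    have "Limsup (at x within C) (\<lambda>u. ereal (?q u)) \<le> 0 + ereal e" if "e > 0" for e
      using E that by (intro Limsup_bounded) (auto elim!: eventually_mono)
    then show ?L by (rule ereal_le_epsilon2) auto
  qed
  also have "?E \<longleftrightarrow> ?R"
  proof
    assume E: ?E
    show ?R
    proof (intro allI impI)
      fix e :: real assume "e > 0"
      with E obtain d where "d > 0" "\<forall>u\<in>C. u \<noteq> x \<and> dist u x < d \<longrightarrow> ?q u < e"
        unfolding eventually_at by blast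
      then have "\<forall>u\<in>C. norm (u - x) < d \<longrightarrow> inner v (u - x) \<le> e * norm (u - x)"
        using quot by (metis dist_norm inner_zero_right mult_zero_right norm_zero order_refl right_minus_eq)
      with \<open>d > 0\<close> show "\<exists>d>0. \<forall>u\<in>C. norm (u - x) < d \<longrightarrow> inner v (u - x) \<le> e * norm (u - x)"
        by blast
    qed
  next
    assume R: ?R
    show ?E
    proof (intro allI impI)
      fix e :: real assume "e > 0"
      then have "e / 2 > 0" by simp
      with R obtain d where "d > 0" and
        d: "\<forall>u\<in>C. norm (u - x) < d \<longrightarrow> inner v (u - x) \<le> e / 2 * norm (u - x)" by blast
      have "?q u < e" if "u \<in> C" "u \<noteq> x" "dist u x < d" for u
      proof -
        have "inner v (u - x) \<le> e / 2 * norm (u - x)" using d that by (simp add: dist_norm)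
        also have "\<dots> < e * norm (u - x)" using \<open>e > 0\<close> that by simp
        finally show ?thesis using that by (simp add: divide_less_eq)
      qed
      then show "eventually (\<lambda>u. ?q u < e) (at x within C)"
        unfolding eventually_at using \<open>d > 0\<close> by auto
    qed
  qed
  finally show ?thesis unfolding regular_normal_cone_def by simp
qed

text \<open>The \<open>\<epsilon>\<close>-normals of variational analysis, in the slightly stronger form in which the inequality holds
on a whole neighbourhood and not only for the upper limit.\<close>

definition approx_normal :: "real \<Rightarrow> 'a::real_inner \<Rightarrow> 'a set \<Rightarrow> 'a set" where
  "approx_normal e x C =
     {v. x \<in> C \<and> (\<exists>d>0. \<forall>u\<in>C. norm (u - x) < d \<longrightarrow> inner v (u - x) \<le> e * norm (u - x))}"

text \<open>Project \<open>y = x + l v\<close> onto \<open>C\<close> for a small \<open>l\<close>. At the projection \<open>p\<close> the vector \<open>(y - p) / l\<close> is a proximal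
normal, hence a regular one. Since \<open>p\<close> is at least as close to \<open>y\<close> as \<open>x\<close> is, the inequality
for \<open>v\<close> gives \<open>norm (p - x) \<le> 2 l e\<close>, and \<open>(y - p) / l\<close> differs from \<open>v\<close> by \<open>(x - p) / l\<close>.\<close>

lemma approx_normal_near_regular_normal:
  fixes x v c :: "'a::euclidean_space"
  assumes cl: "closed (C \<inter> cball c r)" and xb: "x \<in> ball c r" and v: "v \<in> approx_normal e x C"
    and "0 \<le> e" and "\<rho> > 0"
  obtains x' v' where "norm (x' - x) < \<rho>" "norm (v' - v) \<le> 2 * e" "v' \<in> regular_normal_cone x' C"
proof -
  from v obtain d where xC: "x \<in> C" and "d > 0" and
    d: "\<And>u. u \<in> C \<Longrightarrow> norm (u - x) < d \<Longrightarrow> inner v (u - x) \<le> e * norm (u - x)"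
    unfolding approx_normal_def by blast
  define s where "s = min (min d \<rho>) (r - norm (x - c))"
  have xr: "norm (x - c) < r" using xb by (simp add: dist_norm norm_minus_commute)
  have s: "s > 0" using \<open>d > 0\<close> \<open>\<rho> > 0\<close> xr by (simp add: s_def)
  \<comment> \<open>chosen so that \<open>2 * l * norm v < s\<close>, which also covers \<open>v = 0\<close>\<close>
  define l where "l = s / (2 * norm v + 1)"
  have np: "2 * norm v + 1 > 0" using norm_ge_zero[of v] by linarith
  have l: "l > 0" using s np by (simp add: l_def)
  have lv: "2 * (l * norm v) < s"
  proof -
    have "2 * norm v / (2 * norm v + 1) < 1" using np by (subst divide_less_eq_1) simp
    then have "s * (2 * norm v / (2 * norm v + 1)) < s * 1" using s by (intro mult_strict_left_mono)
    then show ?thesis by (simp add: l_def field_simps)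
  qed
  define y where "y = x + l *\<^sub>R v"
  obtain p where pD: "p \<in> C \<inter> cball c r" and
    pmin: "\<And>u. u \<in> C \<inter> cball c r \<Longrightarrow> dist y p \<le> dist y u"
  proof -
    have "x \<in> C \<inter> cball c r" using xC xb by simp
    then have "C \<inter> cball c r \<noteq> {}" by blast
    from distance_attains_inf[OF cl this, of y] show ?thesis using that by blast
  qed
  have "dist y p \<le> dist y x" using pmin xC xb by simp
  then have yp: "norm (p - y) \<le> l * norm v" "norm (x - y) = l * norm v"
    using l by (auto simp: y_def dist_norm norm_minus_commute)
  have "norm (p - x) \<le> norm (p - y) + norm (y - x)" by (metis diff_add_cancel add_diff_eq norm_triangle_ineq)
  then have px: "norm (p - x) < s" using yp lv by (simp add: norm_minus_commute)
  have key: "(norm (p - x))\<^sup>2 \<le> 2 * l * inner v (p - x)"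
  proof -
    have "(norm (p - y))\<^sup>2 \<le> (norm (x - y))\<^sup>2" using yp by (simp add: power_mono)
    moreover have "p - y = (p - x) - l *\<^sub>R v" "x - y = - (l *\<^sub>R v)" by (auto simp: y_def)
    ultimately show ?thesis
      by (simp add: power2_norm_eq_inner inner_diff_left inner_diff_right inner_commute algebra_simps)
        (simp add: power2_eq_square algebra_simps)
  qed
  have iv: "inner v (p - x) \<le> e * norm (p - x)" using d[of p] pD px by (simp add: s_def)
  have pxe: "norm (p - x) \<le> 2 * l * e"
  proof (cases "p = x")
    case True
    then show ?thesis using l \<open>0 \<le> e\<close> by simp
  next
    case False
    have "norm (p - x) * norm (p - x) \<le> 2 * l * inner v (p - x)" using key by (simp add: power2_eq_square)
    also have "\<dots> \<le> 2 * l * (e * norm (p - x))" using iv l by (intro mult_left_mono) auto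
    finally have "norm (p - x) * norm (p - x) \<le> (2 * l * e) * norm (p - x)" by (simp add: mult_ac)
    then show ?thesis using False by simp
  qed
  define v' where "v' = (1 / l) *\<^sub>R (y - p)"
  have "v' - v = (1 / l) *\<^sub>R (x - p)" using l by (simp add: v'_def y_def algebra_simps)
  then have "norm (v' - v) \<le> 2 * e" using pxe l by (simp add: norm_minus_commute pos_divide_le_eq mult_ac)
  moreover have "v' \<in> regular_normal_cone p C"
    unfolding regular_normal_cone_iff
  proof (intro conjI allI impI)
    show "p \<in> C" using pD by simp
    fix a :: real assume "a > 0"
    define dd where "dd = min (2 * l * a) (r - norm (p - c))"
    have "norm (p - c) \<le> norm (p - x) + norm (x - c)" by (metis diff_add_cancel add_diff_eq norm_triangle_ineq)
    then have pr: "norm (p - c) < r" using px by (simp add: s_def)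
    have "inner v' (u - p) \<le> a * norm (u - p)" if u: "u \<in> C" "norm (u - p) < dd" for u
    proof -
      have "norm (u - c) \<le> norm (u - p) + norm (p - c)" by (metis diff_add_cancel add_diff_eq norm_triangle_ineq)
      then have "u \<in> cball c r" using u by (simp add: dd_def dist_norm norm_minus_commute)
      then have "norm (p - y) \<le> norm (u - y)" using pmin[of u] u by (simp add: dist_norm norm_minus_commute)
      then have "(norm (p - y))\<^sup>2 \<le> (norm ((u - p) + (p - y)))\<^sup>2" by (simp add: power_mono)
      then have "2 * inner (y - p) (u - p) \<le> (norm (u - p))\<^sup>2"
        by (simp add: power2_norm_eq_inner inner_diff_left inner_diff_right inner_add_left inner_add_right
           inner_commute algebra_simps)
      then have "inner (y - p) (u - p) \<le> norm (u - p) * (norm (u - p) / 2)" by (simp add: power2_eq_square)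
      also have "\<dots> \<le> norm (u - p) * (l * a)" using u by (intro mult_left_mono) (auto simp: dd_def)
      finally show ?thesis using l by (simp add: v'_def pos_divide_le_eq mult_ac del: scaleR_diff_right scaleR_right_diff_distrib)
    qed
    moreover have "dd > 0" using l \<open>a > 0\<close> pr by (simp add: dd_def)
    ultimately show "\<exists>d>0. \<forall>u\<in>C. norm (u - p) < d \<longrightarrow> inner v' (u - p) \<le> a * norm (u - p)" by blast
  qed
  ultimately show ?thesis using px by (intro that[of p v']) (auto simp: s_def)
qed

text \<open>The limiting normal cone may be computed from approximate normals with vanishing error. Every
optimality condition below is turned into a statement about limiting normals in this way.\<close>

lemma normal_cone_limit_approx_normal:
  fixes x v c :: "'a::euclidean_space"
  assumes cl: "closed (C \<inter> cball x r)" and "r > 0" and e0: "\<And>k. 0 \<le> e k"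
    and X: "X \<longlonglongrightarrow> x" and V: "V \<longlonglongrightarrow> v" and e: "e \<longlonglongrightarrow> 0"
    and N: "\<And>k. V k \<in> approx_normal (e k) (X k) C"
  shows "v \<in> normal_cone x C"
proof -
  obtain k0 where k0: "\<And>k. k \<ge> k0 \<Longrightarrow> X k \<in> ball x r"
    using X \<open>r > 0\<close> unfolding lim_sequentially by (metis dist_commute mem_ball)
  have "\<exists>x' v'. norm (x' - X (k + k0)) < inverse (real (Suc k)) \<and> norm (v' - V (k + k0)) \<le> 2 * e (k + k0)
      \<and> v' \<in> regular_normal_cone x' C" for k
    using approx_normal_near_regular_normal[OF cl k0 N e0, of "k + k0" "inverse (real (Suc k))"]
    by (metis le_add2 inverse_positive_iff_positive of_nat_0_less_iff zero_less_Suc)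
  then obtain X' V' where
    X': "\<And>k. norm (X' k - X (k + k0)) < inverse (real (Suc k))" and
    V': "\<And>k. norm (V' k - V (k + k0)) \<le> 2 * e (k + k0)" and
    R: "\<And>k. V' k \<in> regular_normal_cone (X' k) C" by metis
  have "(\<lambda>k. X' k - X (k + k0)) \<longlonglongrightarrow> 0"
    using X' by (intro Lim_null_comparison[OF _ LIMSEQ_inverse_real_of_nat]) (auto intro: always_eventually less_imp_le)
  then have "X' \<longlonglongrightarrow> x" using tendsto_add[OF _ LIMSEQ_ignore_initial_segment[OF X, of k0]] by fastforce
  moreover have "(\<lambda>k. 2 * e (k + k0)) \<longlonglongrightarrow> 0"
    using tendsto_mult_right_zero[OF LIMSEQ_ignore_initial_segment[OF e]] by blast
  then have "(\<lambda>k. V' k - V (k + k0)) \<longlonglongrightarrow> 0"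
    using V' by (intro Lim_null_comparison[of "\<lambda>k. V' k - V (k + k0)" "\<lambda>k. 2 * e (k + k0)"]) auto
  then have "V' \<longlonglongrightarrow> v" using tendsto_add[OF _ LIMSEQ_ignore_initial_segment[OF V, of k0]] by fastforce
  ultimately show ?thesis unfolding normal_cone_def using R by blast
qed

section \<open>Support functions, faces and measurable selections\<close>

definition support_fun :: "'a::euclidean_space set \<Rightarrow> 'a \<Rightarrow> real" where
  "support_fun S c = (SUP v\<in>S. inner c v)"

definition face :: "'a::euclidean_space set \<Rightarrow> 'a \<Rightarrow> 'a set" where
  "face S c = {v \<in> S. inner c v = support_fun S c}"

lemma bdd_above_inner_compact: "compact S \<Longrightarrow> bdd_above ((\<lambda>v. inner c v) ` S)"
  for S :: "'a::euclidean_space set"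
  by (intro compact_imp_bounded bounded_imp_bdd_above compact_continuous_image continuous_intros)

lemma support_fun_upper: "compact S \<Longrightarrow> v \<in> S \<Longrightarrow> inner c v \<le> support_fun S c"
  unfolding support_fun_def by (intro cSUP_upper bdd_above_inner_compact)

lemma support_fun_attained:
  assumes "compact S" "S \<noteq> {}"
  obtains v where "v \<in> S" "inner c v = support_fun S c"
proof -
  obtain v where v: "v \<in> S" "\<And>w. w \<in> S \<Longrightarrow> inner c w \<le> inner c v"
    using continuous_attains_sup[OF assms continuous_on_inner[OF continuous_on_const continuous_on_id], of c]
    by auto
  then have "support_fun S c = inner c v"
    unfolding support_fun_def using assms(2) by (intro cSup_eq_maximum) auto
  with v that show ?thesis by simp
qed

lemma support_fun_le:
  assumes "compact S" "S \<noteq> {}" "\<And>v. v \<in> S \<Longrightarrow> inner c v \<le> a"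
  shows "support_fun S c \<le> a"
  using support_fun_attained[OF assms(1,2), of c] assms(3) by metis

lemma support_fun_singleton [simp]: "support_fun {v} c = inner c v"
  by (simp add: support_fun_def)

lemma abs_support_fun_le:
  assumes "compact S" "S \<noteq> {}" "\<And>v. v \<in> S \<Longrightarrow> norm v \<le> b"
  shows "\<bar>support_fun S c\<bar> \<le> norm c * b"
proof -
  obtain v where v: "v \<in> S" "inner c v = support_fun S c" by (rule support_fun_attained[OF assms(1,2)])
  have "\<bar>inner c v\<bar> \<le> norm c * norm v" by (rule Cauchy_Schwarz_ineq2)
  also have "\<dots> \<le> norm c * b" using assms(3) v(1) by (intro mult_left_mono) auto
  finally show ?thesis using v by simp
qed

lemma support_fun_diff_le:
  assumes "compact S" "S \<noteq> {}" "\<And>v. v \<in> S \<Longrightarrow> norm v \<le> b"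
  shows "support_fun S c - support_fun S d \<le> norm (c - d) * b"
proof -
  obtain v where v: "v \<in> S" "inner c v = support_fun S c" by (rule support_fun_attained[OF assms(1,2)])
  have "inner (c - d) v \<le> norm (c - d) * norm v" by (rule norm_cauchy_schwarz)
  also have "\<dots> \<le> norm (c - d) * b" using assms(3) v(1) by (intro mult_left_mono) auto
  finally show ?thesis using v support_fun_upper[OF assms(1) v(1), of d] by (simp add: inner_diff_left)
qed

lemma support_fun_scaleR:
  assumes "compact S" "S \<noteq> {}" "0 \<le> a"
  shows "support_fun S (a *\<^sub>R c) = a * support_fun S c"
proof (rule antisym)
  show "support_fun S (a *\<^sub>R c) \<le> a * support_fun S c"
    using assms by (intro support_fun_le) (auto intro: mult_left_mono support_fun_upper)
  obtain v where v: "v \<in> S" "inner c v = support_fun S c" by (rule support_fun_attained[OF assms(1,2)])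
  then show "a * support_fun S c \<le> support_fun S (a *\<^sub>R c)"
    using support_fun_upper[OF assms(1) v(1), of "a *\<^sub>R c"] by simp
qed

lemma face_subset: "face S c \<subseteq> S"
  by (auto simp: face_def)

lemma compact_face: "compact S \<Longrightarrow> compact (face S c)"
proof -
  assume "compact S"
  have "face S c = S \<inter> {v. inner c v = support_fun S c}" by (auto simp: face_def)
  then show ?thesis using \<open>compact S\<close> by (auto intro!: compact_Int_closed closed_hyperplane)
qed

lemma face_nonempty: "compact S \<Longrightarrow> S \<noteq> {} \<Longrightarrow> face S c \<noteq> {}"
  using support_fun_attained[of S c] by (auto simp: face_def)

text \<open>Danskin's formula: the derivative of the support function at \<open>c\<close> in the direction \<open>d\<close> is the value at \<open>d\<close> of
the support function of the face exposed by \<open>c\<close>. Written as the limit of a sequence of difference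
quotients, it transfers measurability from a multifunction to its faces, and it permits
differentiation under the integral sign.\<close>

lemma support_fun_face_limit:
  fixes S :: "'a::euclidean_space set"
  assumes "compact S" "S \<noteq> {}"
  shows "(\<lambda>n. real (Suc n) * (support_fun S (c + (1 / real (Suc n)) *\<^sub>R d) - support_fun S c))
           \<longlonglongrightarrow> support_fun (face S c) d"
    (is "?a \<longlonglongrightarrow> ?s")
proof -
  have lower: "?s \<le> ?a n" for n
  proof -
    obtain v where v: "v \<in> face S c" "inner d v = ?s"
      by (rule support_fun_attained[OF compact_face[OF assms(1)] face_nonempty[OF assms]])
    then have "inner (c + (1 / real (Suc n)) *\<^sub>R d) v \<le> support_fun S (c + (1 / real (Suc n)) *\<^sub>R d)"
      using assms by (intro support_fun_upper) (auto simp: face_def)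
    then show ?thesis using v by (simp add: face_def inner_add_left field_simps)
  qed
  obtain b where b: "\<And>v. v \<in> S \<Longrightarrow> norm v \<le> b"
    using compact_imp_bounded[OF assms(1)] by (auto simp: bounded_iff)
  have upper: "eventually (\<lambda>n. ?a n < ?s + e) sequentially" if "e > 0" for e
  proof -
    \<comment> \<open>on \<open>S'\<close> the value of \<open>c\<close> stays below its maximum by a gap \<open>g\<close>, so maximizers for directions close to \<open>c\<close> avoid \<open>S'\<close>\<close>
    define S' where "S' = S \<inter> {v. inner d v \<ge> ?s + e}"
    have "compact S'" unfolding S'_def using assms(1) by (intro compact_Int_closed closed_halfspace_ge)
    have ex: "\<exists>g>0. \<forall>v\<in>S'. inner c v \<le> support_fun S c - g"
    proof (cases "S' = {}")
      case True then show ?thesis by (auto intro: exI[of _ 1])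
    next
      case False
      obtain w where w: "w \<in> S'" "inner c w = support_fun S' c"
        by (rule support_fun_attained[OF \<open>compact S'\<close> False])
      have "inner c w \<noteq> support_fun S c"
      proof
        assume "inner c w = support_fun S c"
        then have "w \<in> face S c" using w by (auto simp: face_def S'_def)
        then have "inner d w \<le> ?s" by (intro support_fun_upper compact_face assms)
        then show False using w \<open>e > 0\<close> by (auto simp: S'_def)
      qed
      moreover have "inner c w \<le> support_fun S c" using w(1) support_fun_upper[OF assms(1), of w c] by (simp add: S'_def)
      ultimately have "support_fun S c - inner c w > 0" by simp
      moreover have "\<forall>v\<in>S'. inner c v \<le> inner c w" using w support_fun_upper[OF \<open>compact S'\<close>] by simp
      ultimately show ?thesis by (intro exI[of _ "support_fun S c - inner c w"]) auto
    qed
    then obtain g where g: "g > 0" "\<And>v. v \<in> S' \<Longrightarrow> inner c v \<le> support_fun S c - g" by blast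
    have "(\<lambda>n. 2 * (norm d * b) * (1 / real (Suc n))) \<longlonglongrightarrow> 2 * (norm d * b) * 0"
      by (intro tendsto_mult tendsto_const LIMSEQ_Suc lim_1_over_n)
    then have "eventually (\<lambda>n. 2 * (norm d * b) * (1 / real (Suc n)) < g) sequentially"
      using g(1) by (simp add: order_tendsto_iff)
    then show ?thesis
    proof (rule eventually_mono)
      fix n assume n: "2 * (norm d * b) * (1 / real (Suc n)) < g"
      let ?h = "1 / real (Suc n)" let ?c = "c + ?h *\<^sub>R d"
      obtain v where v: "v \<in> S" "inner ?c v = support_fun S ?c" by (rule support_fun_attained[OF assms])
      obtain w where w: "w \<in> S" "inner c w = support_fun S c" by (rule support_fun_attained[OF assms])
      have cs: "\<bar>inner d u\<bar> \<le> norm d * b" if "u \<in> S" for u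
        by (rule order_trans[OF Cauchy_Schwarz_ineq2]) (use b that in \<open>auto intro: mult_left_mono\<close>)
      have h: "?h > 0" by simp
      have "inner ?c w \<le> inner ?c v" using support_fun_upper[OF assms(1) w(1)] v(2) by simp
      then have "support_fun S c + ?h * inner d w \<le> inner c v + ?h * inner d v"
        using w by (simp add: inner_add_left)
      moreover have "?h * inner d v \<le> ?h * (norm d * b)" "?h * (- inner d w) \<le> ?h * (norm d * b)"
        using cs[OF v(1)] cs[OF w(1)] h by (intro mult_left_mono; simp)+
      moreover have "?h * (- inner d w) = - (?h * inner d w)"
        "2 * (norm d * b) * ?h = 2 * (?h * (norm d * b))" by simp_all
      ultimately have "inner c v > support_fun S c - g" using n by linarith
      then have "inner d v < ?s + e" using g(2)[of v] v(1) by (force simp: S'_def)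
      moreover have "?a n \<le> inner d v"
      proof -
        have "support_fun S ?c - support_fun S c \<le> ?h * inner d v"
          using support_fun_upper[OF assms(1) v(1), of c] v(2) by (simp add: inner_add_left)
        then have "real (Suc n) * (support_fun S ?c - support_fun S c) \<le> real (Suc n) * (?h * inner d v)"
          by (intro mult_left_mono) auto
        also have "\<dots> = inner d v" by simp
        finally show ?thesis .
      qed
      ultimately show "?a n < ?s + e" by simp
    qed
  qed
  show ?thesis
  proof (rule order_tendstoI)
    fix a assume "a < ?s"
    then show "eventually (\<lambda>n. a < ?a n) sequentially" using less_le_trans[OF _ lower] by simp
  next
    fix a assume "?s < a"
    then show "eventually (\<lambda>n. ?a n < a) sequentially" using upper[of "a - ?s"] by simp
  qed
qed

text \<open>Measurability of a compact-valued multifunction in terms of its support functions. They determine the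
values up to convex hulls only, which is enough to select extreme points measurably.\<close>

definition measurable_compact :: "'t measure \<Rightarrow> ('t \<Rightarrow> 'a::euclidean_space set) \<Rightarrow> bool" where
  "measurable_compact M L \<longleftrightarrow> (\<forall>t\<in>space M. compact (L t) \<and> L t \<noteq> {}) \<and>
     (\<forall>c. (\<lambda>t. support_fun (L t) c) \<in> borel_measurable M)"

lemma measurable_compact_face:
  assumes "measurable_compact M L"
  shows "measurable_compact M (\<lambda>t. face (L t) c)"
  unfolding measurable_compact_def
proof (intro conjI allI ballI)
  fix t assume "t \<in> space M"
  then show "compact (face (L t) c)" "face (L t) c \<noteq> {}"
    using assms by (auto simp: measurable_compact_def intro: compact_face dest: face_nonempty)
next
  fix d
  have [measurable]: "(\<lambda>t. support_fun (L t) c) \<in> borel_measurable M" for c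
    using assms by (simp add: measurable_compact_def)
  show "(\<lambda>t. support_fun (face (L t) c) d) \<in> borel_measurable M"
  proof (rule borel_measurable_LIMSEQ_real)
    fix t assume "t \<in> space M"
    then show "(\<lambda>n. real (Suc n) * (support_fun (L t) (c + (1 / real (Suc n)) *\<^sub>R d) - support_fun (L t) c))
        \<longlonglongrightarrow> support_fun (face (L t) c) d"
      using assms by (intro support_fun_face_limit) (auto simp: measurable_compact_def)
  qed measurable
qed

text \<open>Passing to the face exposed by one basis vector after the other fixes one coordinate at a time. What
remains is the lexicographic maximum of each value, and its coordinates are measurable because they
are values of support functions.\<close>

lemma measurable_selection:
  fixes L :: "'t \<Rightarrow> 'a::euclidean_space set"
  assumes "measurable_compact M L"
  obtains f where "f \<in> borel_measurable M" "\<And>t. t \<in> space M \<Longrightarrow> f t \<in> L t"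
proof -
  have "\<exists>L'. measurable_compact M L' \<and> (\<forall>t\<in>space M. L' t \<subseteq> L t \<and>
      (\<forall>b\<in>B. \<forall>v\<in>L' t. \<forall>w\<in>L' t. inner b v = inner b w))" if "finite B" for B
    using that
  proof (induction B rule: finite_induct)
    case empty
    then show ?case using assms by auto
  next
    case (insert b B)
    then obtain L' where L': "measurable_compact M L'" "\<forall>t\<in>space M. L' t \<subseteq> L t \<and>
      (\<forall>b\<in>B. \<forall>v\<in>L' t. \<forall>w\<in>L' t. inner b v = inner b w)" by blast
    show ?case
    proof (rule exI[of _ "\<lambda>t. face (L' t) b"], intro conjI ballI)
      show "measurable_compact M (\<lambda>t. face (L' t) b)" using L'(1) by (rule measurable_compact_face)
      fix t assume t: "t \<in> space M"
      show "face (L' t) b \<subseteq> L t" using L'(2) t face_subset by blast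
      fix b' v w assume "b' \<in> insert b B" "v \<in> face (L' t) b" "w \<in> face (L' t) b"
      then have "v \<in> L' t" "w \<in> L' t" "inner b v = inner b w" and b': "b' = b \<or> b' \<in> B"
        by (simp_all add: face_def)
      then show "inner b' v = inner b' w" using L'(2) t by metis
    qed
  qed
  from this[OF finite_Basis] obtain L' where L': "measurable_compact M L'"
    "\<And>t. t \<in> space M \<Longrightarrow> L' t \<subseteq> L t"
    "\<And>t b v w. t \<in> space M \<Longrightarrow> b \<in> Basis \<Longrightarrow> v \<in> L' t \<Longrightarrow> w \<in> L' t \<Longrightarrow> inner b v = inner b w"
    by blast
  have [measurable]: "(\<lambda>t. support_fun (L' t) b) \<in> borel_measurable M" for b
    using L'(1) by (simp add: measurable_compact_def)
  define f where "f t = (\<Sum>b\<in>Basis. support_fun (L' t) b *\<^sub>R b)" for t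
  have "f t \<in> L t" if t: "t \<in> space M" for t
  proof -
    have K: "compact (L' t)" "L' t \<noteq> {}" using L'(1) t by (auto simp: measurable_compact_def)
    then obtain v where v: "v \<in> L' t" by blast
    have "inner b v = support_fun (L' t) b" if b: "b \<in> Basis" for b
      using support_fun_attained[OF K, of b] L'(3)[OF t b v] by metis
    then have "f t = (\<Sum>b\<in>Basis. inner v b *\<^sub>R b)" by (simp add: f_def inner_commute)
    then show ?thesis using v L'(2)[OF t] by (auto simp: euclidean_representation)
  qed
  moreover have "f \<in> borel_measurable M" unfolding f_def by measurable
  ultimately show ?thesis using that by blast
qed

lemma dense_subset_compact:
  fixes K :: "'a::euclidean_space set"
  obtains D where "countable D" "D \<subseteq> K" "K \<subseteq> closure D"
  using separable[of K] by metis

text \<open>The minimizers of \<open>f t\<close> are the projection of the face of its graph exposed by \<open>(0, -1)\<close>, and the support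
function of the graph over \<open>K\<close> is a supremum over a countable dense subset of \<open>K\<close>.\<close>

lemma measurable_argmin:
  fixes f :: "'t \<Rightarrow> 'a::euclidean_space \<Rightarrow> real"
  assumes K: "compact K" "K \<noteq> {}"
    and cont: "\<And>t. t \<in> space M \<Longrightarrow> continuous_on K (f t)"
    and meas: "\<And>u. u \<in> K \<Longrightarrow> (\<lambda>t. f t u) \<in> borel_measurable M"
  obtains s where "s \<in> borel_measurable M" "(\<lambda>t. f t (s t)) \<in> borel_measurable M"
    "\<And>t. t \<in> space M \<Longrightarrow> s t \<in> K" "\<And>t u. t \<in> space M \<Longrightarrow> u \<in> K \<Longrightarrow> f t (s t) \<le> f t u"
proof -
  define L where "L t = (\<lambda>u. (u, f t u)) ` K" for t
  obtain D where D: "countable D" "D \<subseteq> K" "K \<subseteq> closure D" using dense_subset_compact by blast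
  have "D \<noteq> {}" using D K by auto
  have contL: "continuous_on K (\<lambda>u. (u, f t u))" if "t \<in> space M" for t
    using cont[OF that] by (intro continuous_intros)
  have cL: "compact (L t)" if "t \<in> space M" for t
    unfolding L_def using contL[OF that] K by (intro compact_continuous_image)
  have "measurable_compact M L"
    unfolding measurable_compact_def
  proof (intro conjI ballI allI)
    fix t assume "t \<in> space M"
    then show "compact (L t)" "L t \<noteq> {}" using cL K by (auto simp: L_def)
  next
    fix c :: "'a \<times> real"
    have eq: "support_fun (L t) c = (SUP u\<in>D. inner c (u, f t u))" if t: "t \<in> space M" for t
    proof (rule antisym)
      have bdd: "bdd_above ((\<lambda>u. inner c (u, f t u)) ` D)"
        by (rule bdd_above_mono[OF bdd_above_inner_compact[OF cL[OF t], of c]]) (use D in \<open>auto simp: L_def\<close>)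
      have "inner c (u, f t u) \<le> (SUP u\<in>D. inner c (u, f t u))" if "u \<in> K" for u
      proof -
        from that D(3) have "u \<in> closure D" by blast
        then obtain x where x: "\<And>n. x n \<in> D" "x \<longlonglongrightarrow> u" unfolding closure_sequential by blast
        have "\<forall>\<^sub>F n in sequentially. x n \<in> K" using x(1) D(2) by (auto intro: always_eventually)
        then have "(\<lambda>n. (x n, f t (x n))) \<longlonglongrightarrow> (u, f t u)"
          by (rule continuous_on_tendsto_compose[OF contL[OF t] x(2) that])
        then have "(\<lambda>n. inner c (x n, f t (x n))) \<longlonglongrightarrow> inner c (u, f t u)"
          by (rule tendsto_inner[OF tendsto_const])
        then show ?thesis using bdd x(1) by (intro LIMSEQ_le_const2) (auto intro!: cSUP_upper)
      qed
      then show "support_fun (L t) c \<le> (SUP u\<in>D. inner c (u, f t u))"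
        using cL[OF t] K by (intro support_fun_le) (auto simp: L_def)
      show "(SUP u\<in>D. inner c (u, f t u)) \<le> support_fun (L t) c"
        using \<open>D \<noteq> {}\<close> D cL[OF t] by (intro cSUP_least support_fun_upper) (auto simp: L_def)
    qed
    have "(\<lambda>t. SUP u\<in>D. inner c (u, f t u)) \<in> borel_measurable M"
    proof (rule borel_measurable_cSUP[OF D(1)])
      fix u assume "u \<in> D"
      then have [measurable]: "(\<lambda>t. f t u) \<in> borel_measurable M" using meas D by blast
      show "(\<lambda>t. inner c (u, f t u)) \<in> borel_measurable M" by measurable
    next
      fix t assume t: "t \<in> space M"
      show "bdd_above ((\<lambda>u. inner c (u, f t u)) ` D)"
        by (rule bdd_above_mono[OF bdd_above_inner_compact[OF cL[OF t], of c]]) (use D in \<open>auto simp: L_def\<close>)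
    qed
    then show "(\<lambda>t. support_fun (L t) c) \<in> borel_measurable M"
      using eq by (simp cong: measurable_cong)
  qed
  then obtain h where h: "h \<in> borel_measurable M" "\<And>t. t \<in> space M \<Longrightarrow> h t \<in> face (L t) (0, -1)"
    using measurable_selection[OF measurable_compact_face] by blast
  have h2: "fst (h t) \<in> K \<and> snd (h t) = f t (fst (h t)) \<and> (\<forall>u\<in>K. f t (fst (h t)) \<le> f t u)"
    if t: "t \<in> space M" for t
  proof -
    from h(2)[OF t] obtain u where u: "u \<in> K" "h t = (u, f t u)" "- f t u = support_fun (L t) (0, -1)"
      by (auto simp: face_def L_def)
    have "f t u \<le> f t u'" if "u' \<in> K" for u'
    proof -
      have "inner (0, -1) (u', f t u') \<le> support_fun (L t) (0, -1)"
        using that cL[OF t] by (intro support_fun_upper) (auto simp: L_def)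
      then show ?thesis using u(3) by simp
    qed
    with u show ?thesis by simp
  qed
  have "(\<lambda>t. fst (h t)) \<in> borel_measurable M" "(\<lambda>t. snd (h t)) \<in> borel_measurable M"
    by (intro borel_measurable_continuous_on[OF _ h(1)] continuous_intros)+
  moreover have "(\<lambda>t. f t (fst (h t))) \<in> borel_measurable M"
    using calculation(2) h2 by (simp cong: measurable_cong)
  ultimately show ?thesis using that[of "\<lambda>t. fst (h t)"] h2 by blast
qed

section \<open>Integrals of selections on atomless sets\<close>

text \<open>Greedy exhaustion: each set of a decreasing sequence in \<open>F\<close> is chosen with nearly the least measure
among the members of \<open>F\<close> below its predecessor; the intersection is essentially minimal.\<close>

lemma decreasing_family_minimal:
  assumes "finite_measure M" "A \<in> F" "F \<subseteq> sets M"
    and F_INT: "\<And>S :: nat \<Rightarrow> 't set. (\<And>n. S n \<in> F) \<Longrightarrow> decseq S \<Longrightarrow> (\<Inter>n. S n) \<in> F"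
  obtains B where "B \<in> F" "\<And>C. C \<in> F \<Longrightarrow> C \<subseteq> B \<Longrightarrow> measure M C = measure M B"
proof -
  interpret finite_measure M by fact
  define m where "m B = Inf (measure M ` {C \<in> F. C \<subseteq> B})" for B
  have m_le: "m B \<le> measure M C" if "C \<in> F" "C \<subseteq> B" for B C
    unfolding m_def using that by (intro cInf_lower bdd_belowI[of _ 0]) auto
  have "\<exists>S. \<forall>n. S n \<in> F \<and> (S (Suc n) \<subseteq> S n \<and> measure M (S (Suc n)) < m (S n) + 1 / real (Suc n))"
  proof (rule dependent_nat_choice)
    show "\<exists>x. x \<in> F" using assms by blast
    fix B n assume B: "B \<in> F"
    have "\<exists>x\<in>measure M ` {C \<in> F. C \<subseteq> B}. x < m B + 1 / real (Suc n)"
      unfolding m_def using B by (intro cInf_lessD) auto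
    then show "\<exists>C. C \<in> F \<and> (C \<subseteq> B \<and> measure M C < m B + 1 / real (Suc n))" by blast
  qed
  then obtain S where S: "\<And>n. S n \<in> F" "\<And>n. S (Suc n) \<subseteq> S n"
    "\<And>n. measure M (S (Suc n)) < m (S n) + 1 / real (Suc n)" by blast
  have "decseq S" using S(2) by (rule decseq_SucI)
  define B where "B = (\<Inter>n. S n)"
  have B: "B \<in> F" unfolding B_def using S(1) \<open>decseq S\<close> by (rule F_INT)
  have "measure M C = measure M B" if C: "C \<in> F" "C \<subseteq> B" for C
  proof (rule antisym)
    show "measure M C \<le> measure M B" using C B assms by (intro finite_measure_mono) auto
    have "measure M B \<le> measure M C + 1 / real (Suc n)" for n
    proof -
      have "measure M B \<le> measure M (S (Suc n))" using B S assms by (intro finite_measure_mono) (auto simp: B_def)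
      also have "\<dots> \<le> m (S n) + 1 / real (Suc n)" using S(3)[of n] by simp
      also have "m (S n) \<le> measure M C" using C by (intro m_le) (auto simp: B_def)
      finally show ?thesis by simp
    qed
    moreover have "(\<lambda>n. measure M C + 1 / real (Suc n)) \<longlonglongrightarrow> measure M C + 0"
      by (intro tendsto_add tendsto_const LIMSEQ_Suc lim_1_over_n)
    ultimately show "measure M B \<le> measure M C" using LIMSEQ_le_const by fastforce
  qed
  with B that show ?thesis by blast
qed

definition atomless_on :: "'t measure \<Rightarrow> 't set \<Rightarrow> bool" where
  "atomless_on M A0 \<longleftrightarrow> A0 \<in> sets M \<and> (\<forall>A\<in>sets M. A \<subseteq> A0 \<longrightarrow> 0 < measure M A \<longrightarrow>
     (\<exists>B\<in>sets M. B \<subseteq> A \<and> 0 < measure M B \<and> measure M B < measure M A))"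

text \<open>Nested halving drives the measure to zero, and by dominated convergence the integral of \<open>l\<close> too.\<close>

lemma atomless_small_subset:
  fixes l :: "'t \<Rightarrow> real"
  assumes "finite_measure M" "atomless_on M A0" "A \<in> sets M" "A \<subseteq> A0" "0 < measure M A"
    and l: "integrable M l" and "0 < g"
  obtains B where "B \<in> sets M" "B \<subseteq> A" "0 < measure M B" "(\<integral>t. indicator B t * l t \<partial>M) < g"
proof -
  interpret finite_measure M by fact
  let ?P = "\<lambda>B. B \<in> sets M \<and> B \<subseteq> A \<and> 0 < measure M B"
  have "\<exists>B. \<forall>n. ?P (B n) \<and> (B (Suc n) \<subseteq> B n \<and> measure M (B (Suc n)) \<le> measure M (B n) / 2)"
  proof (rule dependent_nat_choice)
    show "\<exists>B. ?P B" using assms by blast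
    fix B n assume B: "?P B"
    then obtain C where C: "C \<in> sets M" "C \<subseteq> B" "0 < measure M C" "measure M C < measure M B"
      using assms unfolding atomless_on_def by (meson subset_trans)
    have d: "measure M (B - C) = measure M B - measure M C" using B C by (intro finite_measure_Diff) auto
    show "\<exists>C. ?P C \<and> (C \<subseteq> B \<and> measure M C \<le> measure M B / 2)"
    proof (cases "measure M C \<le> measure M B / 2")
      case True then show ?thesis using B C by blast
    next
      case False
      then show ?thesis using B C d by (intro exI[of _ "B - C"]) auto
    qed
  qed
  then obtain B where B: "\<And>n. ?P (B n)" "\<And>n. B (Suc n) \<subseteq> B n"
    "\<And>n. measure M (B (Suc n)) \<le> measure M (B n) / 2" by blast
  have "decseq B" using B(2) by (rule decseq_SucI)
  have half: "measure M (B n) \<le> measure M (B 0) * (1/2) ^ n" for n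
  proof (induction n)
    case (Suc n) then show ?case using B(3)[of n] by simp
  qed simp
  define Z where "Z = (\<Inter>n. B n)"
  have Z: "Z \<in> sets M" using B(1) by (auto simp: Z_def)
  have "(\<lambda>n. measure M (B 0) * (1/2) ^ n) \<longlonglongrightarrow> measure M (B 0) * 0"
    by (intro tendsto_mult tendsto_const LIMSEQ_power_zero) simp
  moreover have "measure M Z \<le> measure M (B 0) * (1/2) ^ n" for n
    using half[of n] finite_measure_mono[of Z "B n"] B(1) by (fastforce simp: Z_def)
  ultimately have "measure M Z \<le> 0" using LIMSEQ_le_const by fastforce
  have [measurable]: "l \<in> borel_measurable M" "Z \<in> sets M" "\<And>n. B n \<in> sets M"
    using l Z B(1) by auto
  from \<open>measure M Z \<le> 0\<close> have "Z \<in> null_sets M" using Z by (simp add: null_sets_def emeasure_eq_measure antisym)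
  have "(\<lambda>n. \<integral>t. indicator (B n) t * l t \<partial>M) \<longlonglongrightarrow> (\<integral>t. indicator Z t * l t \<partial>M)"
  proof (rule integral_dominated_convergence[where w = "\<lambda>t. norm (l t)"])
    show "AE t in M. (\<lambda>n. indicator (B n) t * l t) \<longlonglongrightarrow> indicator Z t * l t"
      unfolding Z_def by (intro AE_I2 tendsto_mult tendsto_const LIMSEQ_indicator_decseq \<open>decseq B\<close>)
    show "(\<lambda>t. indicator Z t * l t) \<in> borel_measurable M" "(\<lambda>t. indicator (B n) t * l t) \<in> borel_measurable M" for n
      by measurable
    show "integrable M (\<lambda>t. norm (l t))" using l by simp
    show "AE t in M. norm (indicator (B n) t * l t) \<le> norm (l t)" for n
      by (auto simp: indicator_def)
  qed
  moreover have "(\<integral>t. indicator Z t * l t \<partial>M) = 0"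
    by (rule integral_eq_zero_AE)
      (use AE_not_in[OF \<open>Z \<in> null_sets M\<close>] in \<open>auto elim!: eventually_mono\<close>)
  ultimately have "\<forall>\<^sub>F n in sequentially. (\<integral>t. indicator (B n) t * l t \<partial>M) < g"
    using \<open>0 < g\<close> by (simp add: order_tendsto_iff)
  then obtain n where "(\<integral>t. indicator (B n) t * l t \<partial>M) < g"
    by (auto simp: eventually_sequentially)
  with B(1)[of n] that show ?thesis by blast
qed

lemma integrable_support_fun:
  fixes L :: "'t \<Rightarrow> 'a::euclidean_space set"
  assumes "measurable_compact M L" "integrable M l"
    and "\<And>t v. t \<in> space M \<Longrightarrow> v \<in> L t \<Longrightarrow> norm v \<le> l t"
  shows "integrable M (\<lambda>t. support_fun (L t) c)"
proof (rule Bochner_Integration.integrable_bound)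
  show "integrable M (\<lambda>t. norm c * l t)" using assms(2) by simp
  show "(\<lambda>t. support_fun (L t) c) \<in> borel_measurable M" using assms(1) by (simp add: measurable_compact_def)
  show "AE t in M. norm (support_fun (L t) c) \<le> norm (norm c * l t)"
  proof (rule AE_I2)
    fix t assume t: "t \<in> space M"
    then have "\<bar>support_fun (L t) c\<bar> \<le> norm c * l t"
      using assms(1,3) by (intro abs_support_fun_le) (auto simp: measurable_compact_def)
    then show "norm (support_fun (L t) c) \<le> norm (norm c * l t)" by simp
  qed
qed

lemma integrable_selection:
  fixes f :: "'t \<Rightarrow> 'a::euclidean_space"
  assumes "f \<in> borel_measurable M" "integrable M l" "\<And>t. t \<in> space M \<Longrightarrow> norm (f t) \<le> l t"
  shows "integrable M f"
  using assms(2,1) by (rule Bochner_Integration.integrable_bound) (use assms(3) in \<open>force intro: AE_I2\<close>)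

text \<open>A form of the theorems of Lyapunov and Aumann. The inequality for all \<open>c\<close> says that \<open>p\<close> belongs to the
integral of the convex hulls of the values of \<open>L\<close>; where \<open>L\<close> is not single-valued the measure has no atoms,
and then \<open>p\<close> is the integral of a selection of \<open>L\<close> itself.

The proof is by induction on the dimension of a space \<open>V\<close> containing all differences of points of the
same value. Fix a selection \<open>f0\<close> and use \<open>L\<close> on a set \<open>A \<subseteq> A0\<close> only, and \<open>{f0 t}\<close> elsewhere, where \<open>A\<close> is
essentially minimal among the sets for which the inequality survives. If \<open>V\<close> is trivial, \<open>f0\<close> has the
integral \<open>p\<close>. If equality holds for
some nonzero \<open>c\<close> in \<open>V\<close>, then \<open>p\<close> lies on the boundary, and the faces exposed by \<open>c\<close> still satisfy the inequality
by Danskin's formula, while their differences are orthogonal to \<open>c\<close>. If not, there is a uniform slack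
over the unit sphere of \<open>V\<close>, and a small set of positive measure could be removed from \<open>A\<close>; so \<open>A\<close> is a
null set, which contradicts the strict inequalities for \<open>c\<close> and \<open>- c\<close>.\<close>

lemma convexified_integral_selection:
  fixes L :: "'t \<Rightarrow> 'a::euclidean_space set" and p :: 'a
  assumes fin: "finite_measure M" and atl: "atomless_on M A0" and l: "integrable M l"
    and V: "subspace V" and L: "measurable_compact M L"
    and bound: "\<And>t v. t \<in> space M \<Longrightarrow> v \<in> L t \<Longrightarrow> norm v \<le> l t"
    and diffs: "\<And>t v w. t \<in> space M \<Longrightarrow> v \<in> L t \<Longrightarrow> w \<in> L t \<Longrightarrow> v - w \<in> V"
    and sing: "\<And>t v w. t \<in> space M - A0 \<Longrightarrow> v \<in> L t \<Longrightarrow> w \<in> L t \<Longrightarrow> v = w"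
    and p: "\<And>c. inner c p \<le> (\<integral>t. support_fun (L t) c \<partial>M)"
  shows "\<exists>f\<in>borel_measurable M. (\<forall>t\<in>space M. f t \<in> L t) \<and> integral\<^sup>L M f = p"
  using V L bound diffs sing p
proof (induction "dim V" arbitrary: V L rule: less_induct)
  case less
  note V = less.prems(1) and L = less.prems(2) and bound = less.prems(3) and diffs = less.prems(4)
    and sing = less.prems(5) and p = less.prems(6)
  interpret finite_measure M by fact
  have A0[measurable]: "A0 \<in> sets M" using atl by (simp add: atomless_on_def)
  have K: "compact (L t)" "L t \<noteq> {}" if "t \<in> space M" for t
    using L that by (auto simp: measurable_compact_def)
  have [measurable]: "(\<lambda>t. support_fun (L t) c) \<in> borel_measurable M" for c
    using L by (simp add: measurable_compact_def)
  obtain f0 where f0: "f0 \<in> borel_measurable M" "\<And>t. t \<in> space M \<Longrightarrow> f0 t \<in> L t"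
    using measurable_selection[OF L] by blast
  note f0(1)[measurable]
  have l0: "0 \<le> l t" if "t \<in> space M" for t
    using bound[OF that f0(2)[OF that]] norm_ge_zero order_trans by blast
  have if0: "integrable M f0" using f0 bound by (intro integrable_selection[OF _ l]) auto
  \<comment> \<open>\<open>s c\<close> is the excess of the values of \<open>L\<close> over \<open>f0\<close> in the direction \<open>c\<close>; it is to be compared with \<open>q\<close>\<close>
  define q where "q = p - integral\<^sup>L M f0"
  define s where "s c t = support_fun (L t) c - inner c (f0 t)" for c t
  have s_meas[measurable]: "s c \<in> borel_measurable M" for c unfolding s_def by measurable
  have s_int: "integrable M (s c)" for c
    unfolding s_def using integrable_support_fun[OF L l bound] if0 by auto
  have s_nonneg: "0 \<le> s c t" if "t \<in> space M" for c t
    unfolding s_def using support_fun_upper[OF K(1) f0(2)] that by auto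
  have s_lip: "s c t - s d t \<le> norm (c - d) * (2 * l t)" if t: "t \<in> space M" for c d t
  proof -
    have "inner (d - c) (f0 t) \<le> norm (d - c) * norm (f0 t)" by (rule norm_cauchy_schwarz)
    also have "\<dots> \<le> norm (c - d) * l t"
      using bound[OF t f0(2)[OF t]] by (simp add: norm_minus_commute mult_left_mono)
    finally show ?thesis
      using support_fun_diff_le[OF K[OF t] bound[OF t], of c d] by (simp add: s_def inner_diff_left algebra_simps)
  qed
  have s_zero: "s 0 t = 0" if t: "t \<in> space M" for t
    using support_fun_scaleR[OF K[OF t], of 0 0] by (simp add: s_def)
  have s_le: "s c t \<le> norm c * (2 * l t)" if t: "t \<in> space M" for c t
    using s_lip[OF t, of c 0] s_zero[OF t] by simp
  have s_scale: "s (a *\<^sub>R c) t = a * s c t" if "t \<in> space M" "0 \<le> a" for a c t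
    using support_fun_scaleR[OF K[OF that(1)] that(2)] by (simp add: s_def right_diff_distrib)
  have s_orth: "s (c + d) t = s c t" if t: "t \<in> space M" and d: "\<And>v. v \<in> V \<Longrightarrow> inner d v = 0" for c d t
  proof -
    have le: "support_fun (L t) (c + d) \<le> support_fun (L t) c + inner d (f0 t)"
      if d: "\<And>v. v \<in> V \<Longrightarrow> inner d v = 0" for c d
    proof (rule support_fun_le[OF K[OF t]])
      fix v assume v: "v \<in> L t"
      have "inner d (v - f0 t) = 0" using d diffs[OF t v f0(2)[OF t]] by blast
      then show "inner (c + d) v \<le> support_fun (L t) c + inner d (f0 t)"
        using support_fun_upper[OF K(1)[OF t] v, of c] by (simp add: inner_add_left inner_diff_right)
    qed
    have "support_fun (L t) c \<le> support_fun (L t) (c + d) + inner (- d) (f0 t)"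
      using le[of "- d" "c + d"] d by simp
    then show ?thesis using le[OF d, of c] by (simp add: s_def inner_add_left)
  qed
  have s_out: "s c t = 0" if t: "t \<in> space M - A0" for c t
  proof -
    have "L t = {f0 t}" using sing[OF t] f0(2) t by blast
    then show ?thesis by (simp add: s_def)
  qed
  define H where "H A c = (\<integral>t. indicator A t * s c t \<partial>M)" for A c
  have iH: "integrable M (\<lambda>t. indicator A t * s c t)" if "A \<in> sets M" for A c
    using integrable_mult_indicator[OF that s_int] by simp
  have H_nonneg: "0 \<le> H A c" for A c
    unfolding H_def using s_nonneg by (intro integral_nonneg_AE AE_I2) auto
  have H_scale: "H A (a *\<^sub>R c) = a * H A c" if "0 \<le> a" for A a c
    unfolding H_def using s_scale that
    by (subst integral_mult_right_zero[symmetric]) (intro Bochner_Integration.integral_cong, auto)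
  have H_orth: "H A (c + d) = H A c" if "\<And>v. v \<in> V \<Longrightarrow> inner d v = 0" for A c d
    unfolding H_def using s_orth[OF _ that] by (intro Bochner_Integration.integral_cong) auto
  have q_le: "inner c q \<le> H A0 c" for c
  proof -
    have "H A0 c = (\<integral>t. s c t \<partial>M)"
      unfolding H_def using s_out by (intro Bochner_Integration.integral_cong) (auto simp: indicator_def)
    also have "\<dots> = (\<integral>t. support_fun (L t) c \<partial>M) - inner c (integral\<^sup>L M f0)"
      unfolding s_def using integrable_support_fun[OF L l bound] if0 by (subst Bochner_Integration.integral_diff) auto
    finally show ?thesis using p[of c] by (simp add: q_def inner_diff_right)
  qed
  define F where "F = {A \<in> sets M. A \<subseteq> A0 \<and> (\<forall>c. inner c q \<le> H A c)}"
  have "A0 \<in> F" using q_le by (simp add: F_def)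
  moreover have "F \<subseteq> sets M" by (auto simp: F_def)
  moreover have "(\<Inter>n. S n) \<in> F" if S: "\<And>n. S n \<in> F" "decseq S" for S :: "nat \<Rightarrow> 't set"
  proof -
    have [measurable]: "S n \<in> sets M" for n using S(1) by (simp add: F_def)
    have "(\<lambda>n. H (S n) c) \<longlonglongrightarrow> H (\<Inter>n. S n) c" for c
      unfolding H_def
    proof (rule integral_dominated_convergence[where w = "s c"])
      show "AE t in M. (\<lambda>n. indicator (S n) t * s c t) \<longlonglongrightarrow> indicator (\<Inter>n. S n) t * s c t"
        by (intro AE_I2 tendsto_mult tendsto_const LIMSEQ_indicator_decseq S(2))
      show "AE t in M. norm (indicator (S n) t * s c t) \<le> s c t" for n
        using s_nonneg by (auto simp: indicator_def)
    qed (use s_int in measurable)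
    moreover have "inner c q \<le> H (S n) c" for c n using S(1) by (simp add: F_def)
    ultimately have "inner c q \<le> H (\<Inter>n. S n) c" for c using LIMSEQ_le_const by blast
    moreover have "(\<Inter>n. S n) \<subseteq> A0" using S(1)[of 0] by (auto simp: F_def)
    ultimately show ?thesis by (auto simp: F_def)
  qed
  ultimately obtain A where A: "A \<in> F" and
    Amin: "\<And>C. C \<in> F \<Longrightarrow> C \<subseteq> A \<Longrightarrow> measure M C = measure M A"
    using decreasing_family_minimal[OF fin, of A0 F] by blast
  have A_sets[measurable]: "A \<in> sets M" and "A \<subseteq> A0" and qA: "\<And>c. inner c q \<le> H A c"
    using A by (auto simp: F_def)
  have q_orth: "inner d q = 0" if "\<And>v. v \<in> V \<Longrightarrow> inner d v = 0" for d
  proof -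
    have "H A d = 0" "H A (- d) = 0" using H_orth[of d A 0] H_orth[of "- d" A 0] that H_scale[of 0 A 0] by auto
    then show ?thesis using qA[of d] qA[of "- d"] by simp
  qed
  show ?case
  proof (cases "\<exists>c\<in>V. c \<noteq> 0 \<and> inner c q = H A c")
    case True
    then obtain c where c: "c \<in> V" "c \<noteq> 0" "inner c q = H A c" by blast
    \<comment> \<open>the boundary case: the faces exposed by \<open>c\<close> have their differences in the smaller space \<open>V'\<close>\<close>
    define V' where "V' = {v \<in> V. inner c v = 0}"
    define L' where "L' t = (if t \<in> A then face (L t) c else {f0 t})" for t
    have "subspace V'" unfolding V'_def using V
      by (auto simp: subspace_def inner_add_right)
    have "c \<notin> V'" using c by (simp add: V'_def)
    have "dim V' < dim V"
    proof (rule dim_psubset)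
      show "span V' \<subset> span V"
        using V \<open>subspace V'\<close> \<open>c \<notin> V'\<close> c(1) V'_def
        by (metis (no_types, lifting) mem_Collect_eq psubsetI span_eq_iff subsetI)
    qed
    moreover have L'_sub: "L' t \<subseteq> L t" if "t \<in> space M" for t
      using face_subset f0(2)[OF that] by (auto simp: L'_def)
    moreover have L': "measurable_compact M L'"
      unfolding measurable_compact_def
    proof (intro conjI ballI allI)
      fix t assume "t \<in> space M"
      then show "compact (L' t)" "L' t \<noteq> {}"
        using compact_face[OF K(1)] face_nonempty[OF K] by (auto simp: L'_def)
    next
      fix d
      have [measurable]: "(\<lambda>t. support_fun (face (L t) c) d) \<in> borel_measurable M"
        using measurable_compact_face[OF L] by (simp add: measurable_compact_def)
      have "(\<lambda>t. if t \<in> A then support_fun (face (L t) c) d else inner d (f0 t)) \<in> borel_measurable M"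
        by measurable
      also have "(\<lambda>t. if t \<in> A then support_fun (face (L t) c) d else inner d (f0 t)) = (\<lambda>t. support_fun (L' t) d)"
        by (auto simp: L'_def)
      finally show "(\<lambda>t. support_fun (L' t) d) \<in> borel_measurable M" .
    qed
    moreover have "v - w \<in> V'" if "t \<in> space M" "v \<in> L' t" "w \<in> L' t" for t v w
    proof -
      have "v - w \<in> V" using diffs L'_sub that by blast
      moreover have "inner c v = inner c w" using that by (auto simp: L'_def face_def split: if_splits)
      ultimately show ?thesis by (simp add: V'_def inner_diff_right)
    qed
    moreover have "v = w" if "t \<in> space M - A0" "v \<in> L' t" "w \<in> L' t" for t v w
      using sing L'_sub that by blast
    moreover have "inner d p \<le> (\<integral>t. support_fun (L' t) d \<partial>M)" for d
    proof -
      let ?h = "\<lambda>n. 1 / real (Suc n)"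
      let ?r = "\<lambda>n t. indicator A t * (real (Suc n) * (s (c + ?h n *\<^sub>R d) t - s c t))"
      let ?g = "\<lambda>t. indicator A t * (support_fun (face (L t) c) d - inner d (f0 t))"
      have [measurable]: "(\<lambda>t. support_fun (face (L t) c) d) \<in> borel_measurable M"
        using measurable_compact_face[OF L] by (simp add: measurable_compact_def)
      \<comment> \<open>the difference quotients of \<open>s\<close> at \<open>c\<close>, integrated over \<open>A\<close>, bound \<open>inner d q\<close> because equality holds at \<open>c\<close>\<close>
      have "(\<lambda>n. \<integral>t. ?r n t \<partial>M) \<longlonglongrightarrow> (\<integral>t. ?g t \<partial>M)"
      proof (rule integral_dominated_convergence[where w = "\<lambda>t. norm d * (2 * l t)"])
        show "integrable M (\<lambda>t. norm d * (2 * l t))" using l by simp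
        show "AE t in M. (\<lambda>n. ?r n t) \<longlonglongrightarrow> ?g t"
        proof (rule AE_I2)
          fix t assume t: "t \<in> space M"
          have eq: "real (Suc n) * (support_fun (L t) (c + ?h n *\<^sub>R d) - support_fun (L t) c) - inner d (f0 t)
              = real (Suc n) * (s (c + ?h n *\<^sub>R d) t - s c t)" for n
            by (simp add: s_def inner_add_left field_simps)
          have "(\<lambda>n. real (Suc n) * (support_fun (L t) (c + ?h n *\<^sub>R d) - support_fun (L t) c) - inner d (f0 t))
             \<longlonglongrightarrow> support_fun (face (L t) c) d - inner d (f0 t)"
            by (intro tendsto_diff tendsto_const support_fun_face_limit K[OF t])
          then show "(\<lambda>n. ?r n t) \<longlonglongrightarrow> ?g t" unfolding eq by (intro tendsto_mult tendsto_const)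
        qed
        show "AE t in M. norm (?r n t) \<le> norm d * (2 * l t)" for n
        proof (rule AE_I2)
          fix t assume t: "t \<in> space M"
          let ?x = "s (c + ?h n *\<^sub>R d) t - s c t"
          have "?x \<le> ?h n * norm d * (2 * l t)" using s_lip[OF t, of "c + ?h n *\<^sub>R d" c] by simp
          moreover have "- ?x \<le> ?h n * norm d * (2 * l t)"
            using s_lip[OF t, of c "c + ?h n *\<^sub>R d"] by simp
          ultimately have "\<bar>?x\<bar> \<le> ?h n * (norm d * (2 * l t))" by simp
          then have "real (Suc n) * \<bar>?x\<bar> \<le> real (Suc n) * (?h n * (norm d * (2 * l t)))"
            by (intro mult_left_mono) auto
          also have "\<dots> = norm d * (2 * l t)" by simp
          finally show "norm (?r n t) \<le> norm d * (2 * l t)"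
            using l0[OF t] by (auto simp: indicator_def abs_mult)
        qed
      qed measurable
      moreover have "inner d q \<le> (\<integral>t. ?r n t \<partial>M)" for n
      proof -
        have eq: "?r n t = real (Suc n) * (indicator A t * s (c + ?h n *\<^sub>R d) t - indicator A t * s c t)" for t
          by (simp add: algebra_simps)
        have "(\<integral>t. ?r n t \<partial>M) = real (Suc n) * (H A (c + ?h n *\<^sub>R d) - H A c)"
          unfolding eq H_def using iH[OF A_sets] by simp
        moreover have "inner d q = real (Suc n) * (inner (c + ?h n *\<^sub>R d) q - inner c q)"
          by (simp add: inner_add_left)
        moreover have "real (Suc n) * (inner (c + ?h n *\<^sub>R d) q - inner c q)
            \<le> real (Suc n) * (H A (c + ?h n *\<^sub>R d) - H A c)"
          using qA[of "c + ?h n *\<^sub>R d"] c(3) by (intro mult_left_mono) auto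
        ultimately show ?thesis by simp
      qed
      ultimately have "inner d q \<le> (\<integral>t. ?g t \<partial>M)" using LIMSEQ_le_const by blast
      also have "(\<integral>t. ?g t \<partial>M) = (\<integral>t. support_fun (L' t) d - inner d (f0 t) \<partial>M)"
        by (intro Bochner_Integration.integral_cong) (auto simp: L'_def)
      also have "\<dots> = (\<integral>t. support_fun (L' t) d \<partial>M) - inner d (integral\<^sup>L M f0)"
      proof -
        have "norm v \<le> l t" if "t \<in> space M" "v \<in> L' t" for t v using bound L'_sub that by blast
        then have "integrable M (\<lambda>t. support_fun (L' t) d)" by (intro integrable_support_fun[OF L' l])
        then show ?thesis using if0 by (subst Bochner_Integration.integral_diff) auto
      qed
      finally show ?thesis by (simp add: q_def inner_diff_right)
    qed
    ultimately have "\<exists>f\<in>borel_measurable M. (\<forall>t\<in>space M. f t \<in> L' t) \<and> integral\<^sup>L M f = p"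
      using bound L'_sub by (intro less.hyps[OF _ \<open>subspace V'\<close> L']) blast+
    then show ?thesis using L'_sub by blast
  next
    case False
    have strict: "inner c q < H A c" if "c \<in> V" "c \<noteq> 0" for c using that False qA[of c] by force
    show ?thesis
    proof (cases "V \<subseteq> {0}")
      case True
      then have "inner q q = 0" by (intro q_orth) auto
      then have "integral\<^sup>L M f0 = p" by (simp add: q_def)
      then show ?thesis using f0 by blast
    next
      case False
      then obtain v0 where v0: "v0 \<in> V" "v0 \<noteq> 0" by blast
      \<comment> \<open>the interior case: by compactness of the unit sphere of \<open>V\<close> the inequality has a slack \<open>g\<close>\<close>
      define U where "U = V \<inter> sphere 0 1"
      have "compact U" unfolding U_def using V by (intro closed_Int_compact closed_subspace) auto
      have "(1 / norm v0) *\<^sub>R v0 \<in> U" unfolding U_def using v0 V by (simp add: subspace_scale)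
      then have "U \<noteq> {}" by blast
      have H_diff: "H A c - H A d \<le> (2 * integral\<^sup>L M l) * norm (c - d)" for c d
      proof -
        have "H A c - H A d = (\<integral>t. indicator A t * s c t - indicator A t * s d t \<partial>M)"
          unfolding H_def using iH[OF A_sets] by simp
        also have "\<dots> \<le> (\<integral>t. norm (c - d) * (2 * l t) \<partial>M)"
        proof (rule integral_mono)
          show "integrable M (\<lambda>t. indicator A t * s c t - indicator A t * s d t)" using iH[OF A_sets] by simp
          show "integrable M (\<lambda>t. norm (c - d) * (2 * l t))" using l by simp
          show "indicator A t * s c t - indicator A t * s d t \<le> norm (c - d) * (2 * l t)" if "t \<in> space M" for t
            using s_lip[OF that, of c d] l0[OF that] by (auto simp: indicator_def)
        qed
        finally show ?thesis by (simp add: mult_ac)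
      qed
      have "(2 * integral\<^sup>L M l)-lipschitz_on UNIV (H A)"
      proof (rule lipschitz_onI)
        show "dist (H A c) (H A d) \<le> (2 * integral\<^sup>L M l) * dist c d" for c d
          using H_diff[of c d] H_diff[of d c] by (simp add: dist_norm abs_le_iff norm_minus_commute)
        show "0 \<le> 2 * integral\<^sup>L M l" using l0 by (simp add: integral_nonneg_AE AE_I2)
      qed
      then have "continuous_on U (\<lambda>c. H A c - inner c q)"
        by (intro continuous_intros continuous_on_subset[OF lipschitz_on_continuous_on]) auto
      then obtain c0 where c0: "c0 \<in> U" "\<And>c. c \<in> U \<Longrightarrow> H A c0 - inner c0 q \<le> H A c - inner c q"
        using continuous_attains_inf[OF \<open>compact U\<close> \<open>U \<noteq> {}\<close>] by blast
      define g where "g = H A c0 - inner c0 q"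
      have "g > 0" unfolding g_def using strict[of c0] c0(1) by (cases "c0 = 0") (auto simp: U_def)
      have "measure M A > 0"
      proof (rule ccontr)
        assume "\<not> 0 < measure M A"
        then have "A \<in> null_sets M"
          using measure_nonneg[of M A] by (simp add: null_sets_def emeasure_eq_measure)
        have "H A c = 0" for c
          unfolding H_def
          by (rule integral_eq_zero_AE) (use AE_not_in[OF \<open>A \<in> null_sets M\<close>] in \<open>auto elim!: eventually_mono\<close>)
        then show False using strict[of v0] strict[of "- v0"] v0 V by (simp add: subspace_neg)
      qed
      then obtain B where B: "B \<in> sets M" "B \<subseteq> A" "0 < measure M B" "(\<integral>t. indicator B t * (2 * l t) \<partial>M) < g"
        using atomless_small_subset[OF fin atl A_sets \<open>A \<subseteq> A0\<close> _ _ \<open>g > 0\<close>, of "\<lambda>t. 2 * l t"] l by auto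
      note B(1)[measurable]
      have "inner c q \<le> H (A - B) c" for c
      proof -
        obtain y z where yz: "y \<in> span V" "\<And>w. w \<in> span V \<Longrightarrow> orthogonal z w" "c = y + z"
          using orthogonal_subspace_decomp_exists[of V c] by metis
        have "y \<in> V" using yz(1) V span_eq_iff by blast
        have z: "inner z v = 0" if "v \<in> V" for v using yz(2)[of v] span_base[OF that] by (simp add: orthogonal_def)
        have "inner y q \<le> H (A - B) y"
        proof (cases "y = 0")
          case True then show ?thesis using H_nonneg by simp
        next
          case False
          define u where "u = (1 / norm y) *\<^sub>R y"
          have u: "u \<in> U" "y = norm y *\<^sub>R u"
            unfolding U_def u_def using False \<open>y \<in> V\<close> V by (auto simp: subspace_scale)
          have "norm u = 1" using u(1) by (simp add: U_def)
          have "H A u - H (A - B) u = (\<integral>t. indicator A t * s u t - indicator (A - B) t * s u t \<partial>M)"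
            unfolding H_def using iH by (subst Bochner_Integration.integral_diff) auto
          also have "\<dots> \<le> (\<integral>t. indicator B t * (2 * l t) \<partial>M)"
          proof (rule integral_mono)
            show "integrable M (\<lambda>t. indicator A t * s u t - indicator (A - B) t * s u t)" using iH by auto
            show "integrable M (\<lambda>t. indicator B t * (2 * l t))"
              using integrable_mult_indicator[OF B(1), of "\<lambda>t. 2 * l t"] l by simp
            show "indicator A t * s u t - indicator (A - B) t * s u t \<le> indicator B t * (2 * l t)" if "t \<in> space M" for t
              using s_le[OF that, of u] B(2) \<open>norm u = 1\<close> by (auto simp: indicator_def)
          qed
          also have "\<dots> < g" by fact
          also have "g \<le> H A u - inner u q" unfolding g_def by (rule c0(2)[OF u(1)])
          finally have "inner u q \<le> H (A - B) u" by simp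
          then have "norm y * inner u q \<le> norm y * H (A - B) u" by (intro mult_left_mono) auto
          then show ?thesis using H_scale[of "norm y" "A - B" u] u(2) by (metis inner_scaleR_left norm_ge_zero)
        qed
        moreover have "H (A - B) (y + z) = H (A - B) y" using z by (rule H_orth)
        moreover have "inner z q = 0" using z by (rule q_orth)
        ultimately show ?thesis by (simp add: yz(3) inner_add_left)
      qed
      then have "A - B \<in> F" using \<open>A \<subseteq> A0\<close> by (auto simp: F_def)
      then have "measure M (A - B) = measure M A" by (rule Amin) auto
      then have False using finite_measure_Diff[OF A_sets B(1,2)] B(3) by simp
      then show ?thesis ..
    qed
  qed
qed

section \<open>Atoms\<close>

definition atom :: "'t measure \<Rightarrow> 't set \<Rightarrow> bool" where
  "atom M A \<longleftrightarrow> A \<in> sets M \<and> 0 < measure M A \<and>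
     (\<forall>B\<in>sets M. B \<subseteq> A \<longrightarrow> measure M B = 0 \<or> measure M B = measure M A)"

text \<open>Each sublevel set of \<open>f\<close> in \<open>A\<close> has measure zero or full measure, and \<open>f\<close> is almost everywhere equal to the
infimum of the levels of the second kind.\<close>

lemma atom_AE_const_real:
  fixes f :: "'t \<Rightarrow> real"
  assumes "finite_measure M" "atom M A" and f[measurable]: "f \<in> borel_measurable M"
  shows "\<exists>c. AE t in M. t \<in> A \<longrightarrow> f t = c"
proof -
  interpret finite_measure M by fact
  have A[measurable]: "A \<in> sets M" and pos: "0 < measure M A" and
    at: "\<And>B. B \<in> sets M \<Longrightarrow> B \<subseteq> A \<Longrightarrow> measure M B = 0 \<or> measure M B = measure M A"
    using assms by (auto simp: atom_def)
  have "A \<subseteq> space M" using A by (rule sets.sets_into_space)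
  define D where "D q = {t \<in> space M. t \<in> A \<and> f t \<le> q}" for q
  have D[measurable]: "D q \<in> sets M" for q unfolding D_def by measurable
  have D_sub: "D q \<subseteq> A" for q by (auto simp: D_def)
  have D_mono: "q \<le> r \<Longrightarrow> D q \<subseteq> D r" for q r by (auto simp: D_def)
  define Q where "Q = {q. measure M (D q) = measure M A}"
  have notQ: "q \<notin> Q \<Longrightarrow> measure M (D q) = 0" for q using at[OF D D_sub, of q] by (auto simp: Q_def)
  have "(\<lambda>n. measure M (D (real n))) \<longlonglongrightarrow> measure M (\<Union>n. D (real n))"
    by (rule finite_Lim_measure_incseq) (auto simp: incseq_def intro!: D_mono)
  moreover have "(\<Union>n. D (real n)) = A"
    using subsetD[OF \<open>A \<subseteq> space M\<close>] real_arch_simple by (auto simp: D_def)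
  ultimately have limA: "(\<lambda>n. measure M (D (real n))) \<longlonglongrightarrow> measure M A" by simp
  have "\<exists>n. measure M (D (real n)) > 0"
    using order_tendstoD(1)[OF limA pos] by (auto simp: eventually_sequentially)
  then have "\<exists>n. measure M (D (real n)) \<noteq> 0" by (metis less_irrefl)
  then have "Q \<noteq> {}" using notQ by blast
  have "(\<lambda>n. measure M (D (- real n))) \<longlonglongrightarrow> measure M (\<Inter>n. D (- real n))"
    by (rule finite_Lim_measure_decseq) (auto simp: decseq_def intro!: D_mono)
  moreover have "(\<Inter>n. D (- real n)) = {}"
  proof -
    have "\<exists>n. \<not> f t \<le> - real n" for t
    proof -
      obtain n where "- f t < real n" using reals_Archimedean2 by blast
      then have "\<not> f t \<le> - real n" by simp
      then show ?thesis by blast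
    qed
    then show ?thesis by (auto simp: D_def)
  qed
  ultimately have lim0: "(\<lambda>n. measure M (D (- real n))) \<longlonglongrightarrow> 0" by simp
  have "\<exists>n. measure M (D (- real n)) < measure M A"
    using order_tendstoD(2)[OF lim0 pos] by (auto simp: eventually_sequentially)
  then obtain n0 where "measure M (D (- real n0)) < measure M A" by blast
  then have n0: "- real n0 \<notin> Q" by (simp add: Q_def)
  have up: "r \<in> Q" if "q \<in> Q" "q \<le> r" for q r
  proof -
    have "measure M (D q) \<le> measure M (D r)" using that by (intro finite_measure_mono D_mono) auto
    then show ?thesis using that pos at[OF D D_sub, of r] by (auto simp: Q_def)
  qed
  have bdd: "bdd_below Q"
  proof (rule bdd_belowI[of _ "- real n0"])
    fix q assume "q \<in> Q" then show "- real n0 \<le> q" using up[of q "- real n0"] n0 by linarith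
  qed
  define c where "c = Inf Q"
  have "AE t in M. t \<in> A \<longrightarrow> f t \<le> c + 1 / real (Suc n) \<and> \<not> f t \<le> c - 1 / real (Suc n)" for n
  proof -
    have "c < c + 1 / real (Suc n)" by simp
    then obtain q where q: "q \<in> Q" "q < c + 1 / real (Suc n)"
      unfolding c_def using cInf_less_iff[OF \<open>Q \<noteq> {}\<close> bdd] by blast
    then have "c + 1 / real (Suc n) \<in> Q" using up by simp
    then have "measure M (A - D (c + 1 / real (Suc n))) = 0"
      using finite_measure_Diff[OF A D D_sub] by (simp add: Q_def)
    then have "A - D (c + 1 / real (Suc n)) \<in> null_sets M"
      by (simp add: null_sets_def emeasure_eq_measure)
    note 1 = AE_not_in[OF this]
    have "c - 1 / real (Suc n) \<notin> Q"
    proof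
      assume "c - 1 / real (Suc n) \<in> Q"
      then have "c \<le> c - 1 / real (Suc n)" unfolding c_def using bdd by (rule cInf_lower)
      then show False by simp
    qed
    then have "D (c - 1 / real (Suc n)) \<in> null_sets M"
      using notQ by (simp add: null_sets_def emeasure_eq_measure)
    note 2 = AE_not_in[OF this]
    from 1 2 AE_space show ?thesis by eventually_elim (auto simp: D_def)
  qed
  then have "AE t in M. \<forall>n. t \<in> A \<longrightarrow> f t \<le> c + 1 / real (Suc n) \<and> \<not> f t \<le> c - 1 / real (Suc n)"
    by (subst AE_all_countable) blast
  then have "AE t in M. t \<in> A \<longrightarrow> f t = c"
  proof eventually_elim
    case (elim t)
    show ?case
    proof
      assume "t \<in> A"
      then have le: "f t \<le> c + 1 / real (Suc n)" "c - 1 / real (Suc n) \<le> f t" for n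
        using elim[rule_format, of n] by auto
      have "(\<lambda>n. c + 1 / real (Suc n)) \<longlonglongrightarrow> c + 0" "(\<lambda>n. c - 1 / real (Suc n)) \<longlonglongrightarrow> c - 0"
        by (intro tendsto_add tendsto_diff tendsto_const LIMSEQ_Suc lim_1_over_n)+
      then have "f t \<le> c + 0" "c - 0 \<le> f t"
        using le by (auto intro: LIMSEQ_le_const LIMSEQ_le_const2)
      then show "f t = c" by simp
    qed
  qed
  then show ?thesis by blast
qed

lemma atom_AE_const:
  fixes f :: "'t \<Rightarrow> 'a::euclidean_space"
  assumes "finite_measure M" "atom M A" and [measurable]: "f \<in> borel_measurable M"
  shows "\<exists>c. AE t in M. t \<in> A \<longrightarrow> f t = c"
proof -
  have "\<exists>c. AE t in M. t \<in> A \<longrightarrow> inner (f t) b = c" for b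
    using assms by (intro atom_AE_const_real) auto
  then obtain c where c: "\<And>b. AE t in M. t \<in> A \<longrightarrow> inner (f t) b = c b" by metis
  have "AE t in M. \<forall>b\<in>Basis. t \<in> A \<longrightarrow> inner (f t) b = c b"
    using c by (intro AE_finite_allI) auto
  then have "AE t in M. t \<in> A \<longrightarrow> f t = (\<Sum>b\<in>Basis. c b *\<^sub>R b)"
  proof eventually_elim
    case (elim t)
    show ?case
    proof
      assume "t \<in> A"
      then have "(\<Sum>b\<in>Basis. inner (f t) b *\<^sub>R b) = (\<Sum>b\<in>Basis. c b *\<^sub>R b)"
        using elim by (intro sum.cong) auto
      then show "f t = (\<Sum>b\<in>Basis. c b *\<^sub>R b)" by (simp add: euclidean_representation)
    qed
  qed
  then show ?thesis by blast
qed

text \<open>The complements of countable unions of atoms are closed under countable intersections, and an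
essentially minimal one contains no further atom.\<close>

lemma atomic_atomless_decomposition:
  assumes fin: "finite_measure M"
  obtains U :: "nat \<Rightarrow> 't set" where "\<And>n. U n = {} \<or> atom M (U n)" "atomless_on M (space M - (\<Union>n. U n))"
proof -
  interpret finite_measure M by fact
  define F where "F = {space M - (\<Union>n. U n) | U :: nat \<Rightarrow> 't set. \<forall>n. U n = {} \<or> atom M (U n)}"
  have at_sets: "U n \<in> sets M" if "\<forall>n. U n = {} \<or> atom M (U n)" for U :: "nat \<Rightarrow> 't set" and n
    using that[rule_format, of n] by (auto simp: atom_def)
  have F: "F \<subseteq> sets M"
  proof
    fix x assume "x \<in> F"
    then obtain U :: "nat \<Rightarrow> 't set" where U: "x = space M - (\<Union>n. U n)" "\<forall>n. U n = {} \<or> atom M (U n)"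
      unfolding F_def by blast
    have "(\<Union>n. U n) \<in> sets M" using at_sets[OF U(2)] by (intro sets.countable_UN) auto
    then show "x \<in> sets M" unfolding U(1) by (rule sets.compl_sets)
  qed
  have "space M - (\<Union>n::nat. {}) \<in> F" unfolding F_def by blast
  moreover have "(\<Inter>n. S n) \<in> F" if S: "\<And>n. S n \<in> F" for S :: "nat \<Rightarrow> 't set"
  proof -
    have "\<forall>n. \<exists>U :: nat \<Rightarrow> 't set. S n = space M - (\<Union>k. U k) \<and> (\<forall>k. U k = {} \<or> atom M (U k))"
      using S unfolding F_def by blast
    then obtain U :: "nat \<Rightarrow> nat \<Rightarrow> 't set" where
      U: "\<And>n. S n = space M - (\<Union>k. U n k)" "\<And>n k. U n k = {} \<or> atom M (U n k)" by metis
    define U' where "U' m = U (fst (prod_decode m)) (snd (prod_decode m))" for m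
    have "(\<Union>m. U' m) = (\<Union>n k. U n k)"
    proof (intro antisym subsetI)
      fix x assume "x \<in> (\<Union>n k. U n k)"
      then obtain n k where "x \<in> U n k" by blast
      then have "x \<in> U' (prod_encode (n, k))" by (simp add: U'_def)
      then show "x \<in> (\<Union>m. U' m)" by blast
    qed (auto simp: U'_def)
    then have "(\<Inter>n. S n) = space M - (\<Union>m. U' m)" using U(1) by auto
    moreover have "\<forall>m. U' m = {} \<or> atom M (U' m)" using U(2) by (simp add: U'_def)
    ultimately show ?thesis unfolding F_def by blast
  qed
  ultimately obtain B where B: "B \<in> F" "\<And>C. C \<in> F \<Longrightarrow> C \<subseteq> B \<Longrightarrow> measure M C = measure M B"
    using decreasing_family_minimal[OF fin _ F] by metis
  then obtain U :: "nat \<Rightarrow> 't set" where U: "B = space M - (\<Union>n. U n)" "\<forall>n. U n = {} \<or> atom M (U n)"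
    unfolding F_def by blast
  have "atomless_on M B"
    unfolding atomless_on_def
  proof (intro conjI ballI impI)
    show Bs: "B \<in> sets M" using B(1) F by blast
    fix A assume A: "A \<in> sets M" "A \<subseteq> B" "0 < measure M A"
    show "\<exists>C\<in>sets M. C \<subseteq> A \<and> 0 < measure M C \<and> measure M C < measure M A"
    proof (rule ccontr)
      assume no: "\<not> ?thesis"
      have "measure M C = 0 \<or> measure M C = measure M A" if "C \<in> sets M" "C \<subseteq> A" for C
      proof -
        have "\<not> (0 < measure M C \<and> measure M C < measure M A)" using no that by blast
        then show ?thesis using finite_measure_mono[OF that(2) A(1)] measure_nonneg[of M C] by linarith
      qed
      then have "atom M A" using A by (auto simp: atom_def)
      define U' where "U' n = (case n of 0 \<Rightarrow> A | Suc m \<Rightarrow> U m)" for n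
      have "(\<Union>n. U' n) = A \<union> (\<Union>n. U n)"
      proof (intro antisym subsetI)
        fix x assume "x \<in> A \<union> (\<Union>n. U n)"
        then consider "x \<in> A" | n where "x \<in> U n" by blast
        then have "\<exists>n. x \<in> U' n"
        proof cases
          case 1 then show ?thesis by (intro exI[of _ 0]) (simp add: U'_def)
        next
          case 2 then show ?thesis by (intro exI[of _ "Suc n"]) (simp add: U'_def)
        qed
        then show "x \<in> (\<Union>n. U' n)" by blast
      next
        fix x assume "x \<in> (\<Union>n. U' n)"
        then obtain n where "x \<in> U' n" by blast
        then show "x \<in> A \<union> (\<Union>n. U n)" by (cases n) (auto simp: U'_def)
      qed
      then have "B - A = space M - (\<Union>n. U' n)" using U(1) by blast
      moreover have "\<forall>n. U' n = {} \<or> atom M (U' n)" using U(2) \<open>atom M A\<close> by (auto simp: U'_def split: nat.splits)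
      ultimately have "B - A \<in> F" unfolding F_def by blast
      then have "measure M (B - A) = measure M B" by (rule B(2)) auto
      then show False using finite_measure_Diff[OF Bs A(1,2)] A(3) by simp
    qed
  qed
  with U that show ?thesis by blast
qed

section \<open>A Fatou lemma for vector-valued functions\<close>

definition cluster_points :: "(nat \<Rightarrow> 'a::metric_space) \<Rightarrow> 'a set" where
  "cluster_points x = (\<Inter>N. closure (x ` {N..}))"

lemma cluster_points_subseqI:
  assumes "\<And>n. k n \<ge> n" "strict_mono r" "(\<lambda>n. x (k (r n))) \<longlonglongrightarrow> v"
  shows "v \<in> cluster_points x"
  unfolding cluster_points_def
proof
  fix N :: nat
  show "v \<in> closure (x ` {N..})"
  proof (rule Lim_in_closed_set[OF closed_closure _ sequentially_bot assms(3)])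
    have "x (k (r n)) \<in> closure (x ` {N..})" if "n \<ge> N" for n
    proof -
      have "k (r n) \<ge> N" using assms(1)[of "r n"] seq_suble[OF assms(2), of n] that by linarith
      then show ?thesis by (intro subsetD[OF closure_subset]) simp
    qed
    then show "\<forall>\<^sub>F n in sequentially. x (k (r n)) \<in> closure (x ` {N..})"
      unfolding eventually_sequentially by blast
  qed
qed

lemma cluster_points_imp_subseq:
  assumes "v \<in> cluster_points x"
  obtains r :: "nat \<Rightarrow> nat" where "strict_mono r" "(\<lambda>n. x (r n)) \<longlonglongrightarrow> v"
proof -
  have ex: "\<exists>k\<ge>N. dist (x k) v < e" if "e > 0" for N e
  proof -
    have "v \<in> closure (x ` {N..})" using assms by (simp add: cluster_points_def)
    then have "\<exists>y\<in>x ` {N..}. dist y v < e" using that by (metis closure_approachable)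
    then show ?thesis by auto
  qed
  have "\<exists>r. \<forall>n. dist (x (r n)) v < 1 / real (Suc n) \<and> r n < r (Suc n)"
  proof (rule dependent_nat_choice)
    show "\<exists>k. dist (x k) v < 1 / real (Suc 0)" using ex[of 1 0] by auto
    fix k n
    show "\<exists>j. dist (x j) v < 1 / real (Suc (Suc n)) \<and> k < j"
      using ex[of "1 / real (Suc (Suc n))" "Suc k"] by (auto simp: Suc_le_eq)
  qed
  then obtain r where r: "\<And>n. dist (x (r n)) v < 1 / real (Suc n)" "\<And>n. r n < r (Suc n)" by blast
  have "(\<lambda>n. dist (x (r n)) v) \<longlonglongrightarrow> 0"
    by (rule Lim_null_comparison[OF _ LIMSEQ_Suc[OF lim_1_over_n]])
      (use r(1) in \<open>auto intro!: always_eventually less_imp_le\<close>)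
  then have "(\<lambda>n. x (r n)) \<longlonglongrightarrow> v" by (rule iffD2[OF tendsto_dist_iff])
  moreover have "strict_mono r" using r(2) by (simp add: strict_mono_Suc_iff)
  ultimately show ?thesis using that by blast
qed

context
  fixes x :: "nat \<Rightarrow> 'a::euclidean_space" and b :: real
  assumes bound: "\<And>k. norm (x k) \<le> b"
begin

lemma bounded_subseq_cluster_point:
  assumes "\<And>n. k n \<ge> n"
  obtains r v where "strict_mono r" "(\<lambda>n. x (k (r n))) \<longlonglongrightarrow> v" "v \<in> cluster_points x"
proof -
  have "\<forall>n. x (k n) \<in> cball 0 b" using bound by simp
  then obtain v r where "strict_mono r" "((\<lambda>n. x (k n)) \<circ> r) \<longlonglongrightarrow> v"
    using compact_cball[of "0::'a" b] unfolding compact_def by metis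
  moreover from this have "v \<in> cluster_points x"
    by (intro cluster_points_subseqI[of k r]) (auto simp: assms comp_def)
  ultimately show ?thesis using that by (simp add: comp_def)
qed

lemma norm_cluster_point_le: "v \<in> cluster_points x \<Longrightarrow> norm v \<le> b"
proof -
  assume "v \<in> cluster_points x"
  then have "v \<in> closure (x ` {0..})" unfolding cluster_points_def by blast
  moreover have "closure (x ` {0..}) \<subseteq> cball 0 b" using bound by (intro closure_minimal) auto
  ultimately show ?thesis by auto
qed

lemma compact_cluster_points: "compact (cluster_points x)"
proof -
  have "closed (cluster_points x)" unfolding cluster_points_def by auto
  moreover have "cluster_points x \<subseteq> cball 0 b" using norm_cluster_point_le by auto
  ultimately show ?thesis by (metis bounded_cball bounded_subset compact_eq_bounded_closed)
qed

lemma cluster_points_nonempty: "cluster_points x \<noteq> {}"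
  using bounded_subseq_cluster_point[of "\<lambda>n. n"] by auto

text \<open>The support function of the set of cluster points is the upper limit of \<open>inner c (x k)\<close>; suprema over the
tails display it as a limit, so that it depends measurably on a parameter.\<close>

lemma support_fun_cluster_points_limit:
  "(\<lambda>N. SUP k\<in>{N..}. inner c (x k)) \<longlonglongrightarrow> support_fun (cluster_points x) c" (is "?S \<longlonglongrightarrow> ?s")
proof -
  have bdd: "bdd_above ((\<lambda>k. inner c (x k)) ` A)" for A
  proof (rule bdd_aboveI2)
    fix k show "inner c (x k) \<le> norm c * b"
      by (rule order_trans[OF norm_cauchy_schwarz]) (simp add: bound mult_left_mono)
  qed
  have lower: "?s \<le> ?S N" for N
  proof -
    obtain v where v: "v \<in> cluster_points x" "inner c v = ?s"
      by (rule support_fun_attained[OF compact_cluster_points cluster_points_nonempty])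
    have "closure (x ` {N..}) \<subseteq> {w. inner c w \<le> ?S N}"
      by (intro closure_minimal closed_halfspace_le) (auto intro!: cSUP_upper bdd)
    then show ?thesis using v by (auto simp: cluster_points_def)
  qed
  have upper: "\<forall>\<^sub>F N in sequentially. ?S N < a" if "?s < a" for a
  proof (rule ccontr)
    assume no: "\<not> ?thesis"
    have mono: "?S N \<le> ?S N'" if "N' \<le> N" for N N'
      using that by (intro cSUP_subset_mono bdd) auto
    have ge: "a \<le> ?S N" for N
    proof (rule ccontr)
      assume "\<not> a \<le> ?S N"
      then have "?S n < a" if "n \<ge> N" for n using mono[OF that] by linarith
      then show False using no unfolding eventually_sequentially by blast
    qed
    define a' where "a' = (?s + a) / 2"
    have a': "?s < a'" "a' < a" using that by (auto simp: a'_def)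
    have "\<exists>k\<ge>N. a' < inner c (x k)" for N
    proof -
      have "a' < ?S N" using ge[of N] a' by simp
      then show ?thesis using less_cSUP_iff[OF _ bdd, of "{N..}" a'] by auto
    qed
    then obtain k where k: "\<And>N. k N \<ge> N" "\<And>N. a' < inner c (x (k N))" by metis
    obtain r v where rv: "strict_mono r" "(\<lambda>n. x (k (r n))) \<longlonglongrightarrow> v" "v \<in> cluster_points x"
      using bounded_subseq_cluster_point[of k] k(1) by blast
    have "(\<lambda>n. inner c (x (k (r n)))) \<longlonglongrightarrow> inner c v" by (intro tendsto_intros rv)
    then have "a' \<le> inner c v" using k(2) by (intro LIMSEQ_le_const) (auto intro: less_imp_le)
    also have "\<dots> \<le> ?s" using rv(3) by (intro support_fun_upper compact_cluster_points)
    finally show False using a' by simp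
  qed
  show ?thesis
  proof (rule order_tendstoI)
    fix a assume "a < ?s"
    then show "\<forall>\<^sub>F N in sequentially. a < ?S N" using less_le_trans[OF _ lower] by simp
  next
    fix a assume "?s < a"
    then show "\<forall>\<^sub>F N in sequentially. ?S N < a" by (rule upper)
  qed
qed

end

lemma convergent_cluster_points:
  assumes "x \<longlonglongrightarrow> u" "v \<in> cluster_points x"
  shows "v = u"
proof -
  obtain r :: "nat \<Rightarrow> nat" where r: "strict_mono r" "(\<lambda>n. x (r n)) \<longlonglongrightarrow> v"
    using cluster_points_imp_subseq[OF assms(2)] by blast
  have "(\<lambda>n. x (r n)) \<longlonglongrightarrow> u" using LIMSEQ_subseq_LIMSEQ[OF assms(1) r(1)] by (simp add: comp_def)
  with r(2) show ?thesis by (rule LIMSEQ_unique)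
qed

lemma diagonal_convergent_subseq:
  fixes c :: "nat \<Rightarrow> nat \<Rightarrow> 'a::euclidean_space"
  assumes "\<And>n. bounded (range (c n))"
  obtains r :: "nat \<Rightarrow> nat" where "strict_mono r" "\<And>n. convergent (\<lambda>k. c n (r k))"
proof -
  interpret subseqs "\<lambda>n s. convergent (\<lambda>k. c n (s k))"
  proof
    fix n and s :: "nat \<Rightarrow> nat" assume "strict_mono s"
    have "bounded (range (\<lambda>k. c n (s k)))" by (rule bounded_subset[OF assms[of n]]) auto
    then obtain l r where "strict_mono r" "((\<lambda>k. c n (s k)) \<circ> r) \<longlonglongrightarrow> l"
      using bounded_imp_convergent_subsequence by blast
    then show "\<exists>r'. strict_mono r' \<and> convergent (\<lambda>k. c n ((s \<circ> r') k))"
      by (auto simp: convergent_def comp_def)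
  qed
  have "convergent (\<lambda>k. c n (diagseq k))" for n
  proof -
    have "convergent (\<lambda>k. c n ((diagseq \<circ> (+) (Suc n)) k))"
    proof (rule diagseq_holds)
      fix r s :: "nat \<Rightarrow> nat" and n
      assume "strict_mono r" "convergent (\<lambda>k. c n (s k))"
      then show "convergent (\<lambda>k. c n ((s \<circ> r) k))"
        using convergent_subseq_convergent[of "\<lambda>k. c n (s k)" r] by (simp add: comp_def)
    qed
    then have "convergent (\<lambda>k. c n (diagseq (k + Suc n)))" by (simp add: comp_def add.commute)
    then show ?thesis by (subst (asm) convergent_ignore_initial_segment)
  qed
  with subseq_diagseq that show ?thesis by blast
qed

text \<open>Schmeidler's Fatou lemma for an integrably bounded sequence with values in a Euclidean space. On each
atom the functions are constant, so a diagonal subsequence converges on the union of all atoms. On the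
rest of the space the measure is atomless, and passing to the limit in the integral of
\<open>inner c (x k) \<le> (SUP j\<in>{k..}. inner c (x j))\<close> gives the hypothesis on \<open>p\<close> that is needed to select from the
multifunction of cluster points.\<close>

lemma integral_cluster_selection:
  fixes x :: "nat \<Rightarrow> 't \<Rightarrow> 'a::euclidean_space"
  assumes fin: "finite_measure M" and x: "\<And>k. x k \<in> borel_measurable M"
    and bound: "\<And>k t. t \<in> space M \<Longrightarrow> norm (x k t) \<le> l t" and l: "integrable M l"
    and lim: "(\<lambda>k. integral\<^sup>L M (x k)) \<longlonglongrightarrow> p"
  obtains f where "integrable M f" "integral\<^sup>L M f = p"
    "AE t in M. f t \<in> cluster_points (\<lambda>k. x k t)"
proof -
  interpret finite_measure M by fact
  obtain U :: "nat \<Rightarrow> 't set" where U: "\<And>n. U n = {} \<or> atom M (U n)"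
    and atl: "atomless_on M (space M - (\<Union>n. U n))"
    using atomic_atomless_decomposition[OF fin] by blast
  have "\<exists>c. AE t in M. t \<in> U n \<longrightarrow> x k t = c" for n k
    using U[of n] atom_AE_const[OF fin _ x] by auto
  then obtain c where c: "\<And>n k. AE t in M. t \<in> U n \<longrightarrow> x k t = c n k" by metis
  have cAE: "AE t in M. \<forall>k. t \<in> U n \<longrightarrow> x k t = c n k" for n
    using c by (subst AE_all_countable) blast
  have "\<exists>c'. (AE t in M. \<forall>k. t \<in> U n \<longrightarrow> x k t = c' k) \<and> bounded (range c')" for n
  proof (cases "U n = {}")
    case True
    then show ?thesis by (intro exI[of _ "\<lambda>_. 0"]) auto
  next
    case False
    then have "U n \<in> sets M" "0 < measure M (U n)" using U[of n] by (auto simp: atom_def)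
    have "\<not> (AE t in M. t \<notin> U n)"
    proof
      assume "AE t in M. t \<notin> U n"
      then have "U n \<in> null_sets M"
        using AE_iff_null_sets[OF \<open>U n \<in> sets M\<close>] by simp
      then have "measure M (U n) = 0" by (simp add: measure_eq_0_null_sets)
      then show False using \<open>0 < measure M (U n)\<close> by simp
    qed
    moreover have "AE t in M. t \<notin> U n" if "\<And>t. t \<in> space M \<Longrightarrow> t \<in> U n \<Longrightarrow> \<not> (\<forall>k. x k t = c n k)"
      using cAE[of n] AE_space by eventually_elim (use that in blast)
    ultimately obtain t where t: "t \<in> space M" "t \<in> U n" "\<forall>k. x k t = c n k" by blast
    have "norm (c n k) \<le> l t" for k using t(3) bound[OF t(1), of k] by simp
    then have "bounded (range (c n))" by (auto simp: bounded_iff)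
    with cAE[of n] show ?thesis by blast
  qed
  then have "\<exists>c'. \<forall>n. (AE t in M. \<forall>k. t \<in> U n \<longrightarrow> x k t = c' n k) \<and> bounded (range (c' n))"
    by (intro choice allI)
  then obtain c' where c': "\<And>n. AE t in M. \<forall>k. t \<in> U n \<longrightarrow> x k t = c' n k" "\<And>n. bounded (range (c' n))"
    by blast
  obtain r :: "nat \<Rightarrow> nat" where r: "strict_mono r" "\<And>n. convergent (\<lambda>k. c' n (r k))"
  proof (rule diagonal_convergent_subseq[of c', OF c'(2)])
    fix r :: "nat \<Rightarrow> nat" assume a: "strict_mono r" "\<And>n. convergent (\<lambda>k. c' n (r k))"
    show ?thesis by (rule that[OF a])
  qed
  have "AE t in M. \<forall>n. \<forall>k. t \<in> U n \<longrightarrow> x k t = c' n k"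
    using c'(1) by (simp add: AE_all_countable)
  then obtain Z where Z: "Z \<in> null_sets M"
    "{t \<in> space M. \<not> (\<forall>n k. t \<in> U n \<longrightarrow> x k t = c' n k)} \<subseteq> Z"
    by (auto elim!: AE_E simp: null_sets_def)
  have Zs[measurable]: "Z \<in> sets M" using Z(1) by auto
  \<comment> \<open>after this change on a null set the functions are constant on the atoms without exception\<close>
  define y where "y k t = (if t \<in> Z then 0 else x (r k) t)" for k t
  note x[measurable]
  have y[measurable]: "y k \<in> borel_measurable M" for k unfolding y_def by measurable
  have ybound: "norm (y k t) \<le> l t" if "t \<in> space M" for k t
    using bound[OF that, of "r k"] order_trans[OF norm_ge_zero bound[OF that, of 0]] by (simp add: y_def)
  have yint: "integrable M (y k)" for k by (rule integrable_selection[OF y l ybound])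
  have "integral\<^sup>L M (y k) = integral\<^sup>L M (x (r k))" for k
    by (rule integral_cong_AE) (use AE_not_in[OF Z(1)] in \<open>auto simp: y_def elim!: eventually_mono\<close>)
  then have ylim: "(\<lambda>k. integral\<^sup>L M (y k)) \<longlonglongrightarrow> p"
    using LIMSEQ_subseq_LIMSEQ[OF lim r(1)] by (simp add: comp_def)
  define L where "L t = cluster_points (\<lambda>k. y k t)" for t
  define S where "S c N t = (SUP k\<in>{N..}. inner c (y k t))" for c N t
  have bdd: "bdd_above ((\<lambda>k. inner c (y k t)) ` A)" if "t \<in> space M" for c t A
  proof (rule bdd_aboveI2)
    fix k show "inner c (y k t) \<le> norm c * l t"
      by (rule order_trans[OF norm_cauchy_schwarz]) (simp add: ybound[OF that] mult_left_mono)
  qed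
  have S_meas[measurable]: "S c N \<in> borel_measurable M" for c N
    unfolding S_def by (rule borel_measurable_cSUP) (auto intro: bdd)
  have S_lim: "(\<lambda>N. S c N t) \<longlonglongrightarrow> support_fun (L t) c" if "t \<in> space M" for c t
    unfolding S_def L_def by (rule support_fun_cluster_points_limit[OF ybound[OF that]])
  have L_meas[measurable]: "(\<lambda>t. support_fun (L t) c) \<in> borel_measurable M" for c
    by (rule borel_measurable_LIMSEQ_real[OF S_lim S_meas])
  have mc: "measurable_compact M L"
    unfolding measurable_compact_def L_def[symmetric]
    using compact_cluster_points[OF ybound] cluster_points_nonempty[OF ybound] L_meas by (simp add: L_def)
  have L_bound: "norm v \<le> l t" if "t \<in> space M" "v \<in> L t" for t v
    using norm_cluster_point_le[OF ybound[OF that(1)]] that(2) by (simp add: L_def)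
  have S_bound: "\<bar>S c N t\<bar> \<le> norm c * l t" if t: "t \<in> space M" for c N t
  proof -
    have le: "\<bar>inner c (y k t)\<bar> \<le> norm c * l t" for k
      by (rule order_trans[OF Cauchy_Schwarz_ineq2]) (simp add: ybound[OF t] mult_left_mono)
    have "S c N t \<le> norm c * l t" unfolding S_def using le by (intro cSUP_least) (auto simp: abs_le_iff)
    moreover have "inner c (y N t) \<le> S c N t" unfolding S_def by (intro cSUP_upper bdd t) auto
    ultimately show ?thesis using le[of N] by linarith
  qed
  have "inner c p \<le> (\<integral>t. support_fun (L t) c \<partial>M)" for c
  proof -
    have il: "integrable M (\<lambda>t. norm c * l t)" using l by simp
    have "(\<lambda>N. \<integral>t. S c N t \<partial>M) \<longlonglongrightarrow> (\<integral>t. support_fun (L t) c \<partial>M)"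
      by (rule integral_dominated_convergence[OF L_meas S_meas il])
        (use S_lim S_bound in \<open>auto intro!: AE_I2\<close>)
    moreover have "(\<lambda>k. inner c (integral\<^sup>L M (y k))) \<longlonglongrightarrow> inner c p" by (intro tendsto_intros ylim)
    moreover have "inner c (integral\<^sup>L M (y k)) \<le> (\<integral>t. S c k t \<partial>M)" for k
    proof -
      have "inner c (integral\<^sup>L M (y k)) = (\<integral>t. inner c (y k t) \<partial>M)" using yint by simp
      also have "\<dots> \<le> (\<integral>t. S c k t \<partial>M)"
      proof (rule integral_mono)
        show "integrable M (\<lambda>t. inner c (y k t))" using yint by simp
        show "integrable M (S c k)"
        proof (rule Bochner_Integration.integrable_bound[OF il S_meas], rule AE_I2)
          fix t assume "t \<in> space M"
          from S_bound[OF this, of c k] show "norm (S c k t) \<le> norm (norm c * l t)" by simp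
        qed
        show "inner c (y k t) \<le> S c k t" if "t \<in> space M" for t
          unfolding S_def using that by (intro cSUP_upper bdd) auto
      qed
      finally show ?thesis .
    qed
    ultimately show ?thesis using LIMSEQ_le by blast
  qed
  moreover have "v = w" if "t \<in> space M - (space M - (\<Union>n. U n))" "v \<in> L t" "w \<in> L t" for t v w
  proof -
    have "convergent (\<lambda>k. y k t)"
    proof (cases "t \<in> Z")
      case True then show ?thesis by (simp add: y_def convergent_const)
    next
      case False
      from that(1) obtain n where n: "t \<in> U n" "t \<in> space M" by blast
      then have "(\<lambda>k. y k t) = (\<lambda>k. c' n (r k))" using Z(2) False by (auto simp: y_def)
      then show ?thesis using r(2) by simp
    qed
    then obtain u where "(\<lambda>k. y k t) \<longlonglongrightarrow> u" by (auto simp: convergent_def)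
    then show ?thesis using that(2,3) convergent_cluster_points unfolding L_def by metis
  qed
  ultimately obtain f where f: "f \<in> borel_measurable M" "\<forall>t\<in>space M. f t \<in> L t" "integral\<^sup>L M f = p"
    using convexified_integral_selection[OF fin atl l subspace_UNIV mc L_bound UNIV_I, of p] by blast
  have "integrable M f" using f L_bound by (intro integrable_selection[OF _ l]) auto
  moreover have "AE t in M. f t \<in> cluster_points (\<lambda>k. x k t)"
    using AE_not_in[OF Z(1)] AE_space
  proof eventually_elim
    case (elim t)
    then have "f t \<in> cluster_points (\<lambda>k. y k t)" using f(2) by (simp add: L_def)
    then have "f t \<in> cluster_points (\<lambda>k. x (r k) t)" using elim by (simp add: y_def)
    then obtain s :: "nat \<Rightarrow> nat" where s: "strict_mono s" "(\<lambda>n. x (r (s n)) t) \<longlonglongrightarrow> f t"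
      using cluster_points_imp_subseq by blast
    then show ?case using seq_suble[OF r(1)] by (intro cluster_points_subseqI[of r s]) auto
  qed
  ultimately show ?thesis using f(3) that by blast
qed

section \<open>Limiting proximal subgradients\<close>

text \<open>Limits of proximal subgradients at points converging to \<open>w\<close>. The proximal inequality is required on all
of \<open>K\<close>, but the curvatures \<open>N k\<close> may be unbounded.\<close>

definition limiting_proximal_subgradients :: "'a::real_inner set \<Rightarrow> ('a \<Rightarrow> real) \<Rightarrow> 'a \<Rightarrow> 'a set" where
  "limiting_proximal_subgradients K f w = {v. \<exists>u V N. u \<longlonglongrightarrow> w \<and> V \<longlonglongrightarrow> v \<and>
     (\<forall>k::nat. u k \<in> K \<and> (\<forall>y\<in>K. f (u k) + inner (V k) (y - u k) - N k * (norm (y - u k))\<^sup>2 \<le> f y))}"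

text \<open>A parabola that touches the graph from below at \<open>u k\<close> makes \<open>(V k, -1)\<close> a regular normal to the epigraph.\<close>

lemma limiting_proximal_subgradients_subset_subdiff:
  fixes f :: "'a::real_inner \<Rightarrow> ereal"
  assumes "\<eta> > 0" and f: "\<And>u. u \<in> cball w \<eta> \<Longrightarrow> f u = ereal (h u)"
    and cont: "continuous_on (cball w \<eta>) h"
  shows "limiting_proximal_subgradients (cball w \<eta>) h w \<subseteq> subdiff f w"
proof
  fix v assume "v \<in> limiting_proximal_subgradients (cball w \<eta>) h w"
  then obtain u V N where u: "u \<longlonglongrightarrow> w" and V: "V \<longlonglongrightarrow> v" and uK: "\<And>k::nat. u k \<in> cball w \<eta>" and
    prox: "\<And>k y. y \<in> cball w \<eta> \<Longrightarrow> h (u k) + inner (V k) (y - u k) - N k * (norm (y - u k))\<^sup>2 \<le> h y"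
    unfolding limiting_proximal_subgradients_def by blast
  have fw: "f w = ereal (h w)" using f[of w] \<open>\<eta> > 0\<close> by simp
  obtain k0 where k0: "\<And>k. k \<ge> k0 \<Longrightarrow> dist (u k) w < \<eta>"
    using u \<open>\<eta> > 0\<close> unfolding lim_sequentially by metis
  have "(V k, -1) \<in> regular_normal_cone (u k, h (u k)) (epi f)" if "k \<ge> k0" for k
    unfolding regular_normal_cone_iff
  proof (intro conjI allI impI)
    show "(u k, h (u k)) \<in> epi f" using f[OF uK[of k]] by (simp add: epi_def)
    fix e :: real assume "e > 0"
    define d where "d = min (\<eta> - dist (u k) w) (e / (\<bar>N k\<bar> + 1))"
    have "d > 0" using k0[OF that] \<open>e > 0\<close> by (simp add: d_def add_nonneg_pos)
    have "inner (V k, -1) (z - (u k, h (u k))) \<le> e * norm (z - (u k, h (u k)))"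
      if z: "z \<in> epi f" "norm (z - (u k, h (u k))) < d" for z
    proof -
      obtain y a where ya: "z = (y, a)" by (cases z)
      have ny: "norm (y - u k) \<le> norm (z - (u k, h (u k)))"
        using norm_fst_le[of "y - u k" "a - h (u k)"] by (simp add: ya)
      then have "norm (y - u k) < d" using z(2) by linarith
      then have "dist (u k) y < \<eta> - dist (u k) w" "norm (y - u k) < e / (\<bar>N k\<bar> + 1)"
        by (auto simp: d_def dist_norm norm_minus_commute)
      then have yK: "y \<in> cball w \<eta>" using dist_triangle[of w y "u k"] by (simp add: dist_commute)
      have "h y \<le> a" using z(1) f[OF yK] by (simp add: epi_def ya)
      then have "inner (V k, -1) (z - (u k, h (u k))) \<le> N k * (norm (y - u k))\<^sup>2"
        using prox[OF yK, of k] by (simp add: ya inner_Pair)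
      also have "\<dots> \<le> (\<bar>N k\<bar> + 1) * (norm (y - u k))\<^sup>2" by (intro mult_right_mono) auto
      also have "\<dots> = ((\<bar>N k\<bar> + 1) * norm (y - u k)) * norm (y - u k)" by (simp add: power2_eq_square)
      also have "\<dots> \<le> e * norm (y - u k)"
        using \<open>norm (y - u k) < e / (\<bar>N k\<bar> + 1)\<close>
        by (intro mult_right_mono) (simp_all add: pos_less_divide_eq add_nonneg_pos mult.commute)
      also have "\<dots> \<le> e * norm (z - (u k, h (u k)))" using ny \<open>e > 0\<close> by simp
      finally show ?thesis .
    qed
    with \<open>d > 0\<close> show "\<exists>d>0. \<forall>z\<in>epi f. norm (z - (u k, h (u k))) < d \<longrightarrow>
        inner (V k, -1) (z - (u k, h (u k))) \<le> e * norm (z - (u k, h (u k)))" by blast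
  qed
  then have "(V (k + k0), -1) \<in> regular_normal_cone (u (k + k0), h (u (k + k0))) (epi f)" for k by simp
  moreover have "(\<lambda>k. h (u k)) \<longlonglongrightarrow> h w"
  proof (rule continuous_on_tendsto_compose[OF cont u])
    show "w \<in> cball w \<eta>" using \<open>\<eta> > 0\<close> by simp
    show "\<forall>\<^sub>F k in sequentially. u k \<in> cball w \<eta>" by (intro always_eventually allI uK)
  qed
  then have "(\<lambda>k. (u (k + k0), h (u (k + k0)))) \<longlonglongrightarrow> (w, h w)"
    by (intro tendsto_Pair LIMSEQ_ignore_initial_segment u)
  moreover have "(\<lambda>k. (V (k + k0), - 1 :: real)) \<longlonglongrightarrow> (v, - 1)"
    by (intro tendsto_Pair LIMSEQ_ignore_initial_segment[OF V] tendsto_const)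
  ultimately have "(v, -1) \<in> normal_cone (w, h w) (epi f)"
    unfolding normal_cone_def by blast
  then show "v \<in> subdiff f w" by (simp add: subdiff_def fw)
qed

text \<open>Convexity along the second variable removes the quadratic error: apply the proximal inequality
at a point of the segment from \<open>u k\<close> towards the point \<open>y k\<close> with the same first component, divide by
the length and let it tend to zero. The resulting subgradient inequality passes to the limit.\<close>

lemma limiting_proximal_subgradient_partially_convex:
  fixes h :: "'a::real_inner \<times> 'b::real_inner \<Rightarrow> real"
  assumes v: "v \<in> limiting_proximal_subgradients K h (x, z)" and cont: "continuous_on K h" and "convex K"
    and z': "(x, z') \<in> interior K" and "(x, z) \<in> K"
    and conv: "\<And>x u u' r. (x, u) \<in> K \<Longrightarrow> (x, u') \<in> K \<Longrightarrow> 0 \<le> r \<Longrightarrow> r \<le> 1 \<Longrightarrow>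
      h (x, (1 - r) *\<^sub>R u + r *\<^sub>R u') \<le> (1 - r) * h (x, u) + r * h (x, u')"
  shows "inner v (0, z' - z) \<le> h (x, z') - h (x, z)"
proof -
  from v obtain u V N where u: "u \<longlonglongrightarrow> (x, z)" and V: "V \<longlonglongrightarrow> v" and uK: "\<And>k::nat. u k \<in> K" and
    prox: "\<And>k y. y \<in> K \<Longrightarrow> h (u k) + inner (V k) (y - u k) - N k * (norm (y - u k))\<^sup>2 \<le> h y"
    unfolding limiting_proximal_subgradients_def by blast
  define y where "y k = (fst (u k), z')" for k
  have y: "y \<longlonglongrightarrow> (x, z')" unfolding y_def using tendsto_fst[OF u] by (intro tendsto_Pair) auto
  have "\<forall>\<^sub>F k in sequentially. y k \<in> interior K"
    using y z' by (intro topological_tendstoD) auto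
  then have yK: "\<forall>\<^sub>F k in sequentially. y k \<in> K"
    by (rule eventually_mono) (use interior_subset in blast)
  have le: "inner (V k) (y k - u k) \<le> h (y k) - h (u k)" if "y k \<in> K" for k
  proof -
    define c where "c = N k * (norm (y k - u k))\<^sup>2"
    have "inner (V k) (y k - u k) - r * c \<le> h (y k) - h (u k)" if r: "0 < r" "r \<le> 1" for r
    proof -
      let ?p = "u k + r *\<^sub>R (y k - u k)"
      have p: "?p = (1 - r) *\<^sub>R u k + r *\<^sub>R y k" by (simp add: algebra_simps)
      then have "?p \<in> K" using \<open>convex K\<close> uK \<open>y k \<in> K\<close> r by (simp add: convex_alt)
      from prox[OF this, of k]
      have "h (u k) + r * inner (V k) (y k - u k) - r * (r * c) \<le> h ?p"
        by (simp add: c_def power_mult_distrib power2_eq_square mult_ac)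
      moreover have "?p = (fst (u k), (1 - r) *\<^sub>R snd (u k) + r *\<^sub>R z')"
        unfolding y_def by (cases "u k") (simp add: algebra_simps)
      then have "h ?p \<le> (1 - r) * h (u k) + r * h (y k)"
        using conv[of "fst (u k)" "snd (u k)" z' r] uK[of k] \<open>y k \<in> K\<close> r by (simp add: y_def)
      ultimately have "r * (inner (V k) (y k - u k) - r * c) \<le> r * (h (y k) - h (u k))"
        by (simp add: algebra_simps)
      then show ?thesis using r by simp
    qed
    then have "\<forall>\<^sub>F r in at_right 0. inner (V k) (y k - u k) - r * c \<le> h (y k) - h (u k)"
      unfolding eventually_at_right_field by (auto intro!: exI[of _ 1])
    moreover have "((\<lambda>r. inner (V k) (y k - u k) - r * c) \<longlongrightarrow> inner (V k) (y k - u k) - 0 * c) (at_right 0)"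
      by (intro tendsto_intros)
    ultimately show ?thesis using tendsto_upperbound[of _ _ "at_right (0::real)"] by fastforce
  qed
  have "(\<lambda>k. inner (V k) (y k - u k)) \<longlonglongrightarrow> inner v ((x, z') - (x, z))"
    by (intro tendsto_inner V tendsto_diff y u)
  moreover have "(\<lambda>k. h (y k) - h (u k)) \<longlonglongrightarrow> h (x, z') - h (x, z)"
    using continuous_on_tendsto_compose[OF cont y _ yK] continuous_on_tendsto_compose[OF cont u \<open>(x, z) \<in> K\<close>]
      uK z' interior_subset by (intro tendsto_diff) auto
  moreover have "\<forall>\<^sub>F k in sequentially. inner (V k) (y k - u k) \<le> h (y k) - h (u k)"
    using yK by (rule eventually_mono) (rule le)
  ultimately have "inner v ((x, z') - (x, z)) \<le> h (x, z') - h (x, z)"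
    by (intro tendsto_le[OF sequentially_bot])
  then show ?thesis by simp
qed

lemma limiting_proximal_subgradient_zero_function:
  fixes v :: "'a::real_inner"
  assumes "\<eta> > 0" and v: "v \<in> limiting_proximal_subgradients (cball w \<eta>) (\<lambda>_. 0) w"
  shows "v = 0"
proof -
  from v obtain u V N where u: "u \<longlonglongrightarrow> w" and V: "V \<longlonglongrightarrow> v" and
    all: "\<forall>k::nat. u k \<in> cball w \<eta> \<and> (\<forall>y\<in>cball w \<eta>. 0 + inner (V k) (y - u k) - N k * (norm (y - u k))\<^sup>2 \<le> 0)"
    unfolding limiting_proximal_subgradients_def by blast
  have prox: "inner (V k) (y - u k) - N k * (norm (y - u k))\<^sup>2 \<le> 0" if "y \<in> cball w \<eta>" for k y
    using all[rule_format, of k] that by simp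
  have zero: "V k = 0" if "dist (u k) w < \<eta>" for k :: nat
  proof (rule ccontr)
    assume "V k \<noteq> 0"
    then have nV: "norm (V k) > 0" by simp
    define s where "s = min ((\<eta> - dist (u k) w) / norm (V k)) (1 / (\<bar>N k\<bar> + 1))"
    have "s > 0" using that nV by (simp add: s_def add_nonneg_pos)
    have "s \<le> (\<eta> - dist (u k) w) / norm (V k)" by (simp add: s_def)
    then have "s * norm (V k) \<le> \<eta> - dist (u k) w" using nV by (simp add: pos_le_divide_eq)
    then have "u k + s *\<^sub>R V k \<in> cball w \<eta>"
      using dist_triangle[of w "u k + s *\<^sub>R V k" "u k"] \<open>s > 0\<close> by (simp add: dist_norm norm_minus_commute)
    from prox[OF this, of k] have "s * (norm (V k))\<^sup>2 \<le> N k * (s * norm (V k))\<^sup>2"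
      using \<open>s > 0\<close> by (simp add: power2_norm_eq_inner)
    then have "s * (norm (V k))\<^sup>2 * 1 \<le> s * (norm (V k))\<^sup>2 * (N k * s)" by (simp add: power2_eq_square mult_ac)
    then have "1 \<le> N k * s" using \<open>s > 0\<close> nV by (subst (asm) mult_le_cancel_left_pos) auto
    also have "\<dots> \<le> \<bar>N k\<bar> * (1 / (\<bar>N k\<bar> + 1))" using \<open>s > 0\<close> by (intro mult_mono) (auto simp: s_def)
    also have "\<dots> < 1" by (simp add: add_nonneg_pos)
    finally show False by simp
  qed
  have "\<forall>\<^sub>F k in sequentially. dist (u k) w < \<eta>" using u \<open>\<eta> > 0\<close> by (rule tendstoD)
  then have "\<forall>\<^sub>F k in sequentially. V k = 0" by (rule eventually_mono) (rule zero)
  then have "V \<longlonglongrightarrow> 0" by (rule tendsto_eventually)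
  with V show ?thesis using LIMSEQ_unique by blast
qed

section \<open>Expectations of Lipschitz integrands and their Moreau envelopes\<close>

locale lipschitz_integrand = finite_measure M for M :: "'t measure" +
  fixes \<phi> :: "'t \<Rightarrow> 'a::euclidean_space \<Rightarrow> real" and l :: "'t \<Rightarrow> real" and w :: 'a and \<eta> :: real
  assumes eta_pos: "\<eta> > 0"
    and phi_measurable: "\<And>u. u \<in> cball w \<eta> \<Longrightarrow> (\<lambda>t. \<phi> t u) \<in> borel_measurable M"
    and phi_lipschitz: "\<And>t. t \<in> space M \<Longrightarrow> (l t)-lipschitz_on (cball w \<eta>) (\<phi> t)"
    and l_integrable: "integrable M l"
    and phi_integrable_center: "integrable M (\<lambda>t. \<phi> t w)"
begin

definition E :: "'a \<Rightarrow> real" where "E u = (\<integral>t. \<phi> t u \<partial>M)"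

text \<open>The Moreau envelope of the integrand restricted to the ball.\<close>

definition envelope :: "real \<Rightarrow> 't \<Rightarrow> 'a \<Rightarrow> real" where
  "envelope N t p = (INF u\<in>cball w \<eta>. \<phi> t u + N / 2 * (norm (u - p))\<^sup>2)"

lemma l_nonneg: "t \<in> space M \<Longrightarrow> 0 \<le> l t"
  using phi_lipschitz by (auto simp: lipschitz_on_def)

lemma phi_diff: "t \<in> space M \<Longrightarrow> u \<in> cball w \<eta> \<Longrightarrow> v \<in> cball w \<eta> \<Longrightarrow> \<bar>\<phi> t u - \<phi> t v\<bar> \<le> l t * norm (u - v)"
  using lipschitz_onD[OF phi_lipschitz] by (simp add: dist_norm)

lemma phi_continuous: "t \<in> space M \<Longrightarrow> continuous_on (cball w \<eta>) (\<phi> t)"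
  using phi_lipschitz by (rule lipschitz_on_continuous_on)

lemma norm_diff_ball: "u \<in> cball w \<eta> \<Longrightarrow> v \<in> cball w \<eta> \<Longrightarrow> norm (u - v) \<le> 2 * \<eta>"
  using dist_triangle[of u v w] by (simp add: dist_norm norm_minus_commute)

lemma phi_integrable:
  assumes "u \<in> cball w \<eta>" shows "integrable M (\<lambda>t. \<phi> t u)"
proof (rule Bochner_Integration.integrable_bound)
  show "integrable M (\<lambda>t. \<bar>\<phi> t w\<bar> + l t * norm (u - w))"
    using phi_integrable_center l_integrable by simp
  show "AE t in M. norm (\<phi> t u) \<le> norm (\<bar>\<phi> t w\<bar> + l t * norm (u - w))"
  proof (rule AE_I2)
    fix t assume t: "t \<in> space M"
    have "\<bar>\<phi> t u - \<phi> t w\<bar> \<le> l t * norm (u - w)" using t assms eta_pos by (intro phi_diff) auto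
    then show "norm (\<phi> t u) \<le> norm (\<bar>\<phi> t w\<bar> + l t * norm (u - w))" by simp
  qed
qed (rule phi_measurable[OF assms])

lemma E_lipschitz:
  assumes "u \<in> cball w \<eta>" "v \<in> cball w \<eta>"
  shows "\<bar>E u - E v\<bar> \<le> integral\<^sup>L M l * norm (u - v)"
proof -
  have "\<bar>E u - E v\<bar> = \<bar>\<integral>t. \<phi> t u - \<phi> t v \<partial>M\<bar>" using assms phi_integrable by (simp add: E_def)
  also have "\<dots> \<le> (\<integral>t. l t * norm (u - v) \<partial>M)"
    using assms by (intro integral_abs_bound[THEN order_trans] integral_mono)
      (auto intro!: phi_diff Bochner_Integration.integrable_abs Bochner_Integration.integrable_diff phi_integrable l_integrable)
  finally show ?thesis using l_integrable by simp
qed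

text \<open>A measurable choice of points at which the infimum in the envelope is attained. The vectors
\<open>N *\<^sub>R (p - s t)\<close> are then proximal subgradients of \<open>\<phi> t\<close> at \<open>s t\<close>, relative to the ball.\<close>

definition proximal_selection :: "real \<Rightarrow> 'a \<Rightarrow> ('t \<Rightarrow> 'a) \<Rightarrow> bool" where
  "proximal_selection N p s \<longleftrightarrow> s \<in> borel_measurable M \<and>
     (\<forall>t\<in>space M. s t \<in> cball w \<eta> \<and> envelope N t p = \<phi> t (s t) + N / 2 * (norm (s t - p))\<^sup>2)"

lemma proximal_selectionD:
  assumes "proximal_selection N p s"
  shows "s \<in> borel_measurable M" "t \<in> space M \<Longrightarrow> s t \<in> cball w \<eta>"
    "t \<in> space M \<Longrightarrow> envelope N t p = \<phi> t (s t) + N / 2 * (norm (s t - p))\<^sup>2"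
  using assms by (auto simp: proximal_selection_def)

lemma power2_norm_diff: "(norm (a - b))\<^sup>2 = (norm a)\<^sup>2 - 2 * inner a b + (norm b)\<^sup>2"
  for a b :: "'b::real_inner"
  by (simp add: power2_norm_eq_inner inner_diff_left inner_diff_right inner_commute)

lemma proximal_selection_exists:
  obtains s where "proximal_selection N p s" "(\<lambda>t. envelope N t p) \<in> borel_measurable M"
proof -
  let ?f = "\<lambda>t u. \<phi> t u + N / 2 * (norm (u - p))\<^sup>2"
  have K: "compact (cball w \<eta>)" "cball w \<eta> \<noteq> {}" using eta_pos by auto
  have cont: "continuous_on (cball w \<eta>) (?f t)" if "t \<in> space M" for t
    using phi_continuous[OF that] by (intro continuous_intros)
  have meas: "(\<lambda>t. ?f t u) \<in> borel_measurable M" if "u \<in> cball w \<eta>" for u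
    using phi_measurable[OF that] by simp
  obtain s where s: "s \<in> borel_measurable M" "(\<lambda>t. ?f t (s t)) \<in> borel_measurable M"
    "\<And>t. t \<in> space M \<Longrightarrow> s t \<in> cball w \<eta>" "\<And>t u. t \<in> space M \<Longrightarrow> u \<in> cball w \<eta> \<Longrightarrow> ?f t (s t) \<le> ?f t u"
    using measurable_argmin[OF K cont meas] by blast
  have env: "envelope N t p = ?f t (s t)" if t: "t \<in> space M" for t
    unfolding envelope_def using s(3,4)[OF t] by (intro cInf_eq_minimum) auto
  have "(\<lambda>t. envelope N t p) \<in> borel_measurable M" using s(2) env by (simp cong: measurable_cong)
  moreover have "proximal_selection N p s" using s(1,3) env by (simp add: proximal_selection_def)
  ultimately show ?thesis using that by blast
qed

lemma envelope_le:
  assumes t: "t \<in> space M" and u: "u \<in> cball w \<eta>"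
  shows "envelope N t p \<le> \<phi> t u + N / 2 * (norm (u - p))\<^sup>2"
  unfolding envelope_def
proof (rule cINF_lower[OF _ u])
  have "continuous_on (cball w \<eta>) (\<lambda>u. \<phi> t u + N / 2 * (norm (u - p))\<^sup>2)"
    using phi_continuous[OF t] by (intro continuous_intros)
  then have "compact ((\<lambda>u. \<phi> t u + N / 2 * (norm (u - p))\<^sup>2) ` cball w \<eta>)"
    by (rule compact_continuous_image) simp
  then show "bdd_below ((\<lambda>u. \<phi> t u + N / 2 * (norm (u - p))\<^sup>2) ` cball w \<eta>)"
    by (intro bounded_imp_bdd_below compact_imp_bounded)
qed

text \<open>Beyond the distance \<open>2 * l t / N\<close> the quadratic penalty exceeds what the Lipschitz function \<open>\<phi> t\<close> can gain.\<close>

lemma proximal_selection_displacement: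
  assumes s: "proximal_selection N p s" and p: "p \<in> cball w \<eta>" and t: "t \<in> space M"
  shows "N * norm (s t - p) \<le> 2 * l t"
proof (cases "s t = p")
  case True then show ?thesis using l_nonneg[OF t] by simp
next
  case False
  have "N / 2 * (norm (s t - p))\<^sup>2 \<le> \<phi> t p - \<phi> t (s t)"
    using envelope_le[OF t p, of N p] proximal_selectionD(3)[OF s t] by simp
  also have "\<dots> \<le> l t * norm (s t - p)"
    using phi_diff[OF t p proximal_selectionD(2)[OF s t]] by (simp add: norm_minus_commute)
  finally have "(N * norm (s t - p)) * norm (s t - p) \<le> (2 * l t) * norm (s t - p)"
    by (simp add: power2_eq_square)
  then show ?thesis using False by simp
qed

text \<open>The bound by the diameter \<open>2 * \<eta>\<close> keeps the right-hand side integrable although \<open>l\<close> need not be square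
integrable.\<close>

lemma phi_minus_envelope_le:
  assumes p: "p \<in> cball w \<eta>" and "N > 0" and t: "t \<in> space M"
  shows "\<phi> t p - envelope N t p \<le> l t * min (2 * l t / N) (2 * \<eta>)"
proof -
  obtain s where s: "proximal_selection N p s" by (rule proximal_selection_exists)
  note sK = proximal_selectionD(2)[OF s t]
  have "\<phi> t p - envelope N t p \<le> \<phi> t p - \<phi> t (s t)"
    using proximal_selectionD(3)[OF s t] \<open>N > 0\<close> by simp
  also have "\<dots> \<le> l t * norm (s t - p)" using phi_diff[OF t p sK] by (simp add: norm_minus_commute)
  also have "\<dots> \<le> l t * min (2 * l t / N) (2 * \<eta>)"
    using proximal_selection_displacement[OF s p t] \<open>N > 0\<close> norm_diff_ball[OF sK p] l_nonneg[OF t]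
    by (intro mult_left_mono) (auto simp: pos_le_divide_eq mult.commute)
  finally show ?thesis .
qed

lemma proximal_selection_inequality:
  assumes s: "proximal_selection N p s" and t: "t \<in> space M" and y: "y \<in> cball w \<eta>"
  shows "\<phi> t (s t) + inner (N *\<^sub>R (p - s t)) (y - s t) - N / 2 * (norm (y - s t))\<^sup>2 \<le> \<phi> t y"
proof -
  have "\<phi> t (s t) + N / 2 * (norm (s t - p))\<^sup>2 \<le> \<phi> t y + N / 2 * (norm (y - p))\<^sup>2"
    using envelope_le[OF t y, of N p] proximal_selectionD(3)[OF s t] by simp
  moreover have "(norm (y - p))\<^sup>2 = (norm (y - s t))\<^sup>2 - 2 * inner (y - s t) (p - s t) + (norm (s t - p))\<^sup>2"
    using power2_norm_diff[of "y - s t" "p - s t"] by (simp add: norm_minus_commute)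
  ultimately show ?thesis by (simp add: algebra_simps inner_commute)
qed

lemma
  assumes s: "proximal_selection N p s" and p: "p \<in> cball w \<eta>" and "N > 0"
  shows proximal_selection_bound: "t \<in> space M \<Longrightarrow> norm (N *\<^sub>R (p - s t)) \<le> 2 * l t"
    and proximal_selection_integrable: "integrable M (\<lambda>t. N *\<^sub>R (p - s t))"
    and proximal_selection_integral_le: "norm (\<integral>t. N *\<^sub>R (p - s t) \<partial>M) \<le> 2 * integral\<^sup>L M l"
proof -
  have bnd: "norm (N *\<^sub>R (p - s t)) \<le> 2 * l t" if "t \<in> space M" for t
    using proximal_selection_displacement[OF s p that] \<open>N > 0\<close> by (simp add: norm_minus_commute)
  then show "norm (N *\<^sub>R (p - s t)) \<le> 2 * l t" if "t \<in> space M" using that .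
  have meas: "(\<lambda>t. N *\<^sub>R (p - s t)) \<in> borel_measurable M"
    using proximal_selectionD(1)[OF s] by measurable
  have l2: "integrable M (\<lambda>t. 2 * l t)" using l_integrable by simp
  show int: "integrable M (\<lambda>t. N *\<^sub>R (p - s t))" by (rule integrable_selection[OF meas l2 bnd])
  have "norm (\<integral>t. N *\<^sub>R (p - s t) \<partial>M) \<le> (\<integral>t. 2 * l t \<partial>M)"
  proof (rule order_trans[OF integral_norm_bound integral_mono])
    show "integrable M (\<lambda>t. norm (N *\<^sub>R (p - s t)))" using int by (rule integrable_norm)
  qed (use l2 bnd in blast)+
  then show "norm (\<integral>t. N *\<^sub>R (p - s t) \<partial>M) \<le> 2 * integral\<^sup>L M l" by simp
qed

definition E_envelope :: "real \<Rightarrow> 'a \<Rightarrow> real" where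
  "E_envelope N p = (\<integral>t. envelope N t p \<partial>M)"

definition envelope_gap :: "real \<Rightarrow> real" where
  "envelope_gap N = (\<integral>t. l t * min (2 * l t / N) (2 * \<eta>) \<partial>M)"

lemma gap_bound: "t \<in> space M \<Longrightarrow> N > 0 \<Longrightarrow> \<bar>l t * min (2 * l t / N) (2 * \<eta>)\<bar> \<le> 2 * \<eta> * l t"
proof -
  assume t: "t \<in> space M" and "N > 0"
  have "0 \<le> min (2 * l t / N) (2 * \<eta>)" using l_nonneg[OF t] \<open>N > 0\<close> eta_pos by simp
  then have "\<bar>l t * min (2 * l t / N) (2 * \<eta>)\<bar> = l t * min (2 * l t / N) (2 * \<eta>)"
    using l_nonneg[OF t] by (simp only: abs_mult abs_of_nonneg)
  also have "\<dots> \<le> l t * (2 * \<eta>)" using l_nonneg[OF t] by (intro mult_left_mono) auto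
  finally show ?thesis by (simp add: mult_ac)
qed

lemma l_measurable [measurable]: "l \<in> borel_measurable M"
  using l_integrable by simp

lemma gap_integrable: "N > 0 \<Longrightarrow> integrable M (\<lambda>t. l t * min (2 * l t / N) (2 * \<eta>))"
proof (rule Bochner_Integration.integrable_bound)
  assume "N > 0"
  show "integrable M (\<lambda>t. 2 * \<eta> * l t)" using l_integrable by simp
  show "AE t in M. norm (l t * min (2 * l t / N) (2 * \<eta>)) \<le> norm (2 * \<eta> * l t)"
  proof (rule AE_I2)
    fix t assume "t \<in> space M"
    from gap_bound[OF this \<open>N > 0\<close>] show "norm (l t * min (2 * l t / N) (2 * \<eta>)) \<le> norm (2 * \<eta> * l t)"
      by simp
  qed
qed measurable

lemma envelope_gap_tendsto_0: "(\<lambda>n. envelope_gap (real (Suc n))) \<longlonglongrightarrow> 0"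
proof -
  have "(\<lambda>n. \<integral>t. l t * min (2 * l t / real (Suc n)) (2 * \<eta>) \<partial>M) \<longlonglongrightarrow> (\<integral>t. 0 \<partial>M)"
  proof (rule integral_dominated_convergence[where w = "\<lambda>t. 2 * \<eta> * l t"])
    show "integrable M (\<lambda>t. 2 * \<eta> * l t)" using l_integrable by simp
    show "AE t in M. (\<lambda>n. l t * min (2 * l t / real (Suc n)) (2 * \<eta>)) \<longlonglongrightarrow> 0"
    proof (rule AE_I2)
      fix t
      have "(\<lambda>n. l t * min (2 * l t * (1 / real (Suc n))) (2 * \<eta>)) \<longlonglongrightarrow> l t * min (2 * l t * 0) (2 * \<eta>)"
        by (intro tendsto_mult tendsto_min tendsto_const LIMSEQ_Suc lim_1_over_n)
      then show "(\<lambda>n. l t * min (2 * l t / real (Suc n)) (2 * \<eta>)) \<longlonglongrightarrow> 0" using eta_pos by simp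
    qed
    show "AE t in M. norm (l t * min (2 * l t / real (Suc n)) (2 * \<eta>)) \<le> 2 * \<eta> * l t" for n
      using gap_bound[of _ "real (Suc n)"] by (intro AE_I2) simp
  qed measurable
  then show ?thesis by (simp add: envelope_gap_def)
qed

lemma
  assumes p: "p \<in> cball w \<eta>" and "N > 0"
  shows envelope_integrable: "integrable M (\<lambda>t. envelope N t p)"
    and E_envelope_le: "E_envelope N p \<le> E p"
    and E_envelope_ge: "E p - envelope_gap N \<le> E_envelope N p"
proof -
  have s: "(\<lambda>t. envelope N t p) \<in> borel_measurable M"
    "\<And>t. t \<in> space M \<Longrightarrow> \<phi> t p - envelope N t p \<le> l t * min (2 * l t / N) (2 * \<eta>)"
    using proximal_selection_exists[of N p] phi_minus_envelope_le[OF assms] by blast+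
  have le: "envelope N t p \<le> \<phi> t p" if "t \<in> space M" for t using envelope_le[OF that p, of N p] by simp
  show int: "integrable M (\<lambda>t. envelope N t p)"
  proof (rule Bochner_Integration.integrable_bound[OF _ s(1)])
    show "integrable M (\<lambda>t. \<bar>\<phi> t p\<bar> + 2 * \<eta> * l t)" using phi_integrable[OF p] l_integrable by simp
    show "AE t in M. norm (envelope N t p) \<le> norm (\<bar>\<phi> t p\<bar> + 2 * \<eta> * l t)"
    proof (rule AE_I2)
      fix t assume t: "t \<in> space M"
      show "norm (envelope N t p) \<le> norm (\<bar>\<phi> t p\<bar> + 2 * \<eta> * l t)"
        using s(2)[OF t] le[OF t] gap_bound[OF t \<open>N > 0\<close>] by (simp add: abs_le_iff) linarith
    qed
  qed
  show "E_envelope N p \<le> E p"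
    unfolding E_envelope_def E_def using int phi_integrable[OF p] le by (intro integral_mono) auto
  have "E p \<le> (\<integral>t. envelope N t p + l t * min (2 * l t / N) (2 * \<eta>) \<partial>M)"
    unfolding E_def using s(2)
    by (intro integral_mono phi_integrable[OF p] Bochner_Integration.integrable_add int gap_integrable[OF \<open>N > 0\<close>])
      (simp add: algebra_simps)
  also have "\<dots> = E_envelope N p + envelope_gap N"
    unfolding E_envelope_def envelope_gap_def
    by (intro Bochner_Integration.integral_add int gap_integrable[OF \<open>N > 0\<close>])
  finally show "E p - envelope_gap N \<le> E_envelope N p" by simp
qed

text \<open>As a function of \<open>p\<close> the envelope is an infimum of paraboloids, and keeping the one selected at \<open>p\<close> bounds it
from above by a quadratic function. Hence the expected envelope is smooth from above at \<open>p\<close>, with an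
integral of proximal subgradients as its gradient.\<close>

lemma E_envelope_upper_expansion:
  assumes s: "proximal_selection N p s" and p: "p \<in> cball w \<eta>" and p': "p' \<in> cball w \<eta>" and "N > 0"
  shows "E_envelope N p' \<le> E_envelope N p +
       inner (\<integral>t. N *\<^sub>R (p - s t) \<partial>M) (p' - p) + N / 2 * measure M (space M) * (norm (p' - p))\<^sup>2"
proof -
  note int = proximal_selection_integrable[OF s p \<open>N > 0\<close>]
  have iI: "integrable M (\<lambda>t. inner (N *\<^sub>R (p - s t)) (p' - p))" by (rule integrable_inner_left[OF int])
  have ie: "integrable M (\<lambda>t. envelope N t p)" by (rule envelope_integrable[OF p \<open>N > 0\<close>])
  have "E_envelope N p' \<le> (\<integral>t. envelope N t p + inner (N *\<^sub>R (p - s t)) (p' - p) + N / 2 * (norm (p' - p))\<^sup>2 \<partial>M)"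
    unfolding E_envelope_def
  proof (rule integral_mono)
    show "integrable M (\<lambda>t. envelope N t p')" using envelope_integrable[OF p' \<open>N > 0\<close>] .
    show "integrable M (\<lambda>t. envelope N t p + inner (N *\<^sub>R (p - s t)) (p' - p) + N / 2 * (norm (p' - p))\<^sup>2)"
      by (intro Bochner_Integration.integrable_add ie iI integrable_const)
    fix t assume t: "t \<in> space M"
    have "envelope N t p' \<le> \<phi> t (s t) + N / 2 * (norm (s t - p'))\<^sup>2" using envelope_le[OF t proximal_selectionD(2)[OF s t]] .
    moreover have "(norm (s t - p'))\<^sup>2 = (norm (s t - p))\<^sup>2 - 2 * inner (s t - p) (p' - p) + (norm (p' - p))\<^sup>2"
      using power2_norm_diff[of "s t - p" "p' - p"] by simp
    ultimately show "envelope N t p' \<le> envelope N t p + inner (N *\<^sub>R (p - s t)) (p' - p) + N / 2 * (norm (p' - p))\<^sup>2"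
      using proximal_selectionD(3)[OF s t] by (simp add: inner_diff_left algebra_simps)
  qed
  also have "\<dots> = E_envelope N p + inner (\<integral>t. N *\<^sub>R (p - s t) \<partial>M) (p' - p) + N / 2 * measure M (space M) * (norm (p' - p))\<^sup>2"
  proof -
    have "(\<integral>t. inner (N *\<^sub>R (p - s t)) (p' - p) \<partial>M) = inner (\<integral>t. N *\<^sub>R (p - s t) \<partial>M) (p' - p)"
      by (rule integral_inner_left) (use int in blast)
    then show ?thesis
      unfolding E_envelope_def using ie iI by (simp add: Bochner_Integration.integral_add del: inner_scaleR_left)
  qed
  finally show ?thesis .
qed

lemma E_envelope_continuous:
  assumes "N > 0" shows "continuous_on (cball w \<eta>) (E_envelope N)"
proof -
  define C where "C = 2 * integral\<^sup>L M l + N * \<eta> * measure M (space M)"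
  have il: "0 \<le> integral\<^sup>L M l" by (intro integral_nonneg_AE AE_I2 l_nonneg)
  have le: "E_envelope N p' - E_envelope N p \<le> C * norm (p' - p)"
    if p: "p \<in> cball w \<eta>" and p': "p' \<in> cball w \<eta>" for p p'
  proof -
    obtain s where s: "proximal_selection N p s" by (rule proximal_selection_exists)
    have "norm (\<integral>t. N *\<^sub>R (p - s t) \<partial>M) \<le> 2 * integral\<^sup>L M l"
      by (rule proximal_selection_integral_le[OF s p assms])
    then have "inner (\<integral>t. N *\<^sub>R (p - s t) \<partial>M) (p' - p) \<le> 2 * integral\<^sup>L M l * norm (p' - p)"
      by (intro order_trans[OF norm_cauchy_schwarz] mult_right_mono) auto
    moreover have "N / 2 * measure M (space M) * (norm (p' - p))\<^sup>2 \<le> N / 2 * measure M (space M) * (2 * \<eta> * norm (p' - p))"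
      unfolding power2_eq_square using norm_diff_ball[OF p' p] assms
      by (intro mult_left_mono mult_right_mono) auto
    ultimately show ?thesis using E_envelope_upper_expansion[OF s p p' assms] by (simp add: C_def algebra_simps)
  qed
  have "C-lipschitz_on (cball w \<eta>) (E_envelope N)"
  proof (rule lipschitz_onI)
    show "0 \<le> C" using il assms eta_pos by (simp add: C_def)
    fix p p' assume "p \<in> cball w \<eta>" "p' \<in> cball w \<eta>"
    then show "dist (E_envelope N p) (E_envelope N p') \<le> C * dist p p'"
      using le[of p p'] le[of p' p] by (simp add: dist_norm norm_minus_commute abs_le_iff)
  qed
  then show ?thesis by (rule lipschitz_on_continuous_on)
qed

end

lemma small_cball_in_ball:
  fixes x w :: "'a::real_normed_vector"
  assumes "x \<in> ball w \<eta>" "0 < d" "0 < \<rho>"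
  obtains r where "0 < r" "r < d" "r < \<rho>" "cball x r \<subseteq> ball w \<eta>"
proof -
  define c where "c = \<eta> - dist w x"
  have "c > 0" using assms(1) by (simp add: c_def)
  define r where "r = min (d / 2) (min (\<rho> / 2) (c / 2))"
  have "r \<le> d / 2" "r \<le> \<rho> / 2" "r \<le> c / 2" "r > 0" using assms \<open>c > 0\<close> by (auto simp: r_def)
  then have r: "0 < r" "r < d" "r < \<rho>" "r < \<eta> - dist w x"
    using assms \<open>c > 0\<close> by (auto simp: c_def[symmetric])
  have "u \<in> ball w \<eta>" if "u \<in> cball x r" for u
    using dist_triangle[of w u x] r(4) that by simp
  then show ?thesis using r that by blast
qed

context lipschitz_integrand
begin

text \<open>Minimize the expected envelope minus \<open>inner v'\<close> plus \<open>2 * \<epsilon> * norm (u - v)\<close> over the points \<open>u\<close> of \<open>\<Omega>\<close> near \<open>v\<close>.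
The hypothesis tolerates \<open>\<epsilon> * norm (u - v)\<close>; the surplus \<open>\<epsilon> * norm (p - v)\<close> at the minimizer \<open>p\<close> is therefore at
most the gap between the expectation and the expected envelope, so \<open>p\<close> is close to \<open>v\<close> when \<open>N\<close> is large.
Minimality of \<open>p\<close> and smoothness from above give the approximate normal; the third \<open>\<epsilon>\<close> absorbs the quadratic
term.\<close>

lemma fuzzy_sum_rule:
  assumes \<Omega>: "closed (\<Omega> \<inter> cball w \<eta>)" and v: "v \<in> \<Omega>" "v \<in> ball w \<eta>" and "\<epsilon> > 0" "\<rho> > 0"
    and locmin: "\<exists>d>0. \<forall>u\<in>\<Omega>. norm (u - v) < d \<longrightarrow> inner v' (u - v) \<le> E u - E v + \<epsilon> * norm (u - v)"
  shows "\<exists>p s N. p \<in> ball w \<eta> \<and> norm (p - v) < \<rho> \<and> N > 1 / \<rho> \<and> proximal_selection N p s \<and>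
    v' - (\<integral>t. N *\<^sub>R (p - s t) \<partial>M) \<in> approx_normal (3 * \<epsilon>) p \<Omega>"
proof -
  from locmin obtain d where "d > 0" and
    d: "\<And>u. u \<in> \<Omega> \<Longrightarrow> norm (u - v) < d \<Longrightarrow> inner v' (u - v) \<le> E u - E v + \<epsilon> * norm (u - v)" by blast
  obtain r where r: "r > 0" "r < d" "r < \<rho>" and sub: "cball v r \<subseteq> ball w \<eta>"
    by (rule small_cball_in_ball[OF v(2) \<open>d > 0\<close> \<open>\<rho> > 0\<close>])
  then have sub': "cball v r \<subseteq> cball w \<eta>" using ball_subset_cball by blast
  define C where "C = \<Omega> \<inter> cball v r"
  have "C = (\<Omega> \<inter> cball w \<eta>) \<inter> cball v r" using sub' by (auto simp: C_def)
  then have "compact C" using \<Omega> by (simp add: closed_Int_compact)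
  have "v \<in> C" using v r by (simp add: C_def)
  have C: "u \<in> cball w \<eta>" if "u \<in> C" for u using that sub' by (auto simp: C_def)
  have "\<forall>\<^sub>F n in sequentially. envelope_gap (real (Suc n)) < \<epsilon> * r"
    using envelope_gap_tendsto_0 \<open>\<epsilon> > 0\<close> r(1) by (intro order_tendstoD) auto
  moreover have "\<forall>\<^sub>F n in sequentially. 1 / \<rho> < real (Suc n)"
    using filterlim_at_top_dense[THEN iffD1, OF filterlim_real_sequentially, rule_format, of "1 / \<rho>"]
    by (rule eventually_mono) simp
  ultimately obtain n where n: "envelope_gap (real (Suc n)) < \<epsilon> * r" "1 / \<rho> < real (Suc n)"
    using eventually_happens[OF eventually_conj] sequentially_bot by blast
  define N where "N = real (Suc n)"
  have "N > 0" by (simp add: N_def)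
  define J where "J u = E_envelope N u - inner v' u + 2 * \<epsilon> * norm (u - v)" for u
  have "continuous_on C J"
    unfolding J_def
    by (intro continuous_intros continuous_on_subset[OF E_envelope_continuous[OF \<open>N > 0\<close>]] subsetI C)
  then obtain p where p: "p \<in> C" "\<And>u. u \<in> C \<Longrightarrow> J p \<le> J u"
    using continuous_attains_inf[OF \<open>compact C\<close>] \<open>v \<in> C\<close> by blast
  have "norm (p - v) \<le> r" "p \<in> \<Omega>" using p(1) by (auto simp: C_def dist_norm norm_minus_commute)
  have "\<epsilon> * norm (p - v) \<le> envelope_gap N"
  proof -
    have "inner v' (p - v) \<le> E p - E v + \<epsilon> * norm (p - v)"
      using d[OF \<open>p \<in> \<Omega>\<close>] \<open>norm (p - v) \<le> r\<close> r(2) by linarith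
    moreover have "E p - envelope_gap N \<le> E_envelope N p" by (rule E_envelope_ge[OF C[OF p(1)] \<open>N > 0\<close>])
    moreover have "E_envelope N v \<le> E v" by (rule E_envelope_le[OF C[OF \<open>v \<in> C\<close>] \<open>N > 0\<close>])
    ultimately show ?thesis using p(2)[OF \<open>v \<in> C\<close>] by (simp add: J_def inner_diff_right)
  qed
  also have "\<dots> < \<epsilon> * r" using n(1) by (simp add: N_def)
  finally have pv: "norm (p - v) < r" using \<open>\<epsilon> > 0\<close> by simp
  obtain s where s: "proximal_selection N p s" by (rule proximal_selection_exists)
  define q where "q = (\<integral>t. N *\<^sub>R (p - s t) \<partial>M)"
  define b where "b = N / 2 * measure M (space M)"
  have "b \<ge> 0" using \<open>N > 0\<close> by (simp add: b_def)
  have "v' - q \<in> approx_normal (3 * \<epsilon>) p \<Omega>"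
    unfolding approx_normal_def
  proof (intro CollectI conjI exI[of _ "min (r - norm (p - v)) (\<epsilon> / (b + 1))"] ballI impI)
    show "p \<in> \<Omega>" by fact
    show "0 < min (r - norm (p - v)) (\<epsilon> / (b + 1))" using pv \<open>\<epsilon> > 0\<close> \<open>b \<ge> 0\<close> by simp
    fix u assume u: "u \<in> \<Omega>" "norm (u - p) < min (r - norm (p - v)) (\<epsilon> / (b + 1))"
    have tri: "norm (u - v) \<le> norm (u - p) + norm (p - v)" using norm_triangle_ineq[of "u - p" "p - v"] by simp
    then have "u \<in> C" using u by (simp add: C_def dist_norm norm_minus_commute)
    have "inner v' (u - p) \<le> E_envelope N u - E_envelope N p + 2 * \<epsilon> * (norm (u - v) - norm (p - v))"
      using p(2)[OF \<open>u \<in> C\<close>] by (simp add: J_def inner_diff_right algebra_simps)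
    also have "\<dots> \<le> E_envelope N u - E_envelope N p + 2 * \<epsilon> * norm (u - p)"
      using tri \<open>\<epsilon> > 0\<close> by simp
    also have "E_envelope N u - E_envelope N p \<le> inner q (u - p) + b * (norm (u - p))\<^sup>2"
      using E_envelope_upper_expansion[OF s C[OF p(1)] C[OF \<open>u \<in> C\<close>] \<open>N > 0\<close>] by (simp add: q_def b_def)
    also have "b * (norm (u - p))\<^sup>2 \<le> \<epsilon> * norm (u - p)"
    proof -
      have "b * norm (u - p) \<le> (b + 1) * norm (u - p)" by (intro mult_right_mono) auto
      also have "\<dots> \<le> \<epsilon>" using u(2) \<open>b \<ge> 0\<close> by (simp add: pos_less_divide_eq mult.commute)
      finally have "(b * norm (u - p)) * norm (u - p) \<le> \<epsilon> * norm (u - p)" by (intro mult_right_mono) auto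
      then show ?thesis by (simp add: power2_eq_square mult_ac)
    qed
    finally show "inner (v' - q) (u - p) \<le> 3 * \<epsilon> * norm (u - p)" by (simp add: inner_diff_left)
  qed
  moreover have "p \<in> ball w \<eta>" using p(1) sub by (auto simp: C_def)
  moreover have "norm (p - v) < \<rho>" using pv r(3) by simp
  moreover have "N > 1 / \<rho>" using n(2) by (simp add: N_def)
  ultimately show ?thesis using s unfolding q_def by blast
qed

text \<open>Approximate subgradients of the function \<open>E\<close> restricted to \<open>\<Omega>\<close>, at points tending to \<open>w\<close>, decompose in the limit.
By the fuzzy sum rule each \<open>v k\<close> is, up to a small error, the sum of an integral of proximal subgradients and
an approximate normal to \<open>\<Omega>\<close>. The integrals are bounded, hence converge for a subsequence, and the
Fatou lemma represents their limit by cluster points of the proximal subgradients. Those are limiting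
proximal subgradients at \<open>w\<close>, because the points selected by the envelopes tend to \<open>w\<close>.\<close>

theorem limiting_sum_rule:
  assumes \<Omega>: "closed (\<Omega> \<inter> cball w \<eta>)"
    and x: "\<And>k. x k \<in> \<Omega>" "\<And>k. x k \<in> ball w \<eta>" "x \<longlonglongrightarrow> w" and v: "v \<longlonglongrightarrow> v0"
    and \<epsilon>: "\<And>k. \<epsilon> k > 0" "\<epsilon> \<longlonglongrightarrow> 0"
    and locmin: "\<And>k::nat. \<exists>d>0. \<forall>u\<in>\<Omega>. norm (u - x k) < d \<longrightarrow>
      inner (v k) (u - x k) \<le> E u - E (x k) + \<epsilon> k * norm (u - x k)"
  obtains \<xi> where "integrable M \<xi>" "v0 - integral\<^sup>L M \<xi> \<in> normal_cone w \<Omega>"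
    "AE t in M. \<xi> t \<in> limiting_proximal_subgradients (cball w \<eta>) (\<phi> t) w"
proof -
  define P where "P k p s N \<longleftrightarrow> p \<in> ball w \<eta> \<and> norm (p - x k) < 1 / real (Suc k) \<and> N > real (Suc k) \<and> proximal_selection N p s \<and>
    v k - (\<integral>t. N *\<^sub>R (p - s t) \<partial>M) \<in> approx_normal (3 * \<epsilon> k) p \<Omega>" for k p s N
  have "\<exists>p s N. P k p s N" for k
    using fuzzy_sum_rule[OF \<Omega> x(1)[of k] x(2)[of k] \<epsilon>(1)[of k] _ locmin[of k], of "1 / real (Suc k)"]
    by (simp add: P_def)
  then obtain p s N where P: "\<And>k. P k (p k) (s k) (N k)" by metis
  define X where "X k t = N k *\<^sub>R (p k - s k t)" for k t
  have p: "p k \<in> ball w \<eta>" "norm (p k - x k) < 1 / real (Suc k)" and N: "N k > real (Suc k)" and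
    s: "proximal_selection (N k) (p k) (s k)" and
    appr: "v k - integral\<^sup>L M (X k) \<in> approx_normal (3 * \<epsilon> k) (p k) \<Omega>" for k
    using P[of k] unfolding P_def X_def by blast+
  have N0: "N k > 0" for k using N[of k] by linarith
  have pK: "p k \<in> cball w \<eta>" for k using p(1)[of k] by simp
  have X_bound: "norm (X k t) \<le> 2 * l t" if "t \<in> space M" for k t
    unfolding X_def by (rule proximal_selection_bound[OF s pK N0 that])
  have X_meas: "X k \<in> borel_measurable M" for k unfolding X_def using proximal_selectionD(1)[OF s, of k] by measurable
  have l2: "integrable M (\<lambda>t. 2 * l t)" using l_integrable by simp
  have "norm (integral\<^sup>L M (X k)) \<le> 2 * integral\<^sup>L M l" for k
    unfolding X_def by (rule proximal_selection_integral_le[OF s pK N0])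
  then have "bounded (range (\<lambda>k. integral\<^sup>L M (X k)))" by (auto simp: bounded_iff)
  then obtain q r where r: "strict_mono (r :: nat \<Rightarrow> nat)" and "((\<lambda>k. integral\<^sup>L M (X k)) \<circ> r) \<longlonglongrightarrow> q"
    using bounded_imp_convergent_subsequence by blast
  then have q: "(\<lambda>k. integral\<^sup>L M (X (r k))) \<longlonglongrightarrow> q" by (simp add: comp_def)
  obtain \<xi> where \<xi>: "integrable M \<xi>" "integral\<^sup>L M \<xi> = q"
    "AE t in M. \<xi> t \<in> cluster_points (\<lambda>k. X (r k) t)"
    using integral_cluster_selection[OF finite_measure_axioms X_meas X_bound l2 q] by blast
  have inv0: "(\<lambda>k. 1 / real (Suc k)) \<longlonglongrightarrow> 0" by (rule LIMSEQ_Suc[OF lim_1_over_n])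
  have "(\<lambda>k. p k - x k) \<longlonglongrightarrow> 0"
    by (rule Lim_null_comparison[OF _ inv0]) (use p(2) in \<open>auto intro!: always_eventually less_imp_le\<close>)
  from tendsto_add[OF this x(3)] have p_lim: "p \<longlonglongrightarrow> w" by simp
  note sub = LIMSEQ_subseq_LIMSEQ[OF _ r, unfolded comp_def]
  have "v0 - q \<in> normal_cone w \<Omega>"
  proof (rule normal_cone_limit_approx_normal[OF \<Omega> eta_pos])
    show "(\<lambda>k. p (r k)) \<longlonglongrightarrow> w" by (rule sub[OF p_lim])
    show "(\<lambda>k. v (r k) - integral\<^sup>L M (X (r k))) \<longlonglongrightarrow> v0 - q" by (intro tendsto_diff sub[OF v] q)
    show "(\<lambda>k. 3 * \<epsilon> (r k)) \<longlonglongrightarrow> 0" by (intro tendsto_mult_right_zero sub[OF \<epsilon>(2)])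
    show "v (r k) - integral\<^sup>L M (X (r k)) \<in> approx_normal (3 * \<epsilon> (r k)) (p (r k)) \<Omega>" for k by (rule appr)
    show "0 \<le> 3 * \<epsilon> (r k)" for k using \<epsilon>(1)[of "r k"] by simp
  qed
  moreover have "AE t in M. \<xi> t \<in> limiting_proximal_subgradients (cball w \<eta>) (\<phi> t) w"
    using \<xi>(3) AE_space
  proof eventually_elim
    case (elim t)
    then obtain j :: "nat \<Rightarrow> nat" where j: "strict_mono j" "(\<lambda>k. X (r (j k)) t) \<longlonglongrightarrow> \<xi> t"
      using cluster_points_imp_subseq by blast
    have "norm (p k - s k t) \<le> 2 * l t * (1 / real (Suc k))" for k
    proof -
      have "real (Suc k) * norm (p k - s k t) \<le> N k * norm (p k - s k t)"
        using N[of k] by (intro mult_right_mono) auto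
      also have "\<dots> = norm (X k t)" using N[of k] by (simp add: X_def)
      also have "\<dots> \<le> 2 * l t" by (rule X_bound[OF elim(2)])
      finally show ?thesis by (simp add: field_simps)
    qed
    then have "(\<lambda>k. p k - s k t) \<longlonglongrightarrow> 0"
      by (intro Lim_null_comparison[OF _ tendsto_mult_right_zero[OF inv0]]) (auto intro!: always_eventually)
    from tendsto_diff[OF p_lim this] have "(\<lambda>k. s k t) \<longlonglongrightarrow> w" by simp
    from LIMSEQ_subseq_LIMSEQ[OF sub[OF this] j(1)] have "(\<lambda>k. s (r (j k)) t) \<longlonglongrightarrow> w" by (simp add: comp_def)
    then show ?case
      unfolding limiting_proximal_subgradients_def using j(2) proximal_selectionD(2)[OF s elim(2)] proximal_selection_inequality[OF s elim(2)]
      by (intro CollectI exI[of _ "\<lambda>k. s (r (j k)) t"] exI[of _ "\<lambda>k. X (r (j k)) t"]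
          exI[of _ "\<lambda>k. N (r (j k)) / 2"]) (auto simp: X_def)
  qed
  ultimately show ?thesis using \<xi>(1,2) that by blast
qed

end

section \<open>Multipliers for expectation constraints\<close>

text \<open>The quadratic upper bound for the square of the positive part, whose derivative \<open>2 * max 0 b\<close> is Lipschitz with
constant 2.\<close>

lemma power2_pos_part_le:
  fixes a b :: real
  shows "(max 0 a)\<^sup>2 \<le> (max 0 b)\<^sup>2 + 2 * max 0 b * (a - b) + (a - b)\<^sup>2"
proof (cases "b \<ge> 0")
  case True
  then have "(max 0 b)\<^sup>2 + 2 * max 0 b * (a - b) + (a - b)\<^sup>2 = a\<^sup>2"
    by (simp add: power2_eq_square algebra_simps)
  moreover have "(max 0 a)\<^sup>2 \<le> a\<^sup>2" by (simp add: max_def)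
  ultimately show ?thesis by simp
next
  case False
  have "(max 0 a)\<^sup>2 \<le> (a - b)\<^sup>2"
  proof (cases "a \<ge> 0")
    case True
    then show ?thesis using False by (simp add: power_mono)
  qed simp
  then show ?thesis using False by simp
qed

text \<open>Minimize \<open>2 * \<epsilon> * norm (u - x) - inner v u\<close> plus the penalty \<open>n / 2\<close> times the sum of the squared constraint violations
over the points \<open>u\<close> of \<open>\<Omega>\<close> near \<open>x\<close>. Cluster points of the minimizers are feasible, so the hypothesis on \<open>v\<close>
leaves \<open>x\<close> as the only one, and some minimizer \<open>q\<close> is close to \<open>x\<close>. The multipliers are the derivatives of the
penalty at \<open>q\<close>; a bound on them that is uniform in \<open>\<epsilon>\<close> and \<open>\<rho>\<close>
has to come from a constraint qualification.\<close>

lemma penalty_multipliers: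
  fixes f :: "'m::finite \<Rightarrow> 'a::euclidean_space \<Rightarrow> real"
  assumes \<Omega>: "closed (\<Omega> \<inter> cball w \<eta>)" and lip: "\<And>i. L-lipschitz_on (cball w \<eta>) (f i)"
    and x: "x \<in> \<Omega>" "x \<in> ball w \<eta>" "\<And>i. f i x \<le> 0" and "\<epsilon> > 0" "\<rho> > 0"
    and normal: "\<exists>d>0. \<forall>u\<in>\<Omega>. norm (u - x) < d \<longrightarrow> (\<forall>i. f i u \<le> 0) \<longrightarrow> inner v (u - x) \<le> \<epsilon> * norm (u - x)"
  shows "\<exists>p y. p \<in> \<Omega> \<and> p \<in> ball w \<eta> \<and> norm (p - x) < \<rho> \<and> (\<forall>i. 0 \<le> y $ i) \<and>
    (\<exists>d>0. \<forall>u\<in>\<Omega>. norm (u - p) < d \<longrightarrow>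
       inner v (u - p) \<le> (\<Sum>i\<in>UNIV. y $ i * (f i u - f i p)) + 3 * \<epsilon> * norm (u - p))"
proof -
  from normal obtain d where "d > 0" and
    d: "\<And>u. u \<in> \<Omega> \<Longrightarrow> norm (u - x) < d \<Longrightarrow> (\<And>i. f i u \<le> 0) \<Longrightarrow> inner v (u - x) \<le> \<epsilon> * norm (u - x)" by blast
  obtain r where r: "r > 0" "r < d" "r < \<rho>" and sub: "cball x r \<subseteq> ball w \<eta>"
    by (rule small_cball_in_ball[OF x(2) \<open>d > 0\<close> \<open>\<rho> > 0\<close>])
  then have sub': "cball x r \<subseteq> cball w \<eta>" using ball_subset_cball by blast
  define C where "C = \<Omega> \<inter> cball x r"
  have "C = (\<Omega> \<inter> cball w \<eta>) \<inter> cball x r" using sub' by (auto simp: C_def)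
  then have "compact C" using \<Omega> by (simp add: closed_Int_compact)
  have "x \<in> C" using x r by (simp add: C_def)
  have C: "u \<in> cball w \<eta>" if "u \<in> C" for u using that sub' by (auto simp: C_def)
  have cont: "continuous_on C (f i)" for i
    by (rule continuous_on_subset[OF lipschitz_on_continuous_on[OF lip]]) (use C in blast)
  define S where "S u = (\<Sum>i\<in>UNIV. (max 0 (f i u))\<^sup>2)" for u
  have S_cont: "continuous_on C S" unfolding S_def by (intro continuous_intros cont)
  have S_nonneg: "0 \<le> S u" for u unfolding S_def by (intro sum_nonneg) auto
  have "max 0 (f i x) = 0" for i using x(3)[of i] by simp
  then have "S x = 0" by (simp add: S_def)
  define J where "J n u = 2 * \<epsilon> * norm (u - x) - inner v u + real (Suc n) / 2 * S u" for n u
  have "\<exists>p\<in>C. \<forall>u\<in>C. J n p \<le> J n u" for n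
    by (rule continuous_attains_inf[OF \<open>compact C\<close>])
      (use \<open>x \<in> C\<close> in \<open>auto simp: J_def[abs_def] intro!: continuous_intros S_cont\<close>)
  then obtain p where p: "\<And>n. p n \<in> C" "\<And>n u. u \<in> C \<Longrightarrow> J n (p n) \<le> J n u" by metis
  have "\<exists>n. norm (p n - x) < r"
  proof (rule ccontr)
    assume "\<not> ?thesis"
    then have far: "r \<le> norm (p n - x)" for n by (simp add: not_less)
    have pr: "norm (p n - x) \<le> r" for n using p(1)[of n] by (simp add: C_def dist_norm norm_minus_commute)
    have Jx: "2 * \<epsilon> * norm (p n - x) + real (Suc n) / 2 * S (p n) \<le> inner v (p n - x)" for n
      using p(2)[OF \<open>x \<in> C\<close>, of n] \<open>S x = 0\<close> by (simp add: J_def inner_diff_right)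
    have cs: "inner v (p n - x) \<le> norm v * r" for n
      using order_trans[OF norm_cauchy_schwarz mult_left_mono[OF pr norm_ge_zero]] .
    have S_le: "norm (S (p n)) \<le> 2 * (norm v * r) * (1 / real (Suc n))" for n
    proof -
      have "0 \<le> 2 * \<epsilon> * norm (p n - x)" using \<open>\<epsilon> > 0\<close> by simp
      then have "real (Suc n) / 2 * S (p n) \<le> norm v * r" using Jx[of n] cs[of n] by linarith
      then show ?thesis using S_nonneg[of "p n"] by (simp add: field_simps)
    qed
    have "(\<lambda>n. 2 * (norm v * r) * (1 / real (Suc n))) \<longlonglongrightarrow> 0"
      by (intro tendsto_mult_right_zero LIMSEQ_Suc[OF lim_1_over_n])
    then have S_lim: "(\<lambda>n. S (p n)) \<longlonglongrightarrow> 0"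
      by (rule Lim_null_comparison[OF always_eventually[OF allI[OF S_le]]])
    obtain u j where j: "u \<in> C" "strict_mono (j :: nat \<Rightarrow> nat)" "(p \<circ> j) \<longlonglongrightarrow> u"
      using \<open>compact C\<close> p(1) unfolding compact_def by metis
    have pj: "(\<lambda>n. p (j n)) \<longlonglongrightarrow> u" using j(3) by (simp add: comp_def)
    have "(\<lambda>n. S (p (j n))) \<longlonglongrightarrow> S u"
      by (rule continuous_on_tendsto_compose[OF S_cont pj j(1)]) (use p(1) in auto)
    moreover have "(\<lambda>n. S (p (j n))) \<longlonglongrightarrow> 0" using LIMSEQ_subseq_LIMSEQ[OF S_lim j(2)] by (simp add: comp_def)
    ultimately have "S u = 0" using LIMSEQ_unique by blast
    then have feas: "f i u \<le> 0" for i
    proof -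
      have "(max 0 (f i u))\<^sup>2 = 0"
        using \<open>S u = 0\<close> unfolding S_def by (subst (asm) sum_nonneg_eq_0_iff) auto
      then have "max 0 (f i u) = 0" by simp
      then show ?thesis by linarith
    qed
    have "2 * \<epsilon> * norm (p n - x) \<le> inner v (p n - x)" for n
    proof -
      have "0 \<le> real (Suc n) / 2 * S (p n)" using S_nonneg by simp
      then show ?thesis using Jx[of n] by linarith
    qed
    moreover have "(\<lambda>n. 2 * \<epsilon> * norm (p (j n) - x)) \<longlonglongrightarrow> 2 * \<epsilon> * norm (u - x)"
      "(\<lambda>n. inner v (p (j n) - x)) \<longlonglongrightarrow> inner v (u - x)" by (intro tendsto_intros pj)+
    ultimately have "2 * \<epsilon> * norm (u - x) \<le> inner v (u - x)" by (meson LIMSEQ_le)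
    moreover have "inner v (u - x) \<le> \<epsilon> * norm (u - x)"
      using j(1) r(2) feas by (intro d) (auto simp: C_def dist_norm norm_minus_commute)
    ultimately have "\<epsilon> * norm (u - x) \<le> 0" by linarith
    then have "norm (u - x) \<le> 0" using \<open>\<epsilon> > 0\<close> by (simp add: mult_le_0_iff)
    moreover have "(\<lambda>n. norm (p (j n) - x)) \<longlonglongrightarrow> norm (u - x)" by (intro tendsto_intros pj)
    then have "r \<le> norm (u - x)" using far by (intro LIMSEQ_le_const) auto
    ultimately show False using r(1) by simp
  qed
  then obtain n where n: "norm (p n - x) < r" by blast
  define q where "q = p n"
  have q: "q \<in> C" "norm (q - x) < r" "\<And>u. u \<in> C \<Longrightarrow> J n q \<le> J n u" using p n by (auto simp: q_def)
  define y :: "real ^ 'm" where "y = (\<chi> i. real (Suc n) * max 0 (f i q))"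
  have "L \<ge> 0" using lip lipschitz_on_nonneg by blast
  define b where "b = real (Suc n) / 2 * (real CARD('m) * L\<^sup>2)"
  have "b \<ge> 0" by (simp add: b_def)
  have "inner v (u - q) \<le> (\<Sum>i\<in>UNIV. y $ i * (f i u - f i q)) + 3 * \<epsilon> * norm (u - q)"
    if u: "u \<in> \<Omega>" "norm (u - q) < min (r - norm (q - x)) (\<epsilon> / (b + 1))" for u
  proof -
    have tri: "norm (u - x) \<le> norm (u - q) + norm (q - x)" using norm_triangle_ineq[of "u - q" "q - x"] by simp
    then have "u \<in> C" using u by (simp add: C_def dist_norm norm_minus_commute)
    have "S u - S q \<le> (\<Sum>i\<in>UNIV. 2 * max 0 (f i q) * (f i u - f i q) + L\<^sup>2 * (norm (u - q))\<^sup>2)"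
      unfolding S_def sum_subtractf[symmetric]
    proof (rule sum_mono)
      fix i
      have "\<bar>f i u - f i q\<bar> \<le> L * norm (u - q)"
        using lipschitz_onD[OF lip C[OF \<open>u \<in> C\<close>] C[OF q(1)]] by (simp add: dist_norm)
      then have "(f i u - f i q)\<^sup>2 \<le> (L * norm (u - q))\<^sup>2" by (metis abs_ge_zero power2_abs power_mono)
      then show "(max 0 (f i u))\<^sup>2 - (max 0 (f i q))\<^sup>2 \<le> 2 * max 0 (f i q) * (f i u - f i q) + L\<^sup>2 * (norm (u - q))\<^sup>2"
        using power2_pos_part_le[of "f i u" "f i q"] by (simp add: power_mult_distrib)
    qed
    also have "\<dots> = (\<Sum>i\<in>UNIV. 2 * max 0 (f i q) * (f i u - f i q)) + real CARD('m) * L\<^sup>2 * (norm (u - q))\<^sup>2"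
      by (simp add: sum.distrib)
    finally have "real (Suc n) / 2 * (S u - S q) \<le>
        real (Suc n) / 2 * ((\<Sum>i\<in>UNIV. 2 * max 0 (f i q) * (f i u - f i q)) + real CARD('m) * L\<^sup>2 * (norm (u - q))\<^sup>2)"
      by (rule mult_left_mono) simp
    also have "\<dots> = (\<Sum>i\<in>UNIV. y $ i * (f i u - f i q)) + b * (norm (u - q))\<^sup>2"
      by (simp add: y_def b_def sum_distrib_left distrib_left mult_ac)
    finally have S_le: "real (Suc n) / 2 * (S u - S q) \<le> (\<Sum>i\<in>UNIV. y $ i * (f i u - f i q)) + b * (norm (u - q))\<^sup>2" .
    have "b * (norm (u - q))\<^sup>2 \<le> \<epsilon> * norm (u - q)"
    proof -
      have "b * norm (u - q) \<le> (b + 1) * norm (u - q)" by (intro mult_right_mono) auto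
      also have "\<dots> \<le> \<epsilon>" using u(2) \<open>b \<ge> 0\<close> by (simp add: pos_less_divide_eq mult.commute)
      finally have "(b * norm (u - q)) * norm (u - q) \<le> \<epsilon> * norm (u - q)" by (intro mult_right_mono) auto
      then show ?thesis by (simp add: power2_eq_square mult_ac)
    qed
    moreover have "inner v (u - q) \<le> 2 * \<epsilon> * (norm (u - x) - norm (q - x)) + real (Suc n) / 2 * (S u - S q)"
      using q(3)[OF \<open>u \<in> C\<close>] unfolding J_def inner_diff_right right_diff_distrib by linarith
    moreover have "2 * \<epsilon> * (norm (u - x) - norm (q - x)) \<le> 2 * \<epsilon> * norm (u - q)" using tri \<open>\<epsilon> > 0\<close> by simp
    ultimately show ?thesis using S_le by linarith
  qed
  moreover have "0 < min (r - norm (q - x)) (\<epsilon> / (b + 1))" using q(2) \<open>\<epsilon> > 0\<close> \<open>b \<ge> 0\<close> by simp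
  moreover have "q \<in> \<Omega>" "q \<in> ball w \<eta>" using q(1) sub by (auto simp: C_def)
  moreover have "norm (q - x) < \<rho>" using q(2) r(3) by simp
  moreover have "\<forall>i. 0 \<le> y $ i" by (simp add: y_def)
  ultimately show ?thesis by blast
qed

locale lipschitz_integrands = finite_measure M for M :: "'t measure" +
  fixes h :: "'m::finite \<Rightarrow> 't \<Rightarrow> 'a::euclidean_space \<Rightarrow> real" and l :: "'t \<Rightarrow> real" and w :: 'a and \<eta> :: real
  assumes each: "\<And>i. lipschitz_integrand M (h i) l w \<eta>"
begin

definition Eh :: "'m \<Rightarrow> 'a \<Rightarrow> real" where "Eh i u = (\<integral>t. h i t u \<partial>M)"

definition comb :: "real ^ 'm \<Rightarrow> 't \<Rightarrow> 'a \<Rightarrow> real" where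
  "comb y t u = (\<Sum>i\<in>UNIV. y $ i * h i t u)"

lemma eta_pos: "\<eta> > 0"
  using each lipschitz_integrand.eta_pos by blast

lemma h_integrable: "u \<in> cball w \<eta> \<Longrightarrow> integrable M (\<lambda>t. h i t u)"
  by (rule lipschitz_integrand.phi_integrable[OF each])

lemma comb_lipschitz_integrand: "lipschitz_integrand M (comb y) (\<lambda>t. (\<Sum>i\<in>UNIV. \<bar>y $ i\<bar>) * l t) w \<eta>"
proof unfold_locales
  interpret lipschitz_integrand M "h i" l w \<eta> for i by (rule each)
  show "\<eta> > 0" by (rule eta_pos)
  show "(\<lambda>t. comb y t u) \<in> borel_measurable M" if "u \<in> cball w \<eta>" for u
    unfolding comb_def using phi_measurable[OF that] by measurable
  show "integrable M (\<lambda>t. (\<Sum>i\<in>UNIV. \<bar>y $ i\<bar>) * l t)" using l_integrable by simp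
  show "integrable M (\<lambda>t. comb y t w)" unfolding comb_def using phi_integrable_center by simp
  show "((\<Sum>i\<in>UNIV. \<bar>y $ i\<bar>) * l t)-lipschitz_on (cball w \<eta>) (comb y t)" if t: "t \<in> space M" for t
  proof (rule lipschitz_onI)
    show "0 \<le> (\<Sum>i\<in>UNIV. \<bar>y $ i\<bar>) * l t" using l_nonneg[OF t] by (simp add: sum_nonneg)
    fix u u' assume u: "u \<in> cball w \<eta>" "u' \<in> cball w \<eta>"
    have "dist (comb y t u) (comb y t u') = \<bar>\<Sum>i\<in>UNIV. y $ i * (h i t u - h i t u')\<bar>"
      by (simp add: dist_norm comb_def sum_subtractf right_diff_distrib)
    also have "\<dots> \<le> (\<Sum>i\<in>UNIV. \<bar>y $ i\<bar> * (l t * norm (u - u')))"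
      by (rule order_trans[OF sum_abs])
        (auto intro!: sum_mono mult_left_mono phi_diff[OF t u] simp: abs_mult)
    also have "\<dots> = (\<Sum>i\<in>UNIV. \<bar>y $ i\<bar>) * (l t * norm (u - u'))" by (rule sum_distrib_right[symmetric])
    finally show "dist (comb y t u) (comb y t u') \<le> (\<Sum>i\<in>UNIV. \<bar>y $ i\<bar>) * l t * dist u u'"
      by (simp add: dist_norm mult.assoc)
  qed
qed

lemma E_comb:
  assumes "u \<in> cball w \<eta>"
  shows "lipschitz_integrand.E M (comb y) u = (\<Sum>i\<in>UNIV. y $ i * Eh i u)"
  unfolding lipschitz_integrand.E_def[OF comb_lipschitz_integrand] comb_def Eh_def
  using h_integrable[OF assms] by simp

lemma Eh_diff:
  assumes "u \<in> cball w \<eta>" "v \<in> cball w \<eta>"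
  shows "\<bar>Eh i u - Eh i v\<bar> \<le> integral\<^sup>L M l * norm (u - v)"
  using lipschitz_integrand.E_lipschitz[OF each assms, of i]
  unfolding lipschitz_integrand.E_def[OF each] Eh_def .

lemma integral_l_nonneg: "0 \<le> integral\<^sup>L M l"
  using lipschitz_integrand.l_nonneg[OF each] by (intro integral_nonneg_AE AE_I2)

lemma Eh_lipschitz: "(integral\<^sup>L M l)-lipschitz_on (cball w \<eta>) (Eh i)"
  using integral_l_nonneg Eh_diff by (intro lipschitz_onI) (auto simp: dist_norm)

text \<open>The functions \<open>Eh i\<close> are Lipschitz on the ball, so replacing the weights \<open>y k\<close> by their limit \<open>y0\<close> costs an error that
tends to zero.\<close>

lemma multiplier_sum_rule:
  assumes \<Omega>: "closed (\<Omega> \<inter> cball w \<eta>)"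
    and p: "\<And>k. p k \<in> \<Omega>" "\<And>k. p k \<in> ball w \<eta>" "p \<longlonglongrightarrow> w" and v: "v \<longlonglongrightarrow> v0" and y: "y \<longlonglongrightarrow> y0"
    and \<epsilon>: "\<And>k. \<epsilon> k > 0" "\<epsilon> \<longlonglongrightarrow> 0"
    and locmin: "\<And>k::nat. \<exists>d>0. \<forall>u\<in>\<Omega>. norm (u - p k) < d \<longrightarrow>
      inner (v k) (u - p k) \<le> (\<Sum>i\<in>UNIV. y k $ i * (Eh i u - Eh i (p k))) + \<epsilon> k * norm (u - p k)"
  obtains \<xi> where "integrable M \<xi>" "v0 - integral\<^sup>L M \<xi> \<in> normal_cone w \<Omega>"
    "AE t in M. \<xi> t \<in> limiting_proximal_subgradients (cball w \<eta>) (comb y0 t) w"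
proof -
  interpret C: lipschitz_integrand M "comb y0" "\<lambda>t. (\<Sum>i\<in>UNIV. \<bar>y0 $ i\<bar>) * l t" w \<eta>
    by (rule comb_lipschitz_integrand)
  define D where "D k = (\<Sum>i\<in>UNIV. \<bar>y k $ i - y0 $ i\<bar>) * integral\<^sup>L M l" for k
  have D0: "0 \<le> D k" for k unfolding D_def using integral_l_nonneg by (simp add: sum_nonneg)
  have "D \<longlonglongrightarrow> (\<Sum>i\<in>UNIV. \<bar>y0 $ i - y0 $ i\<bar>) * integral\<^sup>L M l"
    unfolding D_def[abs_def] by (intro tendsto_intros y)
  then have D_lim: "D \<longlonglongrightarrow> 0" by simp
  have "\<exists>d>0. \<forall>u\<in>\<Omega>. norm (u - p k) < d \<longrightarrow>
      inner (v k) (u - p k) \<le> C.E u - C.E (p k) + (\<epsilon> k + D k) * norm (u - p k)" for k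
  proof -
    obtain d where "d > 0" and d: "\<And>u. u \<in> \<Omega> \<Longrightarrow> norm (u - p k) < d \<Longrightarrow>
      inner (v k) (u - p k) \<le> (\<Sum>i\<in>UNIV. y k $ i * (Eh i u - Eh i (p k))) + \<epsilon> k * norm (u - p k)"
      using locmin[of k] by blast
    have pK: "p k \<in> cball w \<eta>" using p(2)[of k] by simp
    have "inner (v k) (u - p k) \<le> C.E u - C.E (p k) + (\<epsilon> k + D k) * norm (u - p k)"
      if u: "u \<in> \<Omega>" "norm (u - p k) < min d (\<eta> - dist w (p k))" for u
    proof -
      have uK: "u \<in> cball w \<eta>" using dist_triangle[of w u "p k"] u(2) by (simp add: dist_norm norm_minus_commute)
      have "(\<Sum>i\<in>UNIV. (y k $ i - y0 $ i) * (Eh i u - Eh i (p k)))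
          \<le> (\<Sum>i\<in>UNIV. \<bar>y k $ i - y0 $ i\<bar> * (integral\<^sup>L M l * norm (u - p k)))"
      proof (rule sum_mono)
        fix i
        have "(y k $ i - y0 $ i) * (Eh i u - Eh i (p k)) \<le> \<bar>y k $ i - y0 $ i\<bar> * \<bar>Eh i u - Eh i (p k)\<bar>"
          by (metis abs_ge_self abs_mult)
        also have "\<dots> \<le> \<bar>y k $ i - y0 $ i\<bar> * (integral\<^sup>L M l * norm (u - p k))"
          by (intro mult_left_mono Eh_diff uK pK) auto
        finally show "(y k $ i - y0 $ i) * (Eh i u - Eh i (p k)) \<le> \<bar>y k $ i - y0 $ i\<bar> * (integral\<^sup>L M l * norm (u - p k))" .
      qed
      also have "\<dots> = D k * norm (u - p k)" 
        unfolding D_def mult.assoc by (rule sum_distrib_right[symmetric])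
      finally have "(\<Sum>i\<in>UNIV. y k $ i * (Eh i u - Eh i (p k)))
          \<le> (\<Sum>i\<in>UNIV. y0 $ i * (Eh i u - Eh i (p k))) + D k * norm (u - p k)"
        by (simp add: left_diff_distrib sum_subtractf)
      moreover have "(\<Sum>i\<in>UNIV. y0 $ i * (Eh i u - Eh i (p k))) = C.E u - C.E (p k)"
        unfolding E_comb[OF uK] E_comb[OF pK] by (simp add: right_diff_distrib sum_subtractf)
      ultimately show ?thesis using d[OF u(1)] u(2) by (simp add: distrib_right)
    qed
    moreover have "0 < min d (\<eta> - dist w (p k))" using \<open>d > 0\<close> p(2)[of k] by simp
    ultimately show ?thesis by blast
  qed
  moreover have "(\<lambda>k. \<epsilon> k + D k) \<longlonglongrightarrow> 0" using tendsto_add[OF \<epsilon>(2) D_lim] by simp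
  moreover have "\<epsilon> k + D k > 0" for k using \<epsilon>(1)[of k] D0[of k] by simp
  ultimately show ?thesis
    using C.limiting_sum_rule[OF \<Omega> p v, of "\<lambda>k. \<epsilon> k + D k"] that by blast
qed

text \<open>Penalization provides multipliers \<open>y k\<close> along a sequence of points tending to \<open>w\<close>. If they are
bounded, the sum rule applies to the limit of a subsequence. If not, a subsequence with norms tending to
infinity is divided by its norms; a limit is then a nonzero multiplier for the functional \<open>0\<close>, which the constraint qualification \<open>CQ\<close> excludes.\<close>

theorem multiplier_rule:
  assumes \<Omega>: "closed (\<Omega> \<inter> cball w \<eta>)"
    and x: "\<And>k. x k \<in> \<Omega>" "\<And>k i. x k \<in> cball w \<eta> \<Longrightarrow> Eh i (x k) \<le> 0" "x \<longlonglongrightarrow> w" and v: "v \<longlonglongrightarrow> v0"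
    and normal: "\<And>(k::nat) \<epsilon>. \<epsilon> > 0 \<Longrightarrow> x k \<in> ball w \<eta> \<Longrightarrow> \<exists>d>0. \<forall>u\<in>\<Omega>. norm (u - x k) < d \<longrightarrow> (\<forall>i. Eh i u \<le> 0) \<longrightarrow>
      inner (v k) (u - x k) \<le> \<epsilon> * norm (u - x k)"
    and CQ: "\<And>y \<xi>. \<lbrakk>\<And>i. 0 \<le> y $ i; y \<noteq> 0; integrable M \<xi>;
       AE t in M. \<xi> t \<in> limiting_proximal_subgradients (cball w \<eta>) (comb y t) w;
       - integral\<^sup>L M \<xi> \<in> normal_cone w \<Omega>\<rbrakk> \<Longrightarrow> False"
  obtains y \<xi> where "\<And>i. 0 \<le> y $ i" "integrable M \<xi>"
    "AE t in M. \<xi> t \<in> limiting_proximal_subgradients (cball w \<eta>) (comb y t) w"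
    "v0 - integral\<^sup>L M \<xi> \<in> normal_cone w \<Omega>"
proof -
  obtain k0 where k0: "\<And>k. x (k + k0) \<in> ball w \<eta>"
  proof -
    obtain k0 where "\<And>k. k \<ge> k0 \<Longrightarrow> dist (x k) w < \<eta>"
      using x(3) eta_pos unfolding lim_sequentially by metis
    then have "x (k + k0) \<in> ball w \<eta>" for k by (simp add: dist_commute)
    then show ?thesis by (rule that)
  qed
  define e where "e k = 1 / real (Suc k)" for k
  have e: "e k > 0" for k by (simp add: e_def)
  have e_lim: "e \<longlonglongrightarrow> 0" unfolding e_def[abs_def] by (rule LIMSEQ_Suc[OF lim_1_over_n])
  define Q where "Q k p y \<longleftrightarrow> p \<in> \<Omega> \<and> p \<in> ball w \<eta> \<and> norm (p - x (k + k0)) < e k \<and> (\<forall>i. 0 \<le> y $ i) \<and>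
    (\<exists>d>0. \<forall>u\<in>\<Omega>. norm (u - p) < d \<longrightarrow>
       inner (v (k + k0)) (u - p) \<le> (\<Sum>i\<in>UNIV. y $ i * (Eh i u - Eh i p)) + 3 * e k * norm (u - p))"
    for k p and y :: "real ^ 'm"
  have "\<exists>p y. Q k p y" for k
  proof -
    have "Eh i (x (k + k0)) \<le> 0" for i using x(2)[of "k + k0" i] k0[of k] by simp
    then show ?thesis
      unfolding Q_def using penalty_multipliers[OF \<Omega> Eh_lipschitz x(1) k0 _ e e normal[OF e k0]] by blast
  qed
  then obtain p y where Q: "\<And>k. Q k (p k) (y k)" by metis
  have p: "p k \<in> \<Omega>" "p k \<in> ball w \<eta>" and px: "norm (p k - x (k + k0)) \<le> e k" and y0: "0 \<le> y k $ i" and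
    sub: "\<exists>d>0. \<forall>u\<in>\<Omega>. norm (u - p k) < d \<longrightarrow>
       inner (v (k + k0)) (u - p k) \<le> (\<Sum>i\<in>UNIV. y k $ i * (Eh i u - Eh i (p k))) + 3 * e k * norm (u - p k)"
    for k i using Q[of k] unfolding Q_def by auto
  have "(\<lambda>k. p k - x (k + k0)) \<longlonglongrightarrow> 0"
    by (rule Lim_null_comparison[OF _ e_lim]) (use px in auto)
  from tendsto_add[OF this LIMSEQ_ignore_initial_segment[OF x(3), of k0]] have p_lim: "p \<longlonglongrightarrow> w" by simp
  have v_lim: "(\<lambda>k. v (k + k0)) \<longlonglongrightarrow> v0" by (rule LIMSEQ_ignore_initial_segment[OF v])
  have nonneg_limit: "0 \<le> z $ i" if "(\<lambda>k. Y k) \<longlonglongrightarrow> z" "\<And>k. 0 \<le> Y k $ i" for Y and z :: "real ^ 'm" and i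
    using that(2) by (intro LIMSEQ_le_const[OF tendsto_vec_nth[OF that(1)]]) auto
  show ?thesis
  proof (cases "bounded (range y)")
    case True
    then obtain z r where r: "strict_mono (r :: nat \<Rightarrow> nat)" "(y \<circ> r) \<longlonglongrightarrow> z"
      using bounded_imp_convergent_subsequence by blast
    note sq = LIMSEQ_subseq_LIMSEQ[OF _ r(1), unfolded comp_def]
    have y_lim: "(\<lambda>k. y (r k)) \<longlonglongrightarrow> z" using r(2) by (simp add: comp_def)
    have e3: "3 * e (r k) > 0" for k using e[of "r k"] by simp
    have e3_lim: "(\<lambda>k. 3 * e (r k)) \<longlonglongrightarrow> 0" by (intro tendsto_mult_right_zero sq[OF e_lim])
    obtain \<xi> where "integrable M \<xi>" "v0 - integral\<^sup>L M \<xi> \<in> normal_cone w \<Omega>"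
      "AE t in M. \<xi> t \<in> limiting_proximal_subgradients (cball w \<eta>) (comb z t) w"
      using multiplier_sum_rule[OF \<Omega> p(1) p(2) sq[OF p_lim] sq[OF v_lim] y_lim e3 e3_lim sub] by blast
    moreover have "0 \<le> z $ i" for i using nonneg_limit[OF y_lim y0] .
    ultimately show ?thesis using that by blast
  next
    case False
    have "\<exists>j. real (Suc n) < norm (y j)" for n
      using False unfolding bounded_iff by (metis not_le rangeE)
    then obtain j where j: "\<And>n. real (Suc n) < norm (y (j n))" by metis
    have "\<exists>j. \<forall>n. norm (y (j n)) > real (Suc n) \<and> j n < j (Suc n)"
    proof (rule dependent_nat_choice)
      show "\<exists>j. real (Suc 0) < norm (y j)" using j by blast
      fix m n
      have "bounded (y ` {..m})" by (intro finite_imp_bounded) auto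
      then obtain B where B: "\<And>k. k \<le> m \<Longrightarrow> norm (y k) \<le> B" unfolding bounded_iff by auto
      obtain k where k: "norm (y k) > max B (real (Suc (Suc n)))"
        using False unfolding bounded_iff by (metis not_le rangeE)
      then have "m < k" using B[of k] by (cases "k \<le> m") auto
      then show "\<exists>j. real (Suc (Suc n)) < norm (y j) \<and> m < j" using k by auto
    qed
    then obtain j where j: "\<And>n. real (Suc n) < norm (y (j n))" "\<And>n. j n < j (Suc n)" by blast
    have "strict_mono j" using j(2) by (simp add: strict_mono_Suc_iff)
    define a where "a n = 1 / norm (y (j n))" for n
    have a: "a n > 0" "a n \<le> e n" "a n \<le> 1" for n
    proof -
      have "norm (y (j n)) > 0" using j(1)[of n] by (rule le_less_trans[rotated]) simp
      then show "a n > 0" by (simp add: a_def)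
      show "a n \<le> e n" using j(1)[of n] unfolding a_def e_def by (intro frac_le) auto
      then show "a n \<le> 1" by (rule order_trans) (simp add: e_def)
    qed
    have a_lim: "a \<longlonglongrightarrow> 0"
      by (rule Lim_null_comparison[OF _ e_lim]) (use a in \<open>auto intro!: always_eventually simp: abs_of_pos\<close>)
    define Y where "Y n = a n *\<^sub>R y (j n)" for n
    have nY: "norm (Y n) = 1" for n using a(1)[of n] by (simp add: Y_def a_def)
    then have "bounded (range Y)" by (auto simp: bounded_iff)
    then obtain z r where r: "strict_mono (r :: nat \<Rightarrow> nat)" "(Y \<circ> r) \<longlonglongrightarrow> z"
      using bounded_imp_convergent_subsequence by blast
    have Y_lim: "(\<lambda>k. Y (r k)) \<longlonglongrightarrow> z" using r(2) by (simp add: comp_def)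
    have "norm z = 1" using tendsto_norm[OF Y_lim] by (simp add: nY LIMSEQ_const_iff)
    have z0: "0 \<le> z $ i" for i
      by (rule nonneg_limit[OF Y_lim]) (use a(1) y0 in \<open>simp add: Y_def less_imp_le\<close>)
    note sq = LIMSEQ_subseq_LIMSEQ[OF LIMSEQ_subseq_LIMSEQ[OF _ \<open>strict_mono j\<close>] r(1), unfolded comp_def]
    note sr = LIMSEQ_subseq_LIMSEQ[OF _ r(1), unfolded comp_def]
    have "(\<lambda>k. a (r k) *\<^sub>R v (j (r k) + k0)) \<longlonglongrightarrow> 0 *\<^sub>R v0"
      by (intro tendsto_scaleR sr[OF a_lim] sq[OF v_lim])
    then have av_lim: "(\<lambda>k. a (r k) *\<^sub>R v (j (r k) + k0)) \<longlonglongrightarrow> 0" by simp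
    have e3: "3 * e (j (r k)) > 0" for k using e[of "j (r k)"] by simp
    have e3_lim: "(\<lambda>k. 3 * e (j (r k))) \<longlonglongrightarrow> 0" by (intro tendsto_mult_right_zero sq[OF e_lim])
    have sub': "\<exists>d>0. \<forall>u\<in>\<Omega>. norm (u - p (j (r k))) < d \<longrightarrow>
       inner (a (r k) *\<^sub>R v (j (r k) + k0)) (u - p (j (r k)))
         \<le> (\<Sum>i\<in>UNIV. Y (r k) $ i * (Eh i u - Eh i (p (j (r k))))) + 3 * e (j (r k)) * norm (u - p (j (r k)))" for k
    proof -
      let ?n = "r k" let ?p = "p (j (r k))"
      obtain d where "d > 0" and d: "\<And>u. u \<in> \<Omega> \<Longrightarrow> norm (u - ?p) < d \<Longrightarrow>
       inner (v (j ?n + k0)) (u - ?p) \<le> (\<Sum>i\<in>UNIV. y (j ?n) $ i * (Eh i u - Eh i ?p)) + 3 * e (j ?n) * norm (u - ?p)"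
        using sub[of "j ?n"] by blast
      have "inner (a ?n *\<^sub>R v (j ?n + k0)) (u - ?p)
         \<le> (\<Sum>i\<in>UNIV. Y ?n $ i * (Eh i u - Eh i ?p)) + 3 * e (j ?n) * norm (u - ?p)"
        if u: "u \<in> \<Omega>" "norm (u - ?p) < d" for u
      proof -
        have "a ?n * inner (v (j ?n + k0)) (u - ?p)
            \<le> a ?n * ((\<Sum>i\<in>UNIV. y (j ?n) $ i * (Eh i u - Eh i ?p)) + 3 * e (j ?n) * norm (u - ?p))"
          using d[OF u] a(1)[of ?n] by (intro mult_left_mono) auto
        also have "\<dots> = (\<Sum>i\<in>UNIV. Y ?n $ i * (Eh i u - Eh i ?p)) + a ?n * (3 * e (j ?n) * norm (u - ?p))"
          by (simp add: Y_def distrib_left sum_distrib_left mult_ac)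
        also have "a ?n * (3 * e (j ?n) * norm (u - ?p)) \<le> 1 * (3 * e (j ?n) * norm (u - ?p))"
          using a(3)[of ?n] e[of "j ?n"] by (intro mult_right_mono) auto
        finally show ?thesis by simp
      qed
      with \<open>d > 0\<close> show ?thesis by blast
    qed
    obtain \<xi> where "integrable M \<xi>" "0 - integral\<^sup>L M \<xi> \<in> normal_cone w \<Omega>"
      "AE t in M. \<xi> t \<in> limiting_proximal_subgradients (cball w \<eta>) (comb z t) w"
      using multiplier_sum_rule[OF \<Omega> p(1) p(2) sq[OF p_lim] av_lim Y_lim e3 e3_lim sub'] by blast
    then have False using CQ[of z \<xi>] z0 \<open>norm z = 1\<close> by force
    then show ?thesis ..
  qed
qed

end

section \<open>Horizontal normals and Lipschitz-like multifunctions\<close>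

text \<open>Let \<open>(p, q)\<close> be a regular normal at a nearby point \<open>(a, b)\<close> of the graph. When \<open>a\<close> moves by \<open>s p\<close>, some point of the
graph follows with \<open>b\<close> moving by at most \<open>l s norm p\<close>, and the normal inequality gives
\<open>norm p \<le> l * norm q\<close>. This inequality survives in the limit.\<close>

lemma Lipschitz_like_normal_cone_trivial:
  fixes G :: "'a::real_inner \<Rightarrow> 'b::real_inner set"
  assumes "Lipschitz_like G x z" and N: "(v, 0) \<in> normal_cone (x, z) (gph G)"
  shows "v = 0"
proof -
  from assms(1)[unfolded Lipschitz_like_def, THEN conjunct2]
  obtain l U V where *: "l \<ge> 0 \<and> open U \<and> x \<in> U \<and> open V \<and> z \<in> V \<and> (\<forall>u\<in>U. \<forall>v\<in>U.
      G u \<inter> V \<subseteq> {w + (l * norm (u - v)) *\<^sub>R b | w b. w \<in> G v \<and> b \<in> cball 0 1})"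
    by (elim exE) (rule that)
  then have "l \<ge> 0" and U: "open U" "x \<in> U" and V: "open V" "z \<in> V" by simp_all
  have L: "G u \<inter> V \<subseteq> {w + (l * norm (u - v)) *\<^sub>R b | w b. w \<in> G v \<and> b \<in> cball 0 1}"
    if "u \<in> U" "v \<in> U" for u v
    using * that by (elim conjE) (drule bspec, assumption, drule bspec, assumption, assumption)
  obtain X Y where X: "X \<longlonglongrightarrow> (x, z)" and Y: "Y \<longlonglongrightarrow> (v, 0)" and
    R: "\<And>k::nat. Y k \<in> regular_normal_cone (X k) (gph G)"
    using N unfolding normal_cone_def by blast
  have bound: "norm (fst (Y k)) \<le> l * norm (snd (Y k))" if "fst (X k) \<in> U" "snd (X k) \<in> V" for k
  proof -
    define a b p q where "a = fst (X k)" and "b = snd (X k)" and "p = fst (Y k)" and "q = snd (Y k)"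
    have ab: "X k = (a, b)" "Y k = (p, q)" by (simp_all add: a_def b_def p_def q_def)
    have "a \<in> U" "b \<in> V" using that by (simp_all add: a_def b_def)
    have "(a, b) \<in> gph G" and reg: "\<And>e. e > 0 \<Longrightarrow> \<exists>d>0. \<forall>u\<in>gph G. norm (u - (a, b)) < d \<longrightarrow>
        inner (p, q) (u - (a, b)) \<le> e * norm (u - (a, b))"
      using R[of k] unfolding ab regular_normal_cone_iff by blast+
    have "b \<in> G a" using \<open>(a, b) \<in> gph G\<close> by (simp add: gph_def)
    have "norm p \<le> l * norm q + e" if "e > 0" for e
    proof (cases "p = 0")
      case True then show ?thesis using \<open>l \<ge> 0\<close> \<open>e > 0\<close> by simp
    next
      case False
      define e' where "e' = e / (1 + l)"
      have "e' > 0" using \<open>e > 0\<close> \<open>l \<ge> 0\<close> by (simp add: e'_def)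
      obtain d where "d > 0" and d: "\<And>u. u \<in> gph G \<Longrightarrow> norm (u - (a, b)) < d \<Longrightarrow>
        inner (p, q) (u - (a, b)) \<le> e' * norm (u - (a, b))" using reg[OF \<open>e' > 0\<close>] by blast
      obtain c where "c > 0" and c: "\<And>y. dist y a < c \<Longrightarrow> y \<in> U"
        using \<open>open U\<close> \<open>a \<in> U\<close> unfolding open_dist by blast
      obtain m where m: "m > 0" "m \<le> c / 2" "m \<le> d / (2 * (1 + l))"
      proof (rule that)
        show "min (c / 2) (d / (2 * (1 + l))) > 0" using \<open>c > 0\<close> \<open>d > 0\<close> \<open>l \<ge> 0\<close> by simp
      qed (rule min.cobounded1, rule min.cobounded2)
      have np: "norm p > 0" using False by simp
      define s where "s = m / norm p"
      have eq: "s * norm p = m" using np by (simp add: s_def)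
      have "(1 + l) * m \<le> (1 + l) * (d / (2 * (1 + l)))"
        using m(3) \<open>l \<ge> 0\<close> by (intro mult_left_mono) auto
      also have "\<dots> = d / 2" using \<open>l \<ge> 0\<close> by (simp add: field_simps)
      finally have s: "s > 0" "s * norm p < c" "(1 + l) * (s * norm p) < d"
        unfolding eq using m np \<open>c > 0\<close> \<open>d > 0\<close> by (simp_all add: s_def)
      have "a + s *\<^sub>R p \<in> U" using s by (intro c) (simp add: dist_norm)
      then obtain y u where y: "y \<in> G (a + s *\<^sub>R p)" "u \<in> cball 0 1"
        "b = y + (l * norm (a - (a + s *\<^sub>R p))) *\<^sub>R u"
        using L[OF \<open>a \<in> U\<close>, of "a + s *\<^sub>R p"] \<open>b \<in> G a\<close> \<open>b \<in> V\<close> by blast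
      have "norm (y - b) = l * (s * norm p) * norm u" using y(3) s(1) \<open>l \<ge> 0\<close> by (simp add: abs_mult)
      also have "\<dots> \<le> l * (s * norm p) * 1" using y(2) s(1) \<open>l \<ge> 0\<close> by (intro mult_left_mono) auto
      finally have yb: "norm (y - b) \<le> l * (s * norm p)" by simp
      have nrm: "norm ((a + s *\<^sub>R p, y) - (a, b)) \<le> (1 + l) * (s * norm p)"
        using norm_Pair_le[of "s *\<^sub>R p" "y - b"] yb s(1) by (simp add: algebra_simps)
      then have "inner (p, q) ((a + s *\<^sub>R p, y) - (a, b)) \<le> e' * norm ((a + s *\<^sub>R p, y) - (a, b))"
        using s(3) y(1) by (intro d) (auto simp: gph_def)
      also have "\<dots> \<le> e' * ((1 + l) * (s * norm p))" using nrm \<open>e' > 0\<close> by (intro mult_left_mono) auto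
      also have "\<dots> = e * (s * norm p)" using \<open>l \<ge> 0\<close> by (simp add: e'_def field_simps)
      finally have "s * inner p p + inner q (y - b) \<le> e * (s * norm p)" by simp
      moreover have "- inner q (y - b) \<le> norm q * (l * (s * norm p))"
      proof -
        have "- inner q (y - b) \<le> norm q * norm (y - b)"
          using norm_cauchy_schwarz[of q "- (y - b)"] by (simp add: norm_minus_commute inner_diff_right)
        also have "\<dots> \<le> norm q * (l * (s * norm p))" using yb by (intro mult_left_mono) auto
        finally show ?thesis .
      qed
      moreover have "inner p p = norm p * norm p" by (simp add: power2_norm_eq_inner[symmetric] power2_eq_square)
      ultimately have "(s * norm p) * norm p \<le> (s * norm p) * (l * norm q + e)"
        by (simp add: algebra_simps)
      then show ?thesis using s(1) np by simp
    qed
    then have "norm p \<le> l * norm q" by (rule field_le_epsilon)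
    then show ?thesis by (simp add: p_def q_def)
  qed
  have "\<forall>\<^sub>F k in sequentially. fst (X k) \<in> U" "\<forall>\<^sub>F k in sequentially. snd (X k) \<in> V"
    using topological_tendstoD[OF tendsto_fst[OF X] U(1)] topological_tendstoD[OF tendsto_snd[OF X] V(1)] U V by auto
  then have "\<forall>\<^sub>F k in sequentially. norm (fst (Y k)) \<le> l * norm (snd (Y k))"
    by eventually_elim (rule bound)
  moreover have "(\<lambda>k. norm (fst (Y k))) \<longlonglongrightarrow> norm (fst (v, 0::'b))" "(\<lambda>k. l * norm (snd (Y k))) \<longlonglongrightarrow> l * norm (snd (v, 0::'b))"
    by (intro tendsto_intros Y)+
  ultimately have "norm (fst (v, 0::'b)) \<le> l * norm (snd (v, 0::'b))"
    by (intro tendsto_le[OF sequentially_bot])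
  then show ?thesis by simp
qed

lemma norm_add_le_quadratic:
  fixes p h :: "'a::real_inner"
  assumes "p \<noteq> 0"
  shows "norm (p + h) \<le> norm p + inner p h / norm p + (norm h)\<^sup>2 / (2 * norm p)"
proof -
  have np: "norm p > 0" using assms by simp
  have "0 \<le> (norm (p + h) - norm p)\<^sup>2" by simp
  then have "2 * norm p * norm (p + h) \<le> (norm (p + h))\<^sup>2 + (norm p)\<^sup>2"
    by (simp add: power2_eq_square algebra_simps)
  also have "(norm (p + h))\<^sup>2 = (norm p)\<^sup>2 + 2 * inner p h + (norm h)\<^sup>2"
    by (simp add: power2_norm_eq_inner inner_add_left inner_add_right inner_commute)
  finally have "norm (p + h) \<le> ((norm p)\<^sup>2 + 2 * inner p h + (norm h)\<^sup>2 + (norm p)\<^sup>2) / (2 * norm p)"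
    using np by (simp add: pos_le_divide_eq mult_ac)
  also have "\<dots> = norm p + inner p h / norm p + (norm h)\<^sup>2 / (2 * norm p)"
    using np by (simp add: field_simps power2_eq_square)
  finally show ?thesis .
qed

text \<open>Failure of the property with the constant \<open>1 / \<tau>\<close> provides points \<open>u\<close>, \<open>v\<close> near \<open>x\<close> and \<open>y \<in> F u\<close> near \<open>z\<close> with
\<open>norm (y - w) > norm (u - v) / \<tau>\<close> for all \<open>w \<in> F v\<close>. Minimize \<open>norm (a - v) + 2 * \<sigma> * norm (b - y)\<close> over the graph. A
minimizer with \<open>a = v\<close> would have \<open>b \<in> F v\<close> too close to \<open>y\<close>. So \<open>a \<noteq> v\<close>, where the first term is differentiable with
a gradient of norm one, and the second term contributes to the normal inequality only an error of
order \<open>\<sigma>\<close>.\<close>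

lemma not_Lipschitz_like_approx_normal:
  fixes F :: "'a::euclidean_space \<Rightarrow> 'b::euclidean_space set"
  assumes "(x, z) \<in> gph F" "\<not> Lipschitz_like F x z" and cl: "closed (gph F \<inter> cball (x, z) \<eta>)"
    and \<sigma>: "0 < \<sigma>" "\<sigma> \<le> 1" "3 * \<sigma> < \<eta>"
  shows "\<exists>p e. norm (p - (x, z)) \<le> 3 * \<sigma> \<and> norm e = 1 \<and> (e, 0) \<in> approx_normal (3 * \<sigma>) p (gph F)"
proof -
  \<comment> \<open>\<open>\<sigma>\<^sup>2\<close> makes \<open>1 / \<tau>\<close> large against the weight \<open>2 * \<sigma>\<close> and keeps \<open>norm (u - v) / \<sigma>\<close> below \<open>\<sigma>\<close>\<close>
  define \<tau> where "\<tau> = \<sigma>\<^sup>2 / 2"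
  have "\<tau> > 0" using \<sigma> by (simp add: \<tau>_def)
  have s2: "\<sigma>\<^sup>2 \<le> \<sigma>" using \<sigma> by (simp add: power2_eq_square mult_left_le)
  have "\<exists>u\<in>ball x \<tau>. \<exists>v\<in>ball x \<tau>.
      \<not> F u \<inter> ball z \<tau> \<subseteq> {w + (1 / \<tau> * norm (u - v)) *\<^sub>R b | w b. w \<in> F v \<and> b \<in> cball 0 1}"
  proof (rule ccontr)
    assume "\<not> ?thesis"
    then have "\<forall>u\<in>ball x \<tau>. \<forall>v\<in>ball x \<tau>.
      F u \<inter> ball z \<tau> \<subseteq> {w + (1 / \<tau> * norm (u - v)) *\<^sub>R b | w b. w \<in> F v \<and> b \<in> cball 0 1}" by blast
    moreover have "0 \<le> 1 / \<tau>" "x \<in> ball x \<tau>" "z \<in> ball z \<tau>" using \<open>\<tau> > 0\<close> by auto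
    ultimately have "Lipschitz_like F x z"
      unfolding Lipschitz_like_def using assms(1) open_ball by blast
    then show False using assms(2) by simp
  qed
  then obtain u v y where uv: "u \<in> ball x \<tau>" "v \<in> ball x \<tau>" and y: "y \<in> F u" "y \<in> ball z \<tau>" and
    out: "\<And>w b. w \<in> F v \<Longrightarrow> b \<in> cball 0 1 \<Longrightarrow> y \<noteq> w + (1 / \<tau> * norm (u - v)) *\<^sub>R b" by blast
  define \<delta> where "\<delta> = norm (u - v)"
  have "u \<noteq> v" using out[of y 0] y(1) by auto
  then have "\<delta> > 0" by (simp add: \<delta>_def)
  have far: "\<delta> / \<tau> < norm (y - w)" if "w \<in> F v" for w
  proof (rule ccontr)
    assume le: "\<not> \<delta> / \<tau> < norm (y - w)"
    define b where "b = (\<tau> / \<delta>) *\<^sub>R (y - w)"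
    have "norm b = \<tau> / \<delta> * norm (y - w)" using \<open>\<delta> > 0\<close> \<open>\<tau> > 0\<close> by (simp add: b_def del: scaleR_right_diff_distrib)
    also have "\<dots> \<le> \<tau> / \<delta> * (\<delta> / \<tau>)" using le \<open>\<delta> > 0\<close> \<open>\<tau> > 0\<close> by (intro mult_left_mono) auto
    also have "\<dots> = 1" using \<open>\<delta> > 0\<close> \<open>\<tau> > 0\<close> by simp
    finally have "norm b \<le> 1" .
    moreover have "y = w + (1 / \<tau> * norm (u - v)) *\<^sub>R b"
      using \<open>\<delta> > 0\<close> \<open>\<tau> > 0\<close> by (simp add: b_def \<delta>_def[symmetric])
    ultimately show False using out[OF that, of b] by simp
  qed
  have ux: "norm (u - x) < \<tau>" and vx: "norm (v - x) < \<tau>" and yz: "norm (y - z) < \<tau>"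
    using uv y by (auto simp: dist_norm norm_minus_commute)
  have d2: "\<delta> < \<sigma>\<^sup>2"
    using norm_triangle_ineq4[of "u - x" "v - x"] ux vx by (simp add: \<delta>_def \<tau>_def)
  define S where "S = gph F \<inter> cball (x, z) \<eta>"
  have "compact S" unfolding S_def using cl compact_Int_closed[OF compact_cball, of _ "(x, z)" \<eta>]
    by (metis bounded_Int bounded_cball compact_eq_bounded_closed)
  have "norm ((u, y) - (x, z)) \<le> norm (u - x) + norm (y - z)" using norm_Pair_le[of "u - x" "y - z"] by simp
  then have "norm ((u, y) - (x, z)) \<le> \<eta>" using ux yz s2 \<sigma> by (simp add: \<tau>_def)
  then have uyS: "(u, y) \<in> S" 
    using y(1) norm_minus_commute[of "(x, z)" "(u, y)"] by (simp add: S_def gph_def dist_norm)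
  define J where "J p = norm (fst p - v) + 2 * \<sigma> * norm (snd p - y)" for p
  have "continuous_on S J" unfolding J_def by (intro continuous_intros)
  then obtain p where p: "p \<in> S" "\<And>p'. p' \<in> S \<Longrightarrow> J p \<le> J p'"
    using continuous_attains_inf[OF \<open>compact S\<close>] uyS by blast
  obtain a b where ab: "p = (a, b)" by (cases p)
  have Jp: "norm (a - v) + 2 * \<sigma> * norm (b - y) \<le> \<delta>" using p(2)[OF uyS] by (simp add: J_def ab \<delta>_def)
  have "0 \<le> 2 * \<sigma> * norm (b - y)" using \<sigma> by simp
  then have av: "norm (a - v) \<le> \<delta>" using Jp by linarith
  have bny: "norm (b - y) \<le> \<delta> / (2 * \<sigma>)"
  proof -
    have "2 * \<sigma> * norm (b - y) \<le> \<delta>" using Jp norm_ge_zero[of "a - v"] by linarith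
    then show ?thesis using \<sigma> by (simp add: pos_le_divide_eq mult_ac)
  qed
  have "a \<noteq> v"
  proof
    assume "a = v"
    then have "\<delta> / \<tau> < norm (y - b)" using p(1) by (intro far) (simp add: S_def ab gph_def)
    also have "\<dots> \<le> \<delta> / (2 * \<sigma>)" using bny by (simp add: norm_minus_commute)
    also have "\<dots> \<le> \<delta> / \<tau>" using \<open>\<delta> > 0\<close> \<open>\<tau> > 0\<close> \<sigma> s2 by (intro divide_left_mono) (auto simp: \<tau>_def)
    finally show False by simp
  qed
  have "\<delta> / (2 * \<sigma>) \<le> \<sigma>\<^sup>2 / (2 * \<sigma>)" using d2 \<sigma> by (intro divide_right_mono) auto
  also have "\<dots> = \<sigma> / 2" using \<sigma> by (simp add: power2_eq_square)
  finally have bny': "norm (b - y) \<le> \<sigma> / 2" using bny by linarith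
  have "norm (p - (x, z)) \<le> norm (a - x) + norm (b - z)" using norm_Pair_le[of "a - x" "b - z"] by (simp add: ab)
  also have "\<dots> \<le> (norm (a - v) + norm (v - x)) + (norm (b - y) + norm (y - z))"
    using norm_triangle_ineq[of "a - v" "v - x"] norm_triangle_ineq[of "b - y" "y - z"] by simp
  also have "\<dots> \<le> 3 * \<sigma>" using av d2 vx bny' yz s2 \<sigma> by (simp add: \<tau>_def)
  finally have pw: "norm (p - (x, z)) \<le> 3 * \<sigma>" .
  define e where "e = (1 / norm (a - v)) *\<^sub>R (v - a)"
  have nav: "norm (a - v) > 0" using \<open>a \<noteq> v\<close> by simp
  have "norm e = 1" using nav by (simp add: e_def norm_minus_commute)
  moreover have "(e, 0) \<in> approx_normal (3 * \<sigma>) p (gph F)"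
    unfolding approx_normal_def
  proof (intro CollectI conjI exI[of _ "min (\<eta> - norm (p - (x, z))) (2 * \<sigma> * norm (a - v))"] ballI impI)
    show "p \<in> gph F" using p(1) by (simp add: S_def)
    show "0 < min (\<eta> - norm (p - (x, z))) (2 * \<sigma> * norm (a - v))" using pw \<sigma> nav by simp
    fix p' assume p': "p' \<in> gph F" "norm (p' - p) < min (\<eta> - norm (p - (x, z))) (2 * \<sigma> * norm (a - v))"
    have "norm (p' - (x, z)) \<le> norm (p' - p) + norm (p - (x, z))" 
      by (rule dist_triangle[of p' "(x, z)" p, unfolded dist_norm])
    then have "p' \<in> S" using p' norm_minus_commute[of "(x, z)" p'] by (simp add: S_def dist_norm)
    obtain a' b' where ab': "p' = (a', b')" by (cases p')
    have na: "norm (a' - a) \<le> norm (p' - p)" and nb: "norm (b' - b) \<le> norm (p' - p)"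
      using norm_fst_le[of "a' - a" "b' - b"] norm_snd_le[of "b' - b" "a' - a"] by (simp_all add: ab ab')
    have "norm (a - v) + 2 * \<sigma> * norm (b - y) \<le> norm (a' - v) + 2 * \<sigma> * norm (b' - y)"
      using p(2)[OF \<open>p' \<in> S\<close>] by (simp add: J_def ab ab')
    moreover have "norm (a' - v) \<le> norm (a - v) + inner (a - v) (a' - a) / norm (a - v) + (norm (a' - a))\<^sup>2 / (2 * norm (a - v))"
      using norm_add_le_quadratic[of "a - v" "a' - a"] \<open>a \<noteq> v\<close> by simp
    moreover have "2 * \<sigma> * norm (b' - y) \<le> 2 * \<sigma> * norm (b - y) + 2 * \<sigma> * norm (b' - b)"
      using mult_left_mono[OF norm_triangle_ineq[of "b' - b" "b - y"], of "2 * \<sigma>"] \<sigma> by (simp add: distrib_left)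
    moreover have "(norm (a' - a))\<^sup>2 / (2 * norm (a - v)) \<le> \<sigma> * norm (p' - p)"
    proof -
      have "(norm (a' - a))\<^sup>2 \<le> norm (p' - p) * (2 * \<sigma> * norm (a - v))"
        unfolding power2_eq_square using na p'(2) by (intro mult_mono) auto
      then show ?thesis using nav by (simp add: pos_divide_le_eq mult_ac)
    qed
    moreover have "2 * \<sigma> * norm (b' - b) \<le> 2 * \<sigma> * norm (p' - p)" using nb \<sigma> by simp
    moreover have "inner (e, 0) (p' - p) = - (inner (a - v) (a' - a) / norm (a - v))"
      by (simp add: ab ab' e_def inner_diff_left diff_divide_distrib)
    ultimately show "inner (e, 0) (p' - p) \<le> 3 * \<sigma> * norm (p' - p)" by linarith
  qed
  ultimately show ?thesis using pw by blast
qed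

text \<open>The sufficiency part of Mordukhovich's coderivative criterion: a cluster point \<open>e0\<close> of the unit vectors from
the preceding lemma gives a normal \<open>(e0, 0)\<close> with \<open>e0 \<noteq> 0\<close>.\<close>

theorem Lipschitz_like_if_normal_cone_trivial:
  fixes F :: "'a::euclidean_space \<Rightarrow> 'b::euclidean_space set"
  assumes gph: "(x, z) \<in> gph F" and cl: "closed (gph F \<inter> cball (x, z) \<eta>)" and "\<eta> > 0"
    and trivial: "\<And>v. (v, 0) \<in> normal_cone (x, z) (gph F) \<Longrightarrow> v = 0"
  shows "Lipschitz_like F x z"
proof (rule ccontr)
  assume no: "\<not> ?thesis"
  define \<sigma> where "\<sigma> k = min 1 (\<eta> / 4) * (1 / real (Suc k))" for k
  have \<sigma>: "0 < \<sigma> k" "\<sigma> k \<le> 1" "3 * \<sigma> k < \<eta>" for k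
  proof -
    have le: "\<sigma> k \<le> min 1 (\<eta> / 4) * 1" unfolding \<sigma>_def using \<open>\<eta> > 0\<close> by (intro mult_left_mono) auto
    show "0 < \<sigma> k" using \<open>\<eta> > 0\<close> by (simp add: \<sigma>_def)
    show "\<sigma> k \<le> 1" "3 * \<sigma> k < \<eta>" using le \<open>\<eta> > 0\<close> by (auto simp: min_def split: if_splits)
  qed
  have "\<sigma> \<longlonglongrightarrow> 0" unfolding \<sigma>_def[abs_def] by (intro tendsto_mult_right_zero LIMSEQ_Suc[OF lim_1_over_n])
  then have \<sigma>3: "(\<lambda>k. 3 * \<sigma> k) \<longlonglongrightarrow> 0" by (rule tendsto_mult_right_zero)
  have "\<exists>p e. norm (p - (x, z)) \<le> 3 * \<sigma> k \<and> norm e = 1 \<and> (e, 0) \<in> approx_normal (3 * \<sigma> k) p (gph F)" for k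
    by (rule not_Lipschitz_like_approx_normal[OF gph no cl \<sigma>])
  then obtain p e where pe: "\<And>k. norm (p k - (x, z)) \<le> 3 * \<sigma> k" "\<And>k. norm (e k) = 1"
    "\<And>k. (e k, 0) \<in> approx_normal (3 * \<sigma> k) (p k) (gph F)" by metis
  have "(\<lambda>k. p k - (x, z)) \<longlonglongrightarrow> 0" by (rule Lim_null_comparison[OF _ \<sigma>3]) (use pe(1) in auto)
  from tendsto_add[OF this tendsto_const[of "(x, z)"]] have p_lim: "p \<longlonglongrightarrow> (x, z)" by simp
  have "bounded (range e)" using pe(2) by (auto simp: bounded_iff)
  then obtain e0 r where r: "strict_mono (r :: nat \<Rightarrow> nat)" "(e \<circ> r) \<longlonglongrightarrow> e0"
    using bounded_imp_convergent_subsequence by blast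
  note sub = LIMSEQ_subseq_LIMSEQ[OF _ r(1), unfolded comp_def]
  have e_lim: "(\<lambda>k. e (r k)) \<longlonglongrightarrow> e0" using r(2) by (simp add: comp_def)
  have "(e0, 0) \<in> normal_cone (x, z) (gph F)"
  proof (rule normal_cone_limit_approx_normal[OF cl \<open>\<eta> > 0\<close> _ sub[OF p_lim] _ sub[OF \<sigma>3]])
    show "0 \<le> 3 * \<sigma> (r k)" for k using \<sigma>(1)[of "r k"] by simp
    show "(\<lambda>k. (e (r k), 0)) \<longlonglongrightarrow> (e0, 0)" by (intro tendsto_Pair e_lim tendsto_const)
    show "(e (r k), 0) \<in> approx_normal (3 * \<sigma> (r k)) (p (r k)) (gph F)" for k by (rule pe(3))
  qed
  then have "e0 = 0" by (rule trivial)
  moreover have "norm e0 = 1" using tendsto_norm[OF e_lim] by (simp add: pe(2) LIMSEQ_const_iff)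
  ultimately show False by simp
qed

section \<open>Partially convex constraints with a Slater point\<close>

text \<open>Here \<open>\<Omega>\<close> stands for the graph of a multifunction, the point \<open>z'\<close> is a Slater point close to \<open>z\<close>, and the assumption on the
segment expresses the convexity of its value at \<open>x\<close>.\<close>

locale convex_lipschitz_constraints =
  lipschitz_integrands M h l "(x, z)" \<eta>
  for M :: "'t measure" and h :: "'m::finite \<Rightarrow> 't \<Rightarrow> 'a::euclidean_space \<times> 'b::euclidean_space \<Rightarrow> real"
    and l :: "'t \<Rightarrow> real" and x :: 'a and z :: 'b and \<eta> :: real +
  fixes \<Omega> :: "('a \<times> 'b) set" and z' :: 'b
  assumes closed_local: "closed (\<Omega> \<inter> cball (x, z) \<eta>)"
    and regular: "normally_regular \<Omega> (x, z)"
    and segment: "\<And>r. 0 \<le> r \<Longrightarrow> r \<le> 1 \<Longrightarrow> (x, z + r *\<^sub>R (z' - z)) \<in> \<Omega>"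
    and active: "\<And>i. Eh i (x, z) = 0"
    and slater: "\<And>i. Eh i (x, z') < 0" and slater_near: "(x, z') \<in> ball (x, z) \<eta>"
    and convex: "\<And>i t a u u' r. \<lbrakk>t \<in> space M; (a, u) \<in> cball (x, z) \<eta>; (a, u') \<in> cball (x, z) \<eta>; 0 \<le> r; r \<le> 1\<rbrakk>
      \<Longrightarrow> h i t (a, (1 - r) *\<^sub>R u + r *\<^sub>R u') \<le> (1 - r) * h i t (a, u) + r * h i t (a, u')"
begin

text \<open>By normal regularity \<open>v - integral\<^sup>L M \<xi>\<close> is a regular normal, so it has a nonpositive product with the tangent
direction \<open>(0, z' - z)\<close>. Partial convexity bounds the product of \<open>\<xi> t\<close> with this direction by the increment of the
weighted integrand, and the expectation of that increment is the value at \<open>z'\<close>, since the constraints are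
active at \<open>(x, z)\<close>.\<close>

lemma multiplier_slater_bound:
  assumes y: "\<And>i. 0 \<le> y $ i" and \<xi>: "integrable M \<xi>"
    and sub: "AE t in M. \<xi> t \<in> limiting_proximal_subgradients (cball (x, z) \<eta>) (comb y t) (x, z)"
    and N: "v - integral\<^sup>L M \<xi> \<in> normal_cone (x, z) \<Omega>"
  shows "inner v (0, z' - z) \<le> (\<Sum>i\<in>UNIV. y $ i * Eh i (x, z'))"
proof -
  let ?K = "cball (x, z) \<eta>" let ?d = "z' - z"
  interpret C: lipschitz_integrand M "comb y" "\<lambda>t. (\<Sum>i\<in>UNIV. \<bar>y $ i\<bar>) * l t" "(x, z)" \<eta>
    by (rule comb_lipschitz_integrand)
  have wK: "(x, z) \<in> ?K" using eta_pos by simp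
  have zK: "(x, z') \<in> ?K" using slater_near by simp
  have "v - integral\<^sup>L M \<xi> \<in> regular_normal_cone (x, z) \<Omega>"
    using N regular by (simp add: normally_regular_def)
  then have reg: "\<exists>d>0. \<forall>u\<in>\<Omega>. norm (u - (x, z)) < d \<longrightarrow>
      inner (v - integral\<^sup>L M \<xi>) (u - (x, z)) \<le> e * norm (u - (x, z))" if "e > 0" for e
    using that unfolding regular_normal_cone_iff by blast
  have scaled: "inner (v - integral\<^sup>L M \<xi>) (0, ?d) \<le> e * norm ?d" if "e > 0" for e
  proof -
    obtain d where "d > 0" and d: "\<And>u. u \<in> \<Omega> \<Longrightarrow> norm (u - (x, z)) < d \<Longrightarrow>
      inner (v - integral\<^sup>L M \<xi>) (u - (x, z)) \<le> e * norm (u - (x, z))" using reg[OF \<open>e > 0\<close>] by blast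
    obtain r where r: "0 < r" "r \<le> 1" "r * norm ?d < d"
    proof (cases "?d = 0")
      case True
      then show ?thesis using that[of 1] \<open>d > 0\<close> by simp
    next
      case False
      let ?r = "min 1 (d / (2 * norm ?d))"
      have "?r * norm ?d \<le> d / (2 * norm ?d) * norm ?d" by (intro mult_right_mono) auto
      also have "\<dots> < d" using False \<open>d > 0\<close> by simp
      finally show ?thesis using that[of ?r] False \<open>d > 0\<close> by simp
    qed
    have eq: "(x, z + r *\<^sub>R ?d) - (x, z) = r *\<^sub>R (0, ?d)" by simp
    have nrm: "norm (r *\<^sub>R (0 :: 'a, ?d)) = r * norm ?d" using r(1) by (simp add: norm_Pair)
    have "inner (v - integral\<^sup>L M \<xi>) (r *\<^sub>R (0, ?d)) \<le> e * (r * norm ?d)"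
      using d[of "(x, z + r *\<^sub>R ?d)"] segment[of r] r unfolding eq nrm by simp
    then have "r * inner (v - integral\<^sup>L M \<xi>) (0, ?d) \<le> r * (e * norm ?d)"
      by (simp only: inner_scaleR_right mult_ac)
    then show ?thesis using r(1) by simp
  qed
  have "inner (v - integral\<^sup>L M \<xi>) (0, ?d) \<le> 0 + e" if "e > 0" for e
  proof -
    have np: "norm ?d + 1 > 0" using norm_ge_zero[of ?d] by linarith
    then have "inner (v - integral\<^sup>L M \<xi>) (0, ?d) \<le> e / (norm ?d + 1) * norm ?d"
      using that by (intro scaled divide_pos_pos)
    also have "\<dots> \<le> e" using that np by (simp add: pos_divide_le_eq)
    finally show ?thesis by simp
  qed
  then have tangent: "inner (v - integral\<^sup>L M \<xi>) (0, ?d) \<le> 0" by (rule field_le_epsilon)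
  have conv: "comb y t (a, (1 - r) *\<^sub>R u + r *\<^sub>R u') \<le> (1 - r) * comb y t (a, u) + r * comb y t (a, u')"
    if "t \<in> space M" "(a, u) \<in> ?K" "(a, u') \<in> ?K" "0 \<le> r" "r \<le> 1" for t a u u' r
  proof -
    have "comb y t (a, (1 - r) *\<^sub>R u + r *\<^sub>R u') \<le> (\<Sum>i\<in>UNIV. y $ i * ((1 - r) * h i t (a, u) + r * h i t (a, u')))"
      unfolding comb_def using convex[OF that] y by (intro sum_mono mult_left_mono) auto
    also have "\<dots> = (1 - r) * comb y t (a, u) + r * comb y t (a, u')"
      unfolding comb_def sum_distrib_left sum.distrib[symmetric] by (intro sum.cong) (auto simp: algebra_simps)
    finally show ?thesis .
  qed
  have "AE t in M. inner (\<xi> t) (0, ?d) \<le> comb y t (x, z') - comb y t (x, z)"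
    using sub AE_space
  proof eventually_elim
    case (elim t)
    show ?case
      using limiting_proximal_subgradient_partially_convex[OF elim(1) C.phi_continuous[OF elim(2)] convex_cball _ wK conv[OF elim(2)]]
        slater_near by simp
  qed
  then have "(\<integral>t. inner (\<xi> t) (0, ?d) \<partial>M) \<le> (\<integral>t. comb y t (x, z') - comb y t (x, z) \<partial>M)"
    using \<xi> C.phi_integrable[OF zK] C.phi_integrable[OF wK]
    by (intro integral_mono_AE integrable_inner_left Bochner_Integration.integrable_diff)
  also have "\<dots> = C.E (x, z') - C.E (x, z)"
    unfolding C.E_def using C.phi_integrable[OF zK] C.phi_integrable[OF wK] by (rule Bochner_Integration.integral_diff)
  also have "\<dots> = (\<Sum>i\<in>UNIV. y $ i * Eh i (x, z'))"
    unfolding E_comb[OF zK] E_comb[OF wK] by (simp add: active)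
  finally have "inner (integral\<^sup>L M \<xi>) (0, ?d) \<le> (\<Sum>i\<in>UNIV. y $ i * Eh i (x, z'))"
    using integral_inner_left[OF \<xi>] by simp
  then show ?thesis using tangent unfolding inner_diff_left by linarith
qed

lemma slater_combination_neg:
  assumes "\<And>i. 0 \<le> y $ i" "0 \<le> (\<Sum>i\<in>UNIV. y $ i * Eh i (x, z'))"
  shows "y = 0"
proof -
  have le: "y $ i * Eh i (x, z') \<le> 0" for i
    using assms(1)[of i] slater[of i] by (simp add: mult_le_0_iff)
  then have "(\<Sum>i\<in>UNIV. - (y $ i * Eh i (x, z'))) = 0"
    using assms(2) sum_nonpos[of UNIV "\<lambda>i. y $ i * Eh i (x, z')"] by (simp add: sum_negf)
  then have "y $ i * Eh i (x, z') = 0" for i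
    using le by (subst (asm) sum_nonneg_eq_0_iff) auto
  then have "y $ i = 0" for i using slater[of i] by (metis less_irrefl mult_eq_0_iff)
  then show ?thesis by (simp add: vec_eq_iff)
qed

text \<open>For \<open>v = 0\<close> the Slater bound asserts that a nonnegative combination of the negative numbers \<open>Eh i (x, z')\<close> is nonnegative,
hence \<open>y = 0\<close>. This is the constraint qualification of the multiplier rule.\<close>

theorem feasible_set_normals:
  assumes S: "S \<subseteq> \<Omega>" "\<And>u. u \<in> cball (x, z) \<eta> \<Longrightarrow> u \<in> S \<longleftrightarrow> u \<in> \<Omega> \<and> (\<forall>i. Eh i u \<le> 0)"
    and v: "v \<in> normal_cone (x, z) S"
  obtains y \<xi> where "\<And>i. 0 \<le> y $ i" "integrable M \<xi>"
    "AE t in M. \<xi> t \<in> limiting_proximal_subgradients (cball (x, z) \<eta>) (comb y t) (x, z)"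
    "v - integral\<^sup>L M \<xi> \<in> normal_cone (x, z) \<Omega>"
proof -
  obtain X Y where X: "X \<longlonglongrightarrow> (x, z)" and Y: "Y \<longlonglongrightarrow> v" and
    R: "\<And>k::nat. Y k \<in> regular_normal_cone (X k) S"
    using v unfolding normal_cone_def by blast
  have XS: "X k \<in> S" for k using R[of k] by (simp add: regular_normal_cone_iff)
  have X\<Omega>: "X k \<in> \<Omega>" for k using XS S(1) by blast
  have Xneg: "Eh i (X k) \<le> 0" if "X k \<in> cball (x, z) \<eta>" for k i using XS[of k] S(2)[OF that] by simp
  have normal: "\<exists>d>0. \<forall>u\<in>\<Omega>. norm (u - X k) < d \<longrightarrow> (\<forall>i. Eh i u \<le> 0) \<longrightarrow>
      inner (Y k) (u - X k) \<le> \<epsilon> * norm (u - X k)" if "\<epsilon> > 0" "X k \<in> ball (x, z) \<eta>" for k \<epsilon>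
  proof -
    have "\<exists>d>0. \<forall>u\<in>S. norm (u - X k) < d \<longrightarrow> inner (Y k) (u - X k) \<le> \<epsilon> * norm (u - X k)"
      using R[of k] that(1) by (simp add: regular_normal_cone_iff)
    then obtain d where "d > 0" and
      d: "\<And>u. u \<in> S \<Longrightarrow> norm (u - X k) < d \<Longrightarrow> inner (Y k) (u - X k) \<le> \<epsilon> * norm (u - X k)" by blast
    have "inner (Y k) (u - X k) \<le> \<epsilon> * norm (u - X k)"
      if u: "u \<in> \<Omega>" "norm (u - X k) < min d (\<eta> - dist (x, z) (X k))" "\<forall>i. Eh i u \<le> 0" for u
    proof -
      have "dist (X k) u < \<eta> - dist (x, z) (X k)" using u(2) by (simp add: dist_norm norm_minus_commute)
      then have "u \<in> cball (x, z) \<eta>" using dist_triangle[of "(x, z)" u "X k"] by simp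
      then have "u \<in> S" using S(2) u(1,3) by simp
      then show ?thesis using d u(2) by simp
    qed
    moreover have "0 < min d (\<eta> - dist (x, z) (X k))" using \<open>d > 0\<close> that(2) by simp
    ultimately show ?thesis by blast
  qed
  have CQ: False if "\<And>i. 0 \<le> y $ i" "y \<noteq> 0" "integrable M \<xi>"
    "AE t in M. \<xi> t \<in> limiting_proximal_subgradients (cball (x, z) \<eta>) (comb y t) (x, z)"
    "- integral\<^sup>L M \<xi> \<in> normal_cone (x, z) \<Omega>" for y \<xi>
  proof -
    have "0 - integral\<^sup>L M \<xi> \<in> normal_cone (x, z) \<Omega>" using that(5) by simp
    from multiplier_slater_bound[OF that(1,3,4) this]
    have "0 \<le> (\<Sum>i\<in>UNIV. y $ i * Eh i (x, z'))" by simp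
    then show False using slater_combination_neg[of y] that(1,2) by blast
  qed
  show ?thesis
  proof (rule multiplier_rule[OF closed_local X\<Omega> Xneg X Y normal CQ])
    fix y \<xi>
    assume "\<And>i. 0 \<le> y $ i" "integrable M \<xi>"
      "AE t in M. \<xi> t \<in> limiting_proximal_subgradients (cball (x, z) \<eta>) (comb y t) (x, z)"
      "v - integral\<^sup>L M \<xi> \<in> normal_cone (x, z) \<Omega>"
    then show ?thesis by (rule that)
  qed
qed

text \<open>The vector \<open>(a, 0)\<close> is orthogonal to \<open>(0, z' - z)\<close>, so the Slater bound forces \<open>y = 0\<close>; the weighted integrand is
then zero and so are its subgradients.\<close>

corollary feasible_set_horizontal_normals:
  assumes S: "S \<subseteq> \<Omega>" "\<And>u. u \<in> cball (x, z) \<eta> \<Longrightarrow> u \<in> S \<longleftrightarrow> u \<in> \<Omega> \<and> (\<forall>i. Eh i u \<le> 0)"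
    and v: "(a, 0) \<in> normal_cone (x, z) S"
  shows "(a, 0) \<in> normal_cone (x, z) \<Omega>"
proof (rule feasible_set_normals[OF S v])
  fix y \<xi>
  assume y: "\<And>i. 0 \<le> y $ i" and \<xi>: "integrable M \<xi>"
    "AE t in M. \<xi> t \<in> limiting_proximal_subgradients (cball (x, z) \<eta>) (comb y t) (x, z)"
    "(a, 0) - integral\<^sup>L M \<xi> \<in> normal_cone (x, z) \<Omega>"
  have "inner (a, 0) (0, z' - z) \<le> (\<Sum>i\<in>UNIV. y $ i * Eh i (x, z'))"
    by (rule multiplier_slater_bound[OF y \<xi>])
  then have "y = 0" using y by (intro slater_combination_neg) simp_all
  then have "comb y t = (\<lambda>_. 0)" for t by (simp add: comb_def fun_eq_iff)
  then have "AE t in M. \<xi> t = 0"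
    using \<xi>(2) limiting_proximal_subgradient_zero_function[OF eta_pos] by (auto elim!: eventually_mono)
  then have "integral\<^sup>L M \<xi> = 0" by (rule integral_eq_zero_AE)
  then show ?thesis using \<xi>(3) by simp
qed

lemma closed_feasible_set:
  assumes S: "S \<subseteq> \<Omega>" "\<And>u. u \<in> cball (x, z) \<eta> \<Longrightarrow> u \<in> S \<longleftrightarrow> u \<in> \<Omega> \<and> (\<forall>i. Eh i u \<le> 0)"
  shows "closed (S \<inter> cball (x, z) \<eta>)"
proof -
  have cl: "closed (cball (x, z) \<eta> \<inter> Eh i -` {..0})" for i
    by (intro continuous_closed_preimage lipschitz_on_continuous_on[OF Eh_lipschitz]) auto
  have eq: "S \<inter> cball (x, z) \<eta> = (\<Omega> \<inter> cball (x, z) \<eta>) \<inter> (\<Inter>i. cball (x, z) \<eta> \<inter> Eh i -` {..0})"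
    using S by auto
  show ?thesis unfolding eq by (intro closed_Int closed_local closed_INT cl ballI)
qed

end

section \<open>Extended-real expectations\<close>

lemma ereal_integral_eq_integral:
  assumes h: "integrable M h" and f: "AE t in M. f t = ereal (h t)"
  shows "ereal_integral M f = ereal (integral\<^sup>L M h)"
proof -
  have pos: "(\<integral>\<^sup>+ t. e2ennreal (f t) \<partial>M) = (\<integral>\<^sup>+ t. ennreal (h t) \<partial>M)"
    by (rule nn_integral_cong_AE) (use f in \<open>auto elim!: eventually_mono\<close>)
  have neg: "(\<integral>\<^sup>+ t. e2ennreal (- f t) \<partial>M) = (\<integral>\<^sup>+ t. ennreal (- h t) \<partial>M)"
    by (rule nn_integral_cong_AE) (use f in \<open>auto elim!: eventually_mono\<close>)
  have fin: "(\<integral>\<^sup>+ t. ennreal (h t) \<partial>M) \<noteq> \<infinity>" "(\<integral>\<^sup>+ t. ennreal (- h t) \<partial>M) \<noteq> \<infinity>"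
    using h by (auto simp: real_integrable_def)
  have conv: "enn2ereal a = ereal (enn2real a)" if "a \<noteq> \<infinity>" for a
    using that by (cases a) auto
  show ?thesis
    unfolding ereal_integral_def pos neg using fin
    by (simp add: conv real_lebesgue_integral_def[OF h])
qed

text \<open>Since \<open>\<infinity> - \<infinity> = \<infinity>\<close>, an infinite positive part makes the whole integral infinite.\<close>

lemma ereal_integral_less_infty:
  assumes "ereal_integral M f < \<infinity>"
  shows "(\<integral>\<^sup>+ t. e2ennreal (f t) \<partial>M) < \<infinity>"
proof (rule ccontr)
  assume "\<not> ?thesis"
  then have "(\<integral>\<^sup>+ t. e2ennreal (f t) \<partial>M) = top" by (simp add: top.not_eq_extremum[symmetric])
  then have "ereal_integral M f = \<infinity>" by (simp add: ereal_integral_def)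
  then show False using assms by simp
qed

lemma ereal_integral_finite_integrable:
  assumes meas: "f \<in> borel_measurable M" and fin: "AE t in M. \<bar>f t\<bar> \<noteq> \<infinity>" and "\<bar>ereal_integral M f\<bar> \<noteq> \<infinity>"
  shows "integrable M (\<lambda>t. real_of_ereal (f t))"
  unfolding real_integrable_def
proof (intro conjI)
  show "(\<lambda>t. real_of_ereal (f t)) \<in> borel_measurable M" using meas by measurable
  have pos: "(\<integral>\<^sup>+ t. e2ennreal (f t) \<partial>M) = (\<integral>\<^sup>+ t. ennreal (real_of_ereal (f t)) \<partial>M)"
    by (rule nn_integral_cong_AE)
      (use fin in \<open>auto elim!: eventually_mono simp flip: e2ennreal_ereal simp: ereal_real\<close>)
  have neg: "(\<integral>\<^sup>+ t. e2ennreal (- f t) \<partial>M) = (\<integral>\<^sup>+ t. ennreal (- real_of_ereal (f t)) \<partial>M)"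
    by (rule nn_integral_cong_AE)
      (use fin in \<open>auto elim!: eventually_mono simp flip: e2ennreal_ereal uminus_ereal.simps(1) simp: ereal_real\<close>)
  have "(\<integral>\<^sup>+ t. e2ennreal (f t) \<partial>M) < \<infinity>"
    using assms(3) by (intro ereal_integral_less_infty) auto
  then show p: "(\<integral>\<^sup>+ t. ennreal (real_of_ereal (f t)) \<partial>M) \<noteq> \<infinity>" using pos by simp
  show "(\<integral>\<^sup>+ t. ennreal (- real_of_ereal (f t)) \<partial>M) \<noteq> \<infinity>"
  proof
    assume "(\<integral>\<^sup>+ t. ennreal (- real_of_ereal (f t)) \<partial>M) = \<infinity>"
    then have "\<bar>ereal_integral M f\<bar> = \<infinity>"
      unfolding ereal_integral_def pos neg using p
      by (cases "\<integral>\<^sup>+ t. ennreal (real_of_ereal (f t)) \<partial>M") auto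
    then show False using assms(3) by simp
  qed
qed

lemma normal_integrand_section_measurable:
  fixes g :: "'t \<Rightarrow> 'a::second_countable_topology \<Rightarrow> ereal"
  assumes "normal_integrand M g"
  shows "(\<lambda>t. g t u) \<in> borel_measurable M"
proof -
  have "(\<lambda>(t, u). g t u) \<in> borel_measurable (M \<Otimes>\<^sub>M borel)"
    using assms by (simp add: normal_integrand_def)
  from measurable_compose[OF measurable_Pair2'[of u borel M] this] show ?thesis by simp
qed

lemma real_of_ereal_convex:
  assumes "ereal_convex f" "0 \<le> r" "r \<le> 1"
    and "\<bar>f u\<bar> \<noteq> \<infinity>" "\<bar>f v\<bar> \<noteq> \<infinity>" "\<bar>f ((1 - r) *\<^sub>R u + r *\<^sub>R v)\<bar> \<noteq> \<infinity>"
  shows "real_of_ereal (f ((1 - r) *\<^sub>R u + r *\<^sub>R v)) \<le> (1 - r) * real_of_ereal (f u) + r * real_of_ereal (f v)"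
proof -
  have "f ((1 - r) *\<^sub>R u + r *\<^sub>R v) \<le> ereal (1 - r) * f u + ereal r * f v"
    using assms(1-3) by (simp add: ereal_convex_def)
  moreover obtain a b c where "f u = ereal a" "f v = ereal b" "f ((1 - r) *\<^sub>R u + r *\<^sub>R v) = ereal c"
    using assms(4-6) by (metis ereal_real')
  ultimately show ?thesis by simp
qed

text \<open>This moves a strict inequality from a distant point, where the integrand may be infinite and not
obviously integrable, to an intermediate one. The positive part of \<open>f0\<close> has a finite integral as the integral
of \<open>f0\<close> is below \<open>\<infinity>\<close>, and solving the convexity inequality for \<open>f0\<close> bounds its negative part.\<close>

lemma integral_neg_between:
  fixes f0 :: "'t \<Rightarrow> ereal"
  assumes f0: "f0 \<in> borel_measurable M" "AE t in M. f0 t \<noteq> -\<infinity>" "ereal_integral M f0 < 0"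
    and hb: "integrable M hb" "integral\<^sup>L M hb = 0" and hs: "integrable M hs" and r: "0 < r"
    and le: "AE t in M. ereal (hs t) \<le> ereal (1 - r) * ereal (hb t) + ereal r * f0 t"
  shows "integral\<^sup>L M hs < 0"
proof -
  define h0 where "h0 t = real_of_ereal (f0 t)" for t
  have meas: "h0 \<in> borel_measurable M" unfolding h0_def using f0(1) by measurable
  have "(\<integral>\<^sup>+ t. e2ennreal (f0 t) \<partial>M) < \<infinity>"
    using f0(3) by (intro ereal_integral_less_infty) (auto intro: less_trans)
  then have "AE t in M. e2ennreal (f0 t) \<noteq> \<infinity>"
    using f0(1) by (intro nn_integral_PInf_AE) auto
  with f0(2) have f0h: "AE t in M. f0 t = ereal (h0 t)"
  proof eventually_elim
    case (elim t)
    then show ?case by (cases "f0 t") (auto simp: h0_def)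
  qed
  have le': "AE t in M. hs t \<le> (1 - r) * hb t + r * h0 t"
    using le f0h by eventually_elim simp
  have "integrable M h0"
    unfolding real_integrable_def
  proof (intro conjI meas)
    have "(\<integral>\<^sup>+ t. ennreal (h0 t) \<partial>M) = (\<integral>\<^sup>+ t. e2ennreal (f0 t) \<partial>M)"
      by (rule nn_integral_cong_AE) (use f0h in \<open>auto elim!: eventually_mono\<close>)
    then show "(\<integral>\<^sup>+ t. ennreal (h0 t) \<partial>M) \<noteq> \<infinity>"
      using \<open>(\<integral>\<^sup>+ t. e2ennreal (f0 t) \<partial>M) < \<infinity>\<close> by simp
    have "integrable M (\<lambda>t. ((1 - r) * hb t - hs t) / r)" using hb hs by simp
    then have "(\<integral>\<^sup>+ t. ennreal (((1 - r) * hb t - hs t) / r) \<partial>M) \<noteq> \<infinity>"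
      unfolding real_integrable_def by blast
    moreover have "(\<integral>\<^sup>+ t. ennreal (- h0 t) \<partial>M) \<le> (\<integral>\<^sup>+ t. ennreal (((1 - r) * hb t - hs t) / r) \<partial>M)"
    proof (rule nn_integral_mono_AE)
      show "AE t in M. ennreal (- h0 t) \<le> ennreal (((1 - r) * hb t - hs t) / r)"
        using le'
      proof eventually_elim
        case (elim t)
        then have "- h0 t * r \<le> (1 - r) * hb t - hs t" by (simp add: mult.commute)
        then show ?case using r by (intro ennreal_leI) (simp add: pos_le_divide_eq)
      qed
    qed
    ultimately show "(\<integral>\<^sup>+ t. ennreal (- h0 t) \<partial>M) \<noteq> \<infinity>" by (auto simp: top_unique)
  qed
  then have "ereal_integral M f0 = ereal (integral\<^sup>L M h0)" using f0h by (rule ereal_integral_eq_integral)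
  then have "integral\<^sup>L M h0 < 0" using f0(3) by simp
  have "integral\<^sup>L M hs \<le> (\<integral>t. (1 - r) * hb t + r * h0 t \<partial>M)"
    using \<open>integrable M h0\<close> hb hs le' by (intro integral_mono_AE) auto
  also have "\<dots> = r * integral\<^sup>L M h0" using \<open>integrable M h0\<close> hb by simp
  also have "\<dots> < 0" using r \<open>integral\<^sup>L M h0 < 0\<close> by (rule mult_pos_neg)
  finally show ?thesis .
qed

lemma nonneg_in_normal_cone_nonpos:
  fixes y :: "real ^ 'm"
  assumes "\<And>i. 0 \<le> y $ i"
  shows "y \<in> normal_cone 0 {y :: real ^ 'm. y \<le> 0}"
proof -
  have "inner y u \<le> 0" if "u \<le> 0" for u :: "real ^ 'm"
    unfolding inner_vec_def using assms that by (intro sum_nonpos) (simp add: less_eq_vec_def mult_nonneg_nonpos)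
  then have "inner y u \<le> e * norm u" if "u \<le> 0" "e > 0" for u :: "real ^ 'm" and e
    using that order_trans[of "inner y u" 0 "e * norm u"] by simp
  then have "y \<in> regular_normal_cone 0 {y. y \<le> 0}"
    unfolding regular_normal_cone_iff by (auto intro: exI[of _ 1])
  then show ?thesis unfolding normal_cone_def
    by (intro CollectI exI[of _ "\<lambda>_. 0"] exI[of _ "\<lambda>_. y"] conjI tendsto_const allI)
qed

section \<open>The stochastic constraint multifunction\<close>

theorem theorem4p9:
  fixes M :: "'t measure"
    and g :: "'m::finite \<Rightarrow> 't \<Rightarrow> (real ^ 'n) \<times> (real ^ 'q) \<Rightarrow> ereal"
    and G F :: "real ^ 'n \<Rightarrow> (real ^ 'q) set"
    and xbar :: "real ^ 'n" and zbar :: "real ^ 'q"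
  defines "F \<equiv> \<lambda>x. {z. expected_vec M g (x, z) \<le> 0 \<and> z \<in> G x}"
  assumes "finite_measure M" and "complete_measure M"
    and "\<And>i. normal_integrand M (g i)"
    and "closed (gph G)"
    and "(xbar, zbar) \<in> gph F"
    and "\<And>i. locally_Lipschitzian_integrand M (g i) (xbar, zbar)"
    and "\<And>i t x. t \<in> space M \<Longrightarrow> ereal_convex (\<lambda>z. g i t (x, z))"
    and "convex (G xbar)" and "normally_regular (gph G) (xbar, zbar)"
    and "\<exists>z0 \<in> G xbar - {zbar}. \<forall>i. expected M (g i) (xbar, z0) < 0"
    and "\<And>i. expected M (g i) (xbar, zbar) = 0"
  shows "(\<forall>zs xs. xs \<in> coderivative F xbar zbar zs \<longrightarrow>
            (\<exists>ys us vs.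
               ys \<in> normal_cone (\<chi> i. real_of_ereal (expected_vec M g (xbar, zbar) $ i))
                       {y :: real ^ 'm. y \<le> 0} \<and>
               - us \<in> coderivative G xbar zbar vs \<and>
               (xs + us, - zs + vs) \<in>
                 aumann_integral M
                   (\<lambda>t. subdiff (scalarization ys (\<lambda>i. g i t)) (xbar, zbar))))
         \<and> (Lipschitz_like G xbar zbar \<longrightarrow> Lipschitz_like F xbar zbar)"
proof -
  interpret finite_measure M by fact
  note normal = assms(4) and G_closed = assms(5) and wF = assms(6) and loc_lip = assms(7)
    and g_convex = assms(8) and G_convex = assms(9) and G_regular = assms(10) and E_zero = assms(12)
  let ?w = "(xbar, zbar)"
  obtain z0 where z0: "z0 \<in> G xbar" "z0 \<noteq> zbar" "\<And>i. expected M (g i) (xbar, z0) < 0"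
    using assms(11) by blast
  have g_meas: "(\<lambda>t. g i t u) \<in> borel_measurable M" for i u
    by (rule normal_integrand_section_measurable[OF normal])

  have "\<forall>i. \<exists>\<eta> (l :: 't \<Rightarrow> real) T'. \<eta> > 0 \<and> integrable M l \<and>
        T' \<in> sets M \<and> emeasure M (space M - T') = 0 \<and>
        (\<forall>t\<in>T'. (\<forall>u\<in>cball ?w \<eta>. \<bar>g i t u\<bar> \<noteq> \<infinity>) \<and>
                 (l t)-lipschitz_on (cball ?w \<eta>) (\<lambda>u. real_of_ereal (g i t u)))"
    using loc_lip unfolding locally_Lipschitzian_integrand_def by (intro allI)
  then obtain \<eta>' and l' :: "'m \<Rightarrow> 't \<Rightarrow> real" and T' where
    eta': "\<And>i. \<eta>' i > 0" and l': "\<And>i. integrable M (l' i)" and T': "\<And>i. T' i \<in> sets M"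
    "\<And>i. emeasure M (space M - T' i) = 0" and
    finite': "\<And>i t u. t \<in> T' i \<Longrightarrow> u \<in> cball ?w (\<eta>' i) \<Longrightarrow> \<bar>g i t u\<bar> \<noteq> \<infinity>" and
    lip': "\<And>i t. t \<in> T' i \<Longrightarrow> (l' i t)-lipschitz_on (cball ?w (\<eta>' i)) (\<lambda>u. real_of_ereal (g i t u))"
    by metis
  \<comment> \<open>one ball, one Lipschitz function and one set of full measure for all the integrands\<close>
  define \<eta> where "\<eta> = Min (range \<eta>')"
  have "\<eta> > 0" unfolding \<eta>_def using eta' by (subst Min_gr_iff) auto
  have sub_ball: "cball ?w \<eta> \<subseteq> cball ?w (\<eta>' i)" for i
    unfolding \<eta>_def by (intro subset_cball Min_le) auto
  define T where "T = (\<Inter>i. T' i)"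
  have T[measurable]: "T \<in> sets M" unfolding T_def using T'(1) by (intro sets.finite_INT) auto
  have T_space: "T \<subseteq> space M" using T by (rule sets.sets_into_space)
  have AE_T: "AE t in M. t \<in> T"
  proof -
    have "AE t in M. t \<in> T' i" for i
      by (rule AE_I[of _ _ "space M - T' i"]) (use T' in auto)
    then have "AE t in M. \<forall>i\<in>UNIV. t \<in> T' i" by (intro AE_finite_allI) auto
    then show ?thesis by (simp add: T_def)
  qed
  define l where "l t = (if t \<in> T then \<Sum>i\<in>UNIV. l' i t else 0)" for t
  \<comment> \<open>real-valued versions; the value \<open>0\<close> outside of \<open>T\<close> makes the assumptions hold for every \<open>t\<close>\<close>
  define h where "h i t u = (if t \<in> T then real_of_ereal (g i t u) else 0)" for i t u
  have g_finite: "\<bar>g i t u\<bar> \<noteq> \<infinity>" if "t \<in> T" "u \<in> cball ?w \<eta>" for i t u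
    using that sub_ball[of i] by (intro finite'[of t i]) (auto simp: T_def)
  have g_eq: "g i t u = ereal (h i t u)" if "t \<in> T" "u \<in> cball ?w \<eta>" for i t u
    using g_finite[OF that, of i] that(1) by (simp add: h_def ereal_real')
  have h_meas: "(\<lambda>t. h i t u) \<in> borel_measurable M" for i u
    unfolding h_def using g_meas[of i u] by measurable
  have wK: "?w \<in> cball ?w \<eta>" using \<open>\<eta> > 0\<close> by simp
  have AE_g: "AE t in M. g i t u = ereal (h i t u)" if "u \<in> cball ?w \<eta>" for i u
    using AE_T by (rule eventually_mono) (rule g_eq[OF _ that])
  have h_center: "integrable M (\<lambda>t. h i t ?w)" for i
  proof -
    have "integrable M (\<lambda>t. real_of_ereal (g i t ?w))"
    proof (rule ereal_integral_finite_integrable[OF g_meas])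
      show "AE t in M. \<bar>g i t ?w\<bar> \<noteq> \<infinity>" using AE_g[OF wK, of i] by (auto elim!: eventually_mono)
      show "\<bar>ereal_integral M (\<lambda>t. g i t ?w)\<bar> \<noteq> \<infinity>" using E_zero[of i] by (simp add: expected_def)
    qed
    then show ?thesis
    proof (rule integrable_cong_AE_imp[OF _ h_meas])
      show "AE t in M. real_of_ereal (g i t ?w) = h i t ?w"
        using AE_g[OF wK, of i] by (auto elim!: eventually_mono)
    qed
  qed
  have lip: "lipschitz_integrand M (h i) l ?w \<eta>" for i
  proof unfold_locales
    show "\<eta> > 0" by fact
    show "(\<lambda>t. h i t u) \<in> borel_measurable M" for u by (rule h_meas)
    show "integrable M (\<lambda>t. h i t ?w)" by (rule h_center)
    have "integrable M (\<lambda>t. indicator T t *\<^sub>R (\<Sum>i\<in>UNIV. l' i t))"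
      using l' by (intro integrable_mult_indicator T Bochner_Integration.integrable_sum)
    also have "(\<lambda>t. indicator T t *\<^sub>R (\<Sum>i\<in>UNIV. l' i t)) = l" by (auto simp: l_def fun_eq_iff)
    finally show "integrable M l" .
    show "(l t)-lipschitz_on (cball ?w \<eta>) (h i t)" for t
    proof (cases "t \<in> T")
      case False
      then show ?thesis by (simp add: l_def h_def lipschitz_on_def)
    next
      case True
      then have "0 \<le> l' j t" for j using lip'[of t j] by (auto simp: T_def lipschitz_on_def)
      then have "l' i t \<le> l t" using True using member_le_sum[of i UNIV "\<lambda>j. l' j t"] by (simp add: l_def)
      moreover have "(l' i t)-lipschitz_on (cball ?w \<eta>) (\<lambda>u. real_of_ereal (g i t u))"
        by (rule lipschitz_on_subset[OF lip' sub_ball]) (use True in \<open>auto simp: T_def\<close>)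
      ultimately have "(l t)-lipschitz_on (cball ?w \<eta>) (\<lambda>u. real_of_ereal (g i t u))"
        by (rule lipschitz_on_le[rotated])
      then show ?thesis using True by (simp add: h_def[abs_def])
    qed
  qed
  interpret L: lipschitz_integrands M h l ?w \<eta>
    by (intro lipschitz_integrands.intro lipschitz_integrands_axioms.intro finite_measure_axioms lip)
  have expected_eq: "expected M (g i) u = ereal (L.Eh i u)" if "u \<in> cball ?w \<eta>" for i u
    unfolding expected_def L.Eh_def using L.h_integrable[OF that] AE_g[OF that] by (rule ereal_integral_eq_integral)
  have E_w: "L.Eh i ?w = 0" for i using expected_eq[OF wK, of i] E_zero[of i] by simp

  \<comment> \<open>the Slater point is moved along the segment towards \<open>zbar\<close> into the ball on which the integrands are finite\<close>
  define r where "r = min 1 (\<eta> / (2 * norm (z0 - zbar)))"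
  have nz: "norm (z0 - zbar) > 0" using z0(2) by simp
  have r: "0 < r" "r \<le> 1" using \<open>\<eta> > 0\<close> nz by (auto simp: r_def)
  define z1 where "z1 = (1 - r) *\<^sub>R zbar + r *\<^sub>R z0"
  have z1_diff: "z1 - zbar = r *\<^sub>R (z0 - zbar)" by (simp add: z1_def algebra_simps)
  have "norm (z1 - zbar) \<le> \<eta> / (2 * norm (z0 - zbar)) * norm (z0 - zbar)"
    unfolding z1_diff norm_scaleR using r by (intro mult_right_mono) (auto simp: r_def)
  also have "\<dots> < \<eta>" using nz \<open>\<eta> > 0\<close> by simp
  finally have z1_ball: "(xbar, z1) \<in> ball ?w \<eta>"
    by (simp add: dist_Pair_Pair dist_norm norm_minus_commute)
  then have z1K: "(xbar, z1) \<in> cball ?w \<eta>" by simp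
  have E_z1: "L.Eh i (xbar, z1) < 0" for i
    unfolding L.Eh_def
  proof (rule integral_neg_between)
    show "(\<lambda>t. g i t (xbar, z0)) \<in> borel_measurable M" by (rule g_meas)
    show "AE t in M. g i t (xbar, z0) \<noteq> -\<infinity>"
      using normal[of i] by (intro AE_I2) (auto simp: normal_integrand_def)
    show "ereal_integral M (\<lambda>t. g i t (xbar, z0)) < 0" using z0(3)[of i] by (simp add: expected_def)
    show "integrable M (\<lambda>t. h i t ?w)" "integrable M (\<lambda>t. h i t (xbar, z1))"
      by (rule L.h_integrable[OF wK], rule L.h_integrable[OF z1K])
    show "(\<integral>t. h i t ?w \<partial>M) = 0" using E_w[of i] by (simp add: L.Eh_def)
    show "0 < r" by fact
    show "AE t in M. ereal (h i t (xbar, z1)) \<le> ereal (1 - r) * ereal (h i t ?w) + ereal r * g i t (xbar, z0)"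
      using AE_g[OF wK, of i] AE_g[OF z1K, of i] AE_space
    proof eventually_elim
      case (elim t)
      have "g i t (xbar, z1) \<le> ereal (1 - r) * g i t ?w + ereal r * g i t (xbar, z0)"
        using g_convex[OF elim(3), of i xbar] r unfolding ereal_convex_def z1_def by simp
      then show ?case using elim by simp
    qed
  qed

  interpret convex_lipschitz_constraints M h l xbar zbar \<eta> "gph G" z1
  proof unfold_locales
    show "closed (gph G \<inter> cball ?w \<eta>)" using G_closed by (intro closed_Int) auto
    show "normally_regular (gph G) ?w" by fact
    show "L.Eh i ?w = 0" "L.Eh i (xbar, z1) < 0" for i by (rule E_w, rule E_z1)
    show "(xbar, z1) \<in> ball ?w \<eta>" by fact
    have "zbar \<in> G xbar" using wF by (simp add: gph_def F_def)
    fix s :: real assume s: "0 \<le> s" "s \<le> 1"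
    have "s * r \<le> 1" using s r by (simp add: mult_le_one)
    have "zbar + s *\<^sub>R (z1 - zbar) = (1 - s * r) *\<^sub>R zbar + (s * r) *\<^sub>R z0"
      unfolding z1_diff by (simp add: algebra_simps)
    also have "\<dots> \<in> G xbar"
      using G_convex \<open>zbar \<in> G xbar\<close> z0(1) s r \<open>s * r \<le> 1\<close> by (simp add: convex_alt)
    finally show "(xbar, zbar + s *\<^sub>R (z1 - zbar)) \<in> gph G" by (simp add: gph_def)
  next
    fix i t and a :: "real ^ 'n" and u u' :: "real ^ 'q" and s :: real
    assume t: "t \<in> space M" and u: "(a, u) \<in> cball ?w \<eta>" "(a, u') \<in> cball ?w \<eta>" and s: "0 \<le> s" "s \<le> 1"
    have "(1 - s) *\<^sub>R (a, u) + s *\<^sub>R (a, u') \<in> cball ?w \<eta>"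
      using convex_cball[of ?w \<eta>] u s unfolding convex_alt by blast
    then have mid: "(a, (1 - s) *\<^sub>R u + s *\<^sub>R u') \<in> cball ?w \<eta>" by (simp add: scaleR_left_diff_distrib)
    show "h i t (a, (1 - s) *\<^sub>R u + s *\<^sub>R u') \<le> (1 - s) * h i t (a, u) + s * h i t (a, u')"
    proof (cases "t \<in> T")
      case True
      then show ?thesis
        using real_of_ereal_convex[OF g_convex[OF t] s g_finite[OF True u(1)] g_finite[OF True u(2)] g_finite[OF True mid]]
        by (simp add: h_def)
    qed (simp add: h_def)
  qed

  have F_sub: "gph F \<subseteq> gph G" by (auto simp: gph_def F_def)
  have F_iff: "u \<in> gph F \<longleftrightarrow> u \<in> gph G \<and> (\<forall>i. L.Eh i u \<le> 0)" if "u \<in> cball ?w \<eta>" for u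
    using expected_eq[OF that] by (cases u) (auto simp: gph_def F_def expected_vec_def less_eq_vec_def)

  have part1: "\<exists>ys us vs.
      ys \<in> normal_cone (\<chi> i. real_of_ereal (expected_vec M g ?w $ i)) {y :: real ^ 'm. y \<le> 0} \<and>
      - us \<in> coderivative G xbar zbar vs \<and>
      (xs + us, - zs + vs) \<in> aumann_integral M (\<lambda>t. subdiff (scalarization ys (\<lambda>i. g i t)) ?w)"
    if "xs \<in> coderivative F xbar zbar zs" for xs zs
  proof (rule feasible_set_normals[OF F_sub F_iff])
    show "(xs, - zs) \<in> normal_cone ?w (gph F)" using that by (simp add: coderivative_def)
    fix y \<xi>
    assume y: "\<And>i. 0 \<le> y $ i" and \<xi>: "integrable M \<xi>"
      "AE t in M. \<xi> t \<in> limiting_proximal_subgradients (cball ?w \<eta>) (L.comb y t) ?w"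
      "(xs, - zs) - integral\<^sup>L M \<xi> \<in> normal_cone ?w (gph G)"
    interpret C: lipschitz_integrand M "L.comb y" "\<lambda>t. (\<Sum>i\<in>UNIV. \<bar>y $ i\<bar>) * l t" ?w \<eta>
      by (rule L.comb_lipschitz_integrand)
    define p q where "p = fst (integral\<^sup>L M \<xi>)" and "q = snd (integral\<^sup>L M \<xi>)"
    have pq: "integral\<^sup>L M \<xi> = (p, q)" by (simp add: p_def q_def)
    have "(\<chi> i. real_of_ereal (expected_vec M g ?w $ i)) = 0"
      by (simp add: expected_vec_def E_zero vec_eq_iff)
    then have "y \<in> normal_cone (\<chi> i. real_of_ereal (expected_vec M g ?w $ i)) {y :: real ^ 'm. y \<le> 0}"
      using nonneg_in_normal_cone_nonpos[of y] y by simp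
    moreover have "- (p - xs) \<in> coderivative G xbar zbar (zs + q)"
      using \<xi>(3) by (simp add: coderivative_def pq)
    moreover have "(xs + (p - xs), - zs + (zs + q)) \<in> aumann_integral M (\<lambda>t. subdiff (scalarization y (\<lambda>i. g i t)) ?w)"
    proof -
      have "AE t in M. \<xi> t \<in> subdiff (scalarization y (\<lambda>i. g i t)) ?w"
        using \<xi>(2) AE_T
      proof eventually_elim
        case (elim t)
        have "scalarization y (\<lambda>i. g i t) u = ereal (L.comb y t u)" if "u \<in> cball ?w \<eta>" for u
          using g_eq[OF elim(2) that] by (simp add: scalarization_def L.comb_def)
        moreover have "continuous_on (cball ?w \<eta>) (L.comb y t)"
          using C.phi_continuous elim(2) T_space by blast
        ultimately show ?case
          using limiting_proximal_subgradients_subset_subdiff[OF \<open>\<eta> > 0\<close>] elim(1) by blast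
      qed
      then have "(p, q) \<in> aumann_integral M (\<lambda>t. subdiff (scalarization y (\<lambda>i. g i t)) ?w)"
        unfolding aumann_integral_def using \<xi>(1) pq by (auto intro!: exI[of _ \<xi>])
      then show ?thesis by simp
    qed
    ultimately show ?thesis by blast
  qed

  have part2: "Lipschitz_like F xbar zbar" if G_lip: "Lipschitz_like G xbar zbar"
  proof (rule Lipschitz_like_if_normal_cone_trivial[OF wF closed_feasible_set[OF F_sub F_iff] \<open>\<eta> > 0\<close>])
    fix v assume v: "(v, 0) \<in> normal_cone ?w (gph F)"
    have "(v, 0) \<in> normal_cone ?w (gph G)" by (rule feasible_set_horizontal_normals[OF F_sub F_iff v])
    then show "v = 0" by (rule Lipschitz_like_normal_cone_trivial[OF G_lip])
  qed
  show ?thesis using part1 part2 by blast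
qed

end
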